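(* Let $V,W:\mathbb R\to\mathbb R$ be continuous functions, bounded from below, with $V(x)\to\infty$ and $W(x)\to\infty$ as $x\to\pm\infty$, and with $V(x)=V(-x)$ and $W(x)=W(-x)$ for all $x\in\mathbb R$. If $E_n(V)=E_n(W)$ for all $n$, then $V=W$.
   Context: For a continuous function $V$ on $\mathbb R$ tending to $+\infty$ at $\pm\infty$, the self-adjoint operator $-\frac{d^2}{dx^2}+V$ on $L^2(\mathbb R)$ has purely discrete simple spectrum, and $E_0(V)<E_1(V)<E_2(V)<\cdots$ denote its eigenvalues in increasing order. *)

theory Defs
  imports "HOL-Analysis.Analysis"
begin

text \<open>
  Elements of the complex Hilbert space \<open>L\<^sup>2(\<real>)\<close> are handled through representatives:
  functions \<open>real \<Rightarrow> complex\<close>, identified when they agree almost everywhere.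
\<close>

definition square_integrable :: "(real \<Rightarrow> complex) \<Rightarrow> bool" where
  "square_integrable f \<longleftrightarrow>
     f \<in> borel_measurable lebesgue \<and> integrable lebesgue (\<lambda>x. (cmod (f x))\<^sup>2)"

text \<open>
  \<open>f\<close> is locally absolutely continuous on the line and \<open>h\<close> is (a version of) its almost everywhere
  derivative: \<open>h\<close> is locally Lebesgue integrable and \<open>f\<close> is an indefinite integral of \<open>h\<close>.
\<close>

definition has_ac_derivative :: "(real \<Rightarrow> complex) \<Rightarrow> (real \<Rightarrow> complex) \<Rightarrow> bool" where
  "has_ac_derivative f h \<longleftrightarrow>
     (\<forall>a b. a \<le> b \<longrightarrow> h absolutely_integrable_on {a..b} \<and> f b - f a = integral {a..b} h)"

text \<open>
  The graph of \<open>-d\<^sup>2/dx\<^sup>2 + V\<close> on its maximal domain: those \<open>f\<close> in \<open>L\<^sup>2(\<real>)\<close> with \<open>f\<close> and \<open>f'\<close> locally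
  absolutely continuous and \<open>-f'' + V f\<close> in \<open>L\<^sup>2(\<real>)\<close>.  For continuous \<open>V\<close> bounded from below both
  endpoints are in the limit point case, so no boundary conditions occur: this is the unique
  self-adjoint realization, namely the closure of the operator on compactly supported smooth
  functions.  The first component is always the continuous representative of its class.
\<close>

definition schroedinger_graph ::
    "(real \<Rightarrow> real) \<Rightarrow> ((real \<Rightarrow> complex) \<times> (real \<Rightarrow> complex)) set" where
  "schroedinger_graph V =
     {(f, g). square_integrable f \<and> square_integrable g \<and>
        (\<exists>f' f''. has_ac_derivative f f' \<and> has_ac_derivative f' f'' \<and>
           (AE x in lebesgue. g x = - f'' x + complex_of_real (V x) * f x))}"

text \<open>Only real numbers are considered, since eigenvalues of a self-adjoint operator are real.\<close>

definition eigenvalues :: "(real \<Rightarrow> real) \<Rightarrow> real set" where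
  "eigenvalues V =
     {e. \<exists>f. (f, \<lambda>x. complex_of_real e * f x) \<in> schroedinger_graph V \<and>
             \<not> (AE x in lebesgue. f x = 0)}"

text \<open>
  The increasing enumeration \<open>E\<^sub>0(V) < E\<^sub>1(V) < \<dots>\<close> of all eigenvalues.  A strictly increasing sequence
  is determined by its range, so the description is unique.  For continuous \<open>V\<close> tending to
  \<open>+\<infinity>\<close> at both ends such a sequence exists, as the spectrum is purely discrete, unbounded above
  and simple; by simplicity no multiplicities need to be counted.  For other potentials the value
  may be unspecified.
\<close>

definition eigenvalue_seq :: "(real \<Rightarrow> real) \<Rightarrow> nat \<Rightarrow> real" where
  "eigenvalue_seq V = (THE E. strict_mono E \<and> range E = eigenvalues V)"

end

theory Submission
  imports Defs "HOL-Complex_Analysis.Complex_Analysis"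
begin

text \<open>
  Let \<open>u\<close> be the solution of \<open>-u'' + V u = z u\<close> decaying at \<open>+\<infinity>\<close> and \<open>m(z) = u'(0) / u(0)\<close>.  By evenness
  the eigenvalues are the zeros (even eigenfunctions) and the poles (odd eigenfunctions) of the
  meromorphic function \<open>m\<close>.  Since \<open>m\<close> maps the upper half plane into itself, it is increasing on the
  real line and zeros and poles alternate, starting with a zero.  Hence for isospectral \<open>V\<close> and \<open>W\<close>
  the quotient \<open>m\<^sub>V / m\<^sub>W\<close> is entire without zeros, and it avoids the negative reals, so it is constant
  by Picard's theorem; \<open>m(-k\<^sup>2) \<sim> -k\<close> shows that the constant is \<open>1\<close>.

  The potential is recovered from \<open>m\<close> by Bennewitz' argument for the Borg-Marchenko theorem.  With
  the solutions \<open>\<theta>, \<phi>\<close> normalized at \<open>0\<close>, the entire function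
  \<open>\<phi>\<^sub>V \<theta>\<^sub>W - \<theta>\<^sub>V \<phi>\<^sub>W\<close> of \<open>z\<close> has order \<open>1/2\<close>.  It is bounded on the positive axis, where it tends to \<open>0\<close>, and
  also on the negative axis, because there it equals \<open>\<phi>\<^sub>V \<psi>\<^sub>W - \<psi>\<^sub>V \<phi>\<^sub>W\<close> with the
  exponentially small solutions \<open>\<psi> = \<theta> + m \<phi>\<close>.  By Phragmen-Lindelof and Liouville it
  vanishes, whence \<open>\<theta>\<^sub>V\<^sup>2 = \<theta>\<^sub>W\<^sup>2\<close> and \<open>V = W\<close>.
\<close>

section \<open>Second order linear equations on the line\<close>

text \<open>No spectral theory enters, and two obstacles result. \<open>eigenvalue_seq\<close> is a
  definite description, so equal sequences say something about the spectra only once each spectrum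
  is known to be infinite and finite below every bound. Infiniteness comes from function theory:
  with finitely many eigenvalues \<open>m\<close> would be holomorphic near infinity, where Picard's
  theorem leaves only integer powers of \<open>z\<close>, against \<open>m(-k^2)\<close> being of
  size \<open>k\<close>. Secondly, equal spectra do not say that a zero of one Weyl function is a
  zero, and not a pole, of the other. Instead of counting zeros and poles, the real function
  \<open>D = m / (1 + m^2)\<close> encodes the kind of an eigenvalue in the sign of its slope; the
  quotient of the two functions \<open>D\<close> extends to a continuous function on the line that
  never vanishes and is positive near minus infinity. In the last step the half plane version of
  Phragmen-Lindelof is available because order \<open>1/2\<close> is below \<open>1\<close>, and
  both half axes together form the common boundary of the two half planes.\<close>

lemma norm_diff_le_of_vector_derivative:
  fixes f :: "real \<Rightarrow> 'a::real_normed_vector"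
  assumes "a \<le> b"
    and f: "\<And>x. x \<in> {a..b} \<Longrightarrow> (f has_vector_derivative f' x) (at x)"
    and g: "\<And>x. x \<in> {a..b} \<Longrightarrow> (g has_real_derivative g' x) (at x)"
    and le: "\<And>x. x \<in> {a..b} \<Longrightarrow> norm (f' x) \<le> g' x"
  shows "norm (f b - f a) \<le> g b - g a"
proof (cases "a = b")
  case False
  have cf: "continuous_on {a..b} f"
    using f by (meson continuous_at_imp_continuous_on has_vector_derivative_continuous)
  have cg: "continuous_on {a..b} g"
    using g by (meson DERIV_isCont continuous_at_imp_continuous_on)
  show ?thesis
    by (rule differentiable_bound_general[where f' = f' and \<phi>' = g', OF _ cf cg])
      (use assms False in \<open>auto simp: has_real_derivative_iff_has_vector_derivative\<close>)
qed simp

lemma has_vector_derivative_reflect: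
  fixes f :: "real \<Rightarrow> 'a::real_normed_vector"
  assumes "(f has_vector_derivative f') (at (- y))"
  shows "((\<lambda>x. f (- x)) has_vector_derivative - f') (at y)"
proof -
  have "(uminus has_vector_derivative (-1::real)) (at y)"
    by (auto intro!: derivative_eq_intros)
  from vector_diff_chain_at[OF this assms] show ?thesis by (simp add: o_def)
qed

lemma antiderivative_exists:
  fixes f :: "real \<Rightarrow> complex"
  assumes "continuous_on UNIV f"
  obtains F where "\<And>x. (F has_vector_derivative f x) (at x)" "F 0 = 0"
proof -
  have "isCont f x" for x
    using assms by (simp add: continuous_on_eq_continuous_at)
  then obtain F where F: "\<And>x. (F has_vector_derivative f x) (at x)"
    using einterval_antiderivative[of "-\<infinity>" "\<infinity>" f] by auto
  show ?thesis
    by (rule that[of "\<lambda>x. F x - F 0"]) (auto intro!: derivative_eq_intros F)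
qed

text \<open>Integrating \<open>cosh (K * x)\<close> twice from \<open>0\<close> gives
  \<open>(cosh (K * x) - 1) / K^2\<close>. In the norm weighted by this function double integration
  therefore gains \<open>1 / K^2\<close>, on intervals of any length.\<close>

lemma norm_double_antiderivative_le_cosh:
  fixes F :: "real \<Rightarrow> complex"
  assumes F: "\<And>x. (F has_vector_derivative F1 x) (at x)"
    and F1: "\<And>x. (F1 has_vector_derivative f x) (at x)"
    and 0: "F 0 = 0" "F1 0 = 0" and K: "K > 0"
    and f: "\<And>x. \<bar>x\<bar> \<le> L \<Longrightarrow> norm (f x) \<le> g * cosh (K * x)"
    and x: "\<bar>x\<bar> \<le> L"
  shows "norm (F x) \<le> g / K\<^sup>2 * cosh (K * x)" "norm (F1 x) \<le> g / K * cosh (K * x)"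
proof -
  have g: "g \<ge> 0"
    using f[of 0] x order_trans[OF norm_ge_zero, of "f 0" g] by auto
  have *: "norm (H y) \<le> g / K\<^sup>2 * cosh (K * y) \<and> norm (H1 y) \<le> g / K * cosh (K * y)"
    if H: "\<And>x. (H has_vector_derivative H1 x) (at x)"
      and H1: "\<And>x. (H1 has_vector_derivative h x) (at x)"
      and H0: "H 0 = 0" "H1 0 = 0"
      and h: "\<And>x. \<bar>x\<bar> \<le> L \<Longrightarrow> norm (h x) \<le> g * cosh (K * x)"
      and y: "0 \<le> y" "y \<le> L"
    for H H1 h :: "real \<Rightarrow> complex" and y
  proof -
    have s: "norm (H1 y) \<le> g / K * sinh (K * y)" if "0 \<le> y" "y \<le> L" for y
    proof -
      have "norm (H1 y - H1 0) \<le> g / K * sinh (K * y) - g / K * sinh (K * 0)"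
        by (rule norm_diff_le_of_vector_derivative[where f' = h and g' = "\<lambda>x. g * cosh (K * x)"])
          (use that H1 h K in \<open>auto intro!: derivative_eq_intros\<close>)
      then show ?thesis using H0 by simp
    qed
    have "norm (H y - H 0) \<le> g / K\<^sup>2 * cosh (K * y) - g / K\<^sup>2 * cosh (K * 0)"
      by (rule norm_diff_le_of_vector_derivative[where f' = H1 and g' = "\<lambda>x. g / K * sinh (K * x)"])
        (use y H s K in \<open>auto intro!: derivative_eq_intros simp: power2_eq_square\<close>)
    moreover have "g / K\<^sup>2 \<ge> 0" "g / K \<ge> 0" using g K by auto
    moreover have "g / K * sinh (K * y) \<le> g / K * cosh (K * y)"
      using g K by (intro mult_left_mono sinh_le_cosh_real) auto
    ultimately show ?thesis using H0 s[OF y] by simp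
  qed
  have "norm (F x) \<le> g / K\<^sup>2 * cosh (K * x) \<and> norm (F1 x) \<le> g / K * cosh (K * x)"
  proof (cases "x \<ge> 0")
    case True
    then show ?thesis using *[OF F F1 0 f, of x] x by auto
  next
    case False
    have "norm (F (- (- x))) \<le> g / K\<^sup>2 * cosh (K * (- x)) \<and> norm (- F1 (- (- x))) \<le> g / K * cosh (K * (- x))"
    proof (rule *[where h = "\<lambda>x. f (- x)"])
      show "((\<lambda>x. F (- x)) has_vector_derivative - F1 (- y)) (at y)" for y
        by (rule has_vector_derivative_reflect[OF F])
      show "((\<lambda>x. - F1 (- x)) has_vector_derivative f (- y)) (at y)" for y
        using has_vector_derivative_minus[OF has_vector_derivative_reflect[OF F1]] by simp
    qed (use 0 f[of "- _"] False x in auto)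
    then show ?thesis by simp
  qed
  then show "norm (F x) \<le> g / K\<^sup>2 * cosh (K * x)" "norm (F1 x) \<le> g / K * cosh (K * x)" by auto
qed

lemma has_vector_derivative_suminf:
  fixes f :: "nat \<Rightarrow> real \<Rightarrow> complex"
  assumes f: "\<And>n x. \<bar>x\<bar> < L \<Longrightarrow> (f n has_vector_derivative f' n x) (at x)"
    and M: "\<And>n x. \<bar>x\<bar> < L \<Longrightarrow> norm (f n x) \<le> M n" "\<And>n x. \<bar>x\<bar> < L \<Longrightarrow> norm (f' n x) \<le> M n"
    and sm: "summable M" and x: "\<bar>x\<bar> < L"
  shows "((\<lambda>x. \<Sum>n. f n x) has_vector_derivative (\<Sum>n. f' n x)) (at x)"
proof -
  let ?S = "{-L<..<L}"
  have xS: "x \<in> ?S" using x by auto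
  have L0: "0 \<in> ?S" using x by auto
  have "uniform_limit ?S (\<lambda>n x. \<Sum>i<n. f' i x) (\<lambda>x. \<Sum>i. f' i x) sequentially"
    by (rule Weierstrass_m_test) (use M sm in auto)
  have ul: "\<forall>\<^sub>F n in sequentially. \<forall>x\<in>?S. \<forall>h. norm ((\<Sum>i<n. h *\<^sub>R f' i x) - h *\<^sub>R (\<Sum>i. f' i x)) \<le> e * norm h"
    if "e > 0" for e
  proof -
    have "\<forall>\<^sub>F n in sequentially. \<forall>x\<in>?S. dist (\<Sum>i<n. f' i x) (\<Sum>i. f' i x) < e"
      using \<open>uniform_limit _ _ _ _\<close> that by (auto simp: uniform_limit_iff)
    then show ?thesis
    proof eventually_elim
      case (elim n)
      show ?case
      proof (intro ballI allI)
        fix x h assume "x \<in> ?S"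
        then have "norm ((\<Sum>i<n. f' i x) - (\<Sum>i. f' i x)) \<le> e"
          using elim by (auto simp: dist_norm less_imp_le)
        then have "norm (h *\<^sub>R ((\<Sum>i<n. f' i x) - (\<Sum>i. f' i x))) \<le> e * norm h"
          by (simp add: mult.commute[of "\<bar>h\<bar>"] mult_right_mono)
        then show "norm ((\<Sum>i<n. h *\<^sub>R f' i x) - h *\<^sub>R (\<Sum>i. f' i x)) \<le> e * norm h"
          by (simp add: scaleR_right.sum scaleR_diff_right)
      qed
    qed
  qed
  have sm': "summable (\<lambda>n. f n 0)"
    by (rule summable_comparison_test'[OF sm]) (use M L0 in auto)
  have "\<exists>g. \<forall>x\<in>?S. (\<lambda>n. f n x) sums g x \<and> (g has_derivative (\<lambda>h. h *\<^sub>R (\<Sum>i. f' i x))) (at x within ?S)"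
    by (rule has_derivative_series[where x = 0 and f' = "\<lambda>n x h. h *\<^sub>R f' n x" and l = "\<Sum>n. f n 0", OF _ _ ul])
      (use f sm' L0 in \<open>auto simp: has_vector_derivative_def summable_sums has_derivative_at_withinI\<close>)
  then obtain g where g: "\<And>x. x \<in> ?S \<Longrightarrow> (\<lambda>n. f n x) sums g x"
    "\<And>x. x \<in> ?S \<Longrightarrow> (g has_vector_derivative (\<Sum>i. f' i x)) (at x within ?S)"
    unfolding has_vector_derivative_def by blast
  have "(g has_vector_derivative (\<Sum>i. f' i x)) (at x)"
    using g(2)[OF xS] xS by (simp add: at_within_open[OF xS])
  then show ?thesis
    by (rule has_vector_derivative_transform_within_open[OF _ _ xS])
      (use g(1) in \<open>auto simp: sums_iff\<close>)
qed

section \<open>Picard iteration and the linear structure of solutions\<close>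

text \<open>The derivative is carried as a second function, so that initial data and Wronskians are
  plain expressions. \<open>Q\<close> is complex valued because it will absorb the spectral
  parameter as \<open>V - z\<close>.\<close>

definition ode_sol :: "(real \<Rightarrow> complex) \<Rightarrow> (real \<Rightarrow> complex) \<Rightarrow> (real \<Rightarrow> complex) \<Rightarrow> bool" where
  "ode_sol Q u u' \<longleftrightarrow> (\<forall>x. (u has_vector_derivative u' x) (at x)) \<and>
     (\<forall>x. (u' has_vector_derivative Q x * u x) (at x))"

lemma ode_sol_exists:
  fixes a b :: complex
  assumes Q: "continuous_on UNIV Q"
  obtains u u' where "ode_sol Q u u'" "u 0 = a" "u' 0 = b"
proof -
  \<comment> \<open>\<open>P f\<close> is a chosen antiderivative vanishing at \<open>0\<close>; it
    plays the role of integration from \<open>0\<close>, on both sides of \<open>0\<close> at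
    once.\<close>
  define P :: "(real \<Rightarrow> complex) \<Rightarrow> real \<Rightarrow> complex"
    where "P f = (SOME F. (\<forall>x. (F has_vector_derivative f x) (at x)) \<and> F 0 = 0)" for f
  have P: "(P f has_vector_derivative f x) (at x)" "P f 0 = 0" if "continuous_on UNIV f" for f x
  proof -
    have "\<exists>F. (\<forall>x. (F has_vector_derivative f x) (at x)) \<and> F 0 = 0"
      using antiderivative_exists[OF that] by metis
    from someI_ex[OF this] show "(P f has_vector_derivative f x) (at x)" "P f 0 = 0"
      unfolding P_def by auto
  qed
  have cP: "continuous_on UNIV (P f)" if "continuous_on UNIV f" for f
    using P(1)[OF that] by (meson continuous_at_imp_continuous_on has_vector_derivative_continuous)
  \<comment> \<open>\<open>t n\<close> is the increment between consecutive Picard iterates,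
    starting from the affine function with the given data. Its first two derivatives
    \<open>t'\<close> and \<open>t''\<close> are kept explicitly, so that all three series can be
    summed.\<close>
  define t where "t = rec_nat (\<lambda>x. a + of_real x * b) (\<lambda>_ f. P (P (\<lambda>x. Q x * f x)))"
  define t' where "t' = rec_nat (\<lambda>x. b) (\<lambda>n _. P (\<lambda>x. Q x * t n x))"
  define t'' where "t'' = rec_nat (\<lambda>x. 0) (\<lambda>n _. (\<lambda>x. Q x * t n x))"
  have t_simps: "t 0 = (\<lambda>x. a + of_real x * b)" "t (Suc n) = P (t' (Suc n))"
    "t' 0 = (\<lambda>x. b)" "t' (Suc n) = P (t'' (Suc n))"
    "t'' 0 = (\<lambda>x. 0)" "t'' (Suc n) = (\<lambda>x. Q x * t n x)" for n
    by (simp_all add: t_def t'_def t''_def)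
  have ct: "continuous_on UNIV (t n)" for n
  proof (induction n)
    case (Suc n)
    show ?case unfolding t_simps by (intro cP continuous_intros Q Suc)
  qed (auto simp: t_simps intro!: continuous_intros)
  have ct'': "continuous_on UNIV (t'' n)" for n
  proof (cases n)
    case (Suc m)
    show ?thesis unfolding Suc t_simps by (intro continuous_on_mult Q ct)
  qed (simp add: t_simps)
  have ct': "continuous_on UNIV (t' n)" for n
  proof (cases n)
    case (Suc m)
    show ?thesis unfolding Suc t_simps(4) by (intro cP ct'')
  qed (simp add: t_simps)
  have dt: "(t n has_vector_derivative t' n x) (at x)" for n x
  proof (cases n)
    case (Suc m)
    show ?thesis unfolding Suc t_simps(2) by (rule P(1)[OF ct'])
  qed (auto simp: t_simps scaleR_conv_of_real[symmetric] intro!: derivative_eq_intros)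
  have dt': "(t' n has_vector_derivative t'' n x) (at x)" for n x
  proof (cases n)
    case (Suc m)
    show ?thesis unfolding Suc t_simps(4) by (rule P(1)[OF ct''])
  qed (auto simp: t_simps intro!: derivative_eq_intros)
  have t0: "t (Suc n) 0 = 0" "t' (Suc n) 0 = 0" for n
    by (metis P(2) ct' t_simps(2), metis P(2) ct'' t_simps(4))
  define u where "u x = (\<Sum>n. t n x)" for x
  define u' where "u' x = (\<Sum>n. t' n x)" for x
  have sol: "(u has_vector_derivative u' x) (at x) \<and> (u' has_vector_derivative Q x * u x) (at x)" for x
  proof -
    define L where "L = \<bar>x\<bar> + 1"
    have "compact (Q ` {-L..L})"
      by (intro compact_continuous_image continuous_on_subset[OF Q]) auto
    then obtain M0 where M0: "\<And>y. y \<in> {-L..L} \<Longrightarrow> norm (Q y) \<le> M0"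
      by (meson bounded_iff compact_imp_bounded imageI)
    define M where "M = max M0 1"
    have M: "M \<ge> 1" "\<And>y. \<bar>y\<bar> \<le> L \<Longrightarrow> norm (Q y) \<le> M"
      using M0 by (auto simp: M_def abs_le_iff le_max_iff_disj)
    \<comment> \<open>With \<open>K^2 = 2 * M\<close> passing from \<open>t n\<close> to
      \<open>t (Suc n)\<close> gains the factor \<open>M / K^2 = 1/2\<close> in the weighted
      norm.\<close>
    define K where "K = sqrt (2 * M)"
    have K: "K > 0" "K\<^sup>2 = 2 * M" "K \<ge> 1" using M by (auto simp: K_def)
    define C where "C = norm a + (L + 1) * norm b"
    have C0: "C \<ge> 0" and L0: "L > 0" by (auto simp: C_def L_def)
    have bt: "norm (t n y) \<le> C * (1/2)^n * cosh (K * y)" if "\<bar>y\<bar> \<le> L" for n y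
      using that
    proof (induction n arbitrary: y)
      case 0
      have "norm (t 0 y) \<le> norm a + \<bar>y\<bar> * norm b"
        unfolding t_simps by (rule order_trans[OF norm_triangle_ineq]) (simp add: norm_mult)
      also have "\<dots> \<le> C * 1" unfolding C_def using 0 by (auto intro: mult_right_mono)
      also have "\<dots> \<le> C * cosh (K * y)" using C0 by (intro mult_left_mono) (auto simp: cosh_real_ge_1)
      finally show ?case by simp
    next
      case (Suc n)
      have "norm (t (Suc n) y) \<le> (M * (C * (1/2)^n)) / K\<^sup>2 * cosh (K * y)"
      proof (rule norm_double_antiderivative_le_cosh(1)[OF dt dt' t0 K(1) _ Suc.prems])
        fix y assume y: "\<bar>y\<bar> \<le> L"
        have "norm (Q y * t n y) \<le> M * (C * (1/2)^n * cosh (K * y))"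
          unfolding norm_mult using M(1) by (intro mult_mono M Suc.IH y) auto
        then show "norm (t'' (Suc n) y) \<le> M * (C * (1/2)^n) * cosh (K * y)"
          by (simp add: t_simps mult_ac)
      qed
      then show ?case using M(1) by (simp add: K mult_ac)
    qed
    have bt'': "norm (t'' (Suc n) y) \<le> M * (C * (1/2)^n) * cosh (K * y)" if "\<bar>y\<bar> \<le> L" for n y
    proof -
      have "norm (Q y * t n y) \<le> M * (C * (1/2)^n * cosh (K * y))"
        unfolding norm_mult using M(1) by (intro mult_mono M bt that) auto
      then show ?thesis by (simp add: t_simps mult_ac)
    qed
    have bt': "norm (t' (Suc n) y) \<le> (M * (C * (1/2)^n)) / K * cosh (K * y)" if "\<bar>y\<bar> \<le> L" for n y
      by (rule norm_double_antiderivative_le_cosh(2)[OF dt dt' t0 K(1) bt'' that])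
    define H where "H = cosh (K * L)"
    have H: "cosh (K * y) \<le> H" if "\<bar>y\<bar> \<le> L" for y
    proof -
      have "cosh (K * y) = cosh (K * \<bar>y\<bar>)" by (auto simp: abs_if)
      also have "\<dots> \<le> H" unfolding H_def
        using that K by (intro cosh_real_nonneg_le_iff[THEN iffD2]) auto
      finally show ?thesis .
    qed
    have H0: "H \<ge> 1" by (simp add: H_def cosh_real_ge_1)
    \<comment> \<open>One majorant serves \<open>t n\<close>, \<open>t' n\<close> and
      \<open>t'' n\<close>: the factor \<open>2\<close> absorbs the index shift in the bounds for
      \<open>Suc n\<close>, and the last summand covers \<open>t' 0\<close>, which is the constant
      \<open>b\<close>.\<close>
    define B where "B n = 2 * M * C * H * (1/2)^n + norm b * (1/2)^n" for n :: nat
    have sB: "summable B" unfolding B_def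
      by (intro summable_add summable_mult summable_geometric) auto
    have B1: "norm (t n y) \<le> B n" if "\<bar>y\<bar> < L" for n y
    proof -
      have "norm (t n y) \<le> C * (1/2)^n * H"
        using bt[of y n] H[of y] that C0 mult_left_mono[of "cosh (K*y)" H "C * (1/2)^n"] by force
      also have "\<dots> \<le> (2 * M) * (C * (1/2)^n * H)" using M(1) C0 H0
        by (intro mult_left_mono[of 1 "2*M", simplified mult_1] mult_right_mono[of 1 "2*M", simplified mult_1_left]) auto
      also have "\<dots> \<le> B n" by (simp add: B_def)
      finally show ?thesis .
    qed
    have B2: "norm (t' n y) \<le> B n" if "\<bar>y\<bar> < L" for n y
    proof (cases n)
      case 0
      then show ?thesis using M(1) C0 H0 by (simp add: t_simps B_def)
    next
      case (Suc m)
      have "norm (t' n y) \<le> (M * (C * (1/2)^m)) / K * cosh (K * y)" using bt'[of y m] that Suc by simp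
      also have "\<dots> \<le> (M * (C * (1/2)^m)) * H"
      proof (rule mult_mono)
        have "M * (C * (1/2)^m) / K \<le> M * (C * (1/2)^m) / 1"
          using K C0 M(1) by (intro divide_left_mono) auto
        then show "M * (C * (1/2)^m) / K \<le> M * (C * (1/2)^m)" by simp
      qed (use H that C0 M(1) in auto)
      also have "\<dots> \<le> B n" using Suc by (simp add: B_def)
      finally show ?thesis .
    qed
    have B3: "norm (t'' n y) \<le> B n" if "\<bar>y\<bar> < L" for n y
    proof (cases n)
      case 0
      then show ?thesis using M(1) C0 H0 by (simp add: t_simps B_def)
    next
      case (Suc m)
      have "norm (t'' n y) \<le> (M * (C * (1/2)^m)) * cosh (K * y)" using bt''[of y m] that Suc by simp
      also have "\<dots> \<le> (M * (C * (1/2)^m)) * H"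
        by (rule mult_left_mono) (use H that C0 M(1) in auto)
      also have "\<dots> \<le> B n" using Suc by (simp add: B_def)
      finally show ?thesis .
    qed
    have xL: "\<bar>x\<bar> < L" by (simp add: L_def)
    have 1: "(u has_vector_derivative u' x) (at x)"
      unfolding u_def u'_def by (rule has_vector_derivative_suminf[OF dt B1 B2 sB xL])
    have 2: "(u' has_vector_derivative (\<Sum>n. t'' n x)) (at x)"
      unfolding u'_def by (rule has_vector_derivative_suminf[OF dt' B2 B3 sB xL])
    have "summable (\<lambda>n. t'' n x)"
      by (rule summable_comparison_test'[OF sB]) (use B3 xL in auto)
    then have "(\<Sum>n. t'' n x) = (\<Sum>n. t'' (Suc n) x)"
      by (subst suminf_split_head) (auto simp: t_simps)
    also have "\<dots> = Q x * u x" unfolding t_simps u_def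
      by (rule suminf_mult, rule summable_comparison_test'[OF sB]) (use B1 xL in auto)
    finally show ?thesis using 1 2 by simp
  qed
  have "u 0 = a" unfolding u_def
    using suminf_finite[of "{0}" "\<lambda>n. t n 0"] t0 by (auto simp: t_simps(1) gr0_conv_Suc)
  moreover have "u' 0 = b" unfolding u'_def
    using suminf_finite[of "{0}" "\<lambda>n. t' n 0"] t0 by (auto simp: t_simps(3) gr0_conv_Suc)
  ultimately show ?thesis using sol that unfolding ode_sol_def by blast
qed

lemma ode_solD:
  assumes "ode_sol Q u u'"
  shows "(u has_vector_derivative u' x) (at x)" "(u' has_vector_derivative Q x * u x) (at x)"
  using assms by (auto simp: ode_sol_def)

lemma ode_sol_continuous:
  assumes "ode_sol Q u u'"
  shows "continuous_on S u" "continuous_on S u'"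
  using ode_solD[OF assms]
  by (meson continuous_at_imp_continuous_on has_vector_derivative_continuous)+

lemma ode_sol_linear:
  assumes "ode_sol Q u u'" "ode_sol Q v v'"
  shows "ode_sol Q (\<lambda>x. a * u x + b * v x) (\<lambda>x. a * u' x + b * v' x)"
  unfolding ode_sol_def
  by (auto intro!: derivative_eq_intros ode_solD[OF assms(1)] ode_solD[OF assms(2)] simp: algebra_simps)

lemma ode_sol_reflect:
  assumes "ode_sol Q u u'" "\<And>x. Q (- x) = Q x"
  shows "ode_sol Q (\<lambda>x. u (- x)) (\<lambda>x. - u' (- x))"
  unfolding ode_sol_def
  using has_vector_derivative_reflect[OF ode_solD(1)[OF assms(1)]]
    has_vector_derivative_minus[OF has_vector_derivative_reflect[OF ode_solD(2)[OF assms(1)]]] assms(2)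
  by auto

lemma ode_sol_cnj:
  assumes "ode_sol Q u u'"
  shows "ode_sol (\<lambda>x. cnj (Q x)) (\<lambda>x. cnj (u x)) (\<lambda>x. cnj (u' x))"
  unfolding ode_sol_def
  using bounded_linear.has_vector_derivative[OF bounded_linear_cnj ode_solD(1)[OF assms]]
    bounded_linear.has_vector_derivative[OF bounded_linear_cnj ode_solD(2)[OF assms]]
  by auto

section \<open>Wronskians and energy estimates\<close>

text \<open>Lagrange's identity. For equal coefficients it makes Wronskians constant; for two
  spectral parameters \<open>w\<close> and \<open>z\<close> the factor \<open>R - Q\<close> is their
  difference, which is the source of analyticity in the parameter.\<close>

lemma wronskian_derivative:
  assumes "ode_sol Q u u'" "ode_sol R v v'"
  shows "((\<lambda>x. u x * v' x - u' x * v x) has_vector_derivative (R x - Q x) * (u x * v x)) (at x)"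
  by (auto intro!: derivative_eq_intros ode_solD[OF assms(1)] ode_solD[OF assms(2)] simp: algebra_simps)

lemma wronskian_constant:
  assumes "ode_sol Q u u'" "ode_sol Q v v'"
  shows "u x * v' x - u' x * v x = u y * v' y - u' y * v y"
proof -
  obtain c where "\<And>x. x \<in> UNIV \<Longrightarrow> u x * v' x - u' x * v x = c"
    using has_vector_derivative_zero_constant[of UNIV "\<lambda>x. u x * v' x - u' x * v x"]
      wronskian_derivative[OF assms] by auto
  then show ?thesis by simp
qed

lemma has_real_derivative_norm_square:
  fixes u :: "real \<Rightarrow> complex"
  assumes "(u has_vector_derivative u') (at x)"
  shows "((\<lambda>x. (norm (u x))\<^sup>2) has_real_derivative 2 * Re (cnj (u x) * u')) (at x)"
proof -
  have d: "((\<lambda>x. Re (u x)) has_real_derivative Re u') (at x)" "((\<lambda>x. Im (u x)) has_real_derivative Im u') (at x)"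
    unfolding has_real_derivative_iff_has_vector_derivative
    by (auto intro: bounded_linear.has_vector_derivative[OF bounded_linear_Re assms]
        bounded_linear.has_vector_derivative[OF bounded_linear_Im assms])
  show ?thesis unfolding cmod_power2
    by (rule DERIV_cong[OF DERIV_add[OF DERIV_power[OF d(1)] DERIV_power[OF d(2)]]]) (simp add: algebra_simps)
qed

lemma has_real_derivative_Re_cnj_mult:
  fixes u :: "real \<Rightarrow> complex"
  assumes "(u has_vector_derivative u') (at x)" "(v has_vector_derivative v') (at x)"
  shows "((\<lambda>x. Re (cnj (u x) * v x)) has_real_derivative Re (cnj u' * v x + cnj (u x) * v')) (at x)"
  unfolding has_real_derivative_iff_has_vector_derivative
  by (rule bounded_linear.has_vector_derivative[OF bounded_linear_Re])
    (auto intro!: derivative_eq_intros assms bounded_linear.has_vector_derivative[OF bounded_linear_cnj])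

text \<open>The quantity \<open>|u'|^2 + k^2 |u|^2\<close> is conserved when
  \<open>Q = - k^2\<close>, so only \<open>Q + k^2\<close> drives its growth, and the inequality
  between arithmetic and geometric mean yields the rate \<open>N / k\<close>. The free parameter
  \<open>k\<close> is later adapted to the spectral parameter.\<close>

lemma energy_bound:
  assumes u: "ode_sol Q u u'" and k: "k > 0" and x: "x \<ge> 0"
    and N: "\<And>t. t \<in> {0..x} \<Longrightarrow> norm (Q t + of_real (k\<^sup>2)) \<le> N"
  shows "(norm (u' x))\<^sup>2 + k\<^sup>2 * (norm (u x))\<^sup>2
    \<le> ((norm (u' 0))\<^sup>2 + k\<^sup>2 * (norm (u 0))\<^sup>2) * exp (N * x / k)"
proof -
  define E where "E t = (norm (u' t))\<^sup>2 + k\<^sup>2 * (norm (u t))\<^sup>2" for t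
  define E' where "E' t = 2 * Re (cnj (u' t) * (Q t * u t)) + k\<^sup>2 * (2 * Re (cnj (u t) * u' t))" for t
  have dE: "(E has_real_derivative E' t) (at t)" for t
    unfolding E_def E'_def
    by (rule DERIV_add[OF has_real_derivative_norm_square[OF ode_solD(2)[OF u]]
          DERIV_cmult[OF has_real_derivative_norm_square[OF ode_solD(1)[OF u]]]])
  have E': "E' t \<le> N / k * E t" if "t \<in> {0..x}" for t
  proof -
    have "E' t = 2 * Re (cnj (u' t) * ((Q t + of_real (k\<^sup>2)) * u t))"
      unfolding E'_def by (simp add: algebra_simps power2_eq_square)
    also have "\<dots> \<le> 2 * norm (cnj (u' t) * ((Q t + of_real (k\<^sup>2)) * u t))"
      by (intro mult_left_mono complex_Re_le_cmod) auto
    also have "\<dots> = norm (Q t + of_real (k\<^sup>2)) * (2 * norm (u' t) * norm (u t))"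
      by (simp add: norm_mult)
    also have "\<dots> \<le> N * (2 * norm (u' t) * norm (u t))"
      by (intro mult_right_mono N that) auto
    also have "\<dots> = N / k * (2 * norm (u' t) * (k * norm (u t)))" using k by simp
    also have "\<dots> \<le> N / k * E t"
    proof (rule mult_left_mono)
      show "2 * norm (u' t) * (k * norm (u t)) \<le> E t"
        using sum_squares_bound[of "norm (u' t)" "k * norm (u t)"] by (simp add: E_def power_mult_distrib)
      show "0 \<le> N / k" using k order_trans[OF norm_ge_zero N[OF that]] by simp
    qed
    finally show ?thesis .
  qed
  have "E x * exp (- (N / k) * x) \<le> E 0 * exp (- (N / k) * 0)"
  proof (rule DERIV_nonpos_imp_nonincreasing[OF x])
    fix t assume t: "0 \<le> t" "t \<le> x"
    have "((\<lambda>t. E t * exp (- (N / k) * t)) has_real_derivative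
      (E' t - N / k * E t) * exp (- (N / k) * t)) (at t)"
      using k by (auto intro!: derivative_eq_intros dE simp: algebra_simps)
    moreover have "(E' t - N / k * E t) * exp (- (N / k) * t) \<le> 0"
      using E'[of t] t by (intro mult_nonpos_nonneg) auto
    ultimately show "\<exists>y. ((\<lambda>t. E t * exp (- (N / k) * t)) has_real_derivative y) (at t) \<and> y \<le> 0"
      by blast
  qed
  then have "E x * exp (- (N / k) * x) * exp (N * x / k) \<le> E 0 * exp (N * x / k)"
    by (intro mult_right_mono) auto
  then have "E x \<le> E 0 * exp (N * x / k)"
    by (simp add: mult.assoc exp_add[symmetric])
  then show ?thesis by (simp add: E_def)
qed

lemma has_field_derivative_of_quadratic_remainder:
  fixes g :: "complex \<Rightarrow> complex"
  assumes "\<And>w. norm (w - z) \<le> 1 \<Longrightarrow> norm (g w - g z - (w - z) * D) \<le> C * (norm (w - z))\<^sup>2"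
  shows "(g has_field_derivative D) (at z)"
proof -
  have "((\<lambda>w. (g w - g z) / (w - z) - D) \<longlongrightarrow> 0) (at z)"
  proof (rule Lim_null_comparison)
    show "\<forall>\<^sub>F w in at z. norm ((g w - g z) / (w - z) - D) \<le> C * norm (w - z)"
      unfolding eventually_at
    proof (intro exI[of _ 1] conjI ballI impI)
      fix w assume "w \<noteq> z \<and> dist w z < 1"
      then have w: "w - z \<noteq> 0" "norm (w - z) \<le> 1" by (auto simp: dist_norm)
      have "norm ((g w - g z) / (w - z) - D) = norm (g w - g z - (w - z) * D) / norm (w - z)"
        using w(1) by (simp add: norm_divide[symmetric] diff_divide_distrib)
      also have "\<dots> \<le> C * (norm (w - z))\<^sup>2 / norm (w - z)"
        by (intro divide_right_mono assms w) auto
      also have "\<dots> = C * norm (w - z)" using w(1) by (simp add: power2_eq_square)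
      finally show "norm ((g w - g z) / (w - z) - D) \<le> C * norm (w - z)" .
    qed auto
    show "((\<lambda>w. C * norm (w - z)) \<longlongrightarrow> 0) (at z)"
      by (auto intro!: tendsto_eq_intros)
  qed
  then have "((\<lambda>w. (g w - g z) / (w - z)) \<longlongrightarrow> D) (at z)"
    using LIM_zero_iff by blast
  then show ?thesis by (simp add: has_field_derivative_iff)
qed

section \<open>Fundamental solutions\<close>

locale potential =
  fixes V :: "real \<Rightarrow> real"
  assumes cont: "continuous_on UNIV V"
    and even: "V (- x) = V x"
    and at_top: "filterlim V at_top at_top"
begin

definition Q :: "complex \<Rightarrow> real \<Rightarrow> complex" where
  "Q z x = of_real (V x) - z"

lemma continuous_Q: "continuous_on UNIV (Q z)"
  unfolding Q_def by (intro continuous_intros cont)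

lemma Q_cnj: "Q (cnj z) = (\<lambda>x. cnj (Q z x))"
  by (simp add: Q_def fun_eq_iff)

lemma Q_even: "Q z (- x) = Q z x"
  by (simp add: Q_def even)

definition fundamental :: "complex \<Rightarrow> complex \<Rightarrow> complex \<Rightarrow> (real \<Rightarrow> complex) \<times> (real \<Rightarrow> complex)" where
  "fundamental z a b = (SOME p. ode_sol (Q z) (fst p) (snd p) \<and> fst p 0 = a \<and> snd p 0 = b)"

lemma fundamental:
  "ode_sol (Q z) (fst (fundamental z a b)) (snd (fundamental z a b))"
  "fst (fundamental z a b) 0 = a" "snd (fundamental z a b) 0 = b"
proof -
  obtain u u' where "ode_sol (Q z) u u'" "u 0 = a" "u' 0 = b"
    using ode_sol_exists[OF continuous_Q] .
  then have "\<exists>p. ode_sol (Q z) (fst p) (snd p) \<and> fst p 0 = a \<and> snd p 0 = b"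
    by (intro exI[of _ "(u, u')"]) auto
  from someI_ex[OF this] show "ode_sol (Q z) (fst (fundamental z a b)) (snd (fundamental z a b))"
    "fst (fundamental z a b) 0 = a" "snd (fundamental z a b) 0 = b"
    unfolding fundamental_def by auto
qed

definition "theta z = fst (fundamental z 1 0)"
definition "theta' z = snd (fundamental z 1 0)"
definition "phi z = fst (fundamental z 0 1)"
definition "phi' z = snd (fundamental z 0 1)"

lemma theta: "ode_sol (Q z) (theta z) (theta' z)" and theta_0 [simp]: "theta z 0 = 1" "theta' z 0 = 0"
  and phi: "ode_sol (Q z) (phi z) (phi' z)" and phi_0 [simp]: "phi z 0 = 0" "phi' z 0 = 1"
  unfolding theta_def theta'_def phi_def phi'_def by (rule fundamental)+

lemma wronskian_theta_phi: "theta z x * phi' z x - theta' z x * phi z x = 1"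
  using wronskian_constant[OF theta phi, of z x 0] by simp

text \<open>Cramer's rule with constant Wronskians. Picard iteration gave existence only; this
  supplies uniqueness for given initial data, and with it the reflection and conjugation symmetries
  below.\<close>

lemma solution_decomp:
  assumes u: "ode_sol (Q z) u u'"
  shows "u x = u 0 * theta z x + u' 0 * phi z x" "u' x = u 0 * theta' z x + u' 0 * phi' z x"
proof -
  have 1: "u x * phi' z x - u' x * phi z x = u 0" using wronskian_constant[OF u phi, of x 0] by simp
  have 2: "theta z x * u' x - theta' z x * u x = u' 0" using wronskian_constant[OF theta u, of x 0] by simp
  have "u 0 * theta z x + u' 0 * phi z x = u x * (theta z x * phi' z x - theta' z x * phi z x)"
    unfolding 1[symmetric] 2[symmetric] by (simp add: algebra_simps)
  then show "u x = u 0 * theta z x + u' 0 * phi z x" by (simp add: wronskian_theta_phi)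
  have "u 0 * theta' z x + u' 0 * phi' z x = u' x * (theta z x * phi' z x - theta' z x * phi z x)"
    unfolding 1[symmetric] 2[symmetric] by (simp add: algebra_simps)
  then show "u' x = u 0 * theta' z x + u' 0 * phi' z x" by (simp add: wronskian_theta_phi)
qed

lemma theta_reflect: "theta z (- x) = theta z x" and phi_reflect: "phi z (- x) = - phi z x"
  using solution_decomp(1)[OF ode_sol_reflect[OF theta Q_even], of z x]
    solution_decomp(1)[OF ode_sol_reflect[OF phi Q_even], of z x] by auto

lemma theta_cnj: "theta (cnj z) x = cnj (theta z x)" "theta' (cnj z) x = cnj (theta' z x)"
  and phi_cnj: "phi (cnj z) x = cnj (phi z x)" "phi' (cnj z) x = cnj (phi' z x)"
proof -
  have t: "ode_sol (Q (cnj z)) (\<lambda>x. cnj (theta z x)) (\<lambda>x. cnj (theta' z x))"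
    and p: "ode_sol (Q (cnj z)) (\<lambda>x. cnj (phi z x)) (\<lambda>x. cnj (phi' z x))"
    unfolding Q_cnj by (rule ode_sol_cnj theta phi)+
  show "theta (cnj z) x = cnj (theta z x)" "theta' (cnj z) x = cnj (theta' z x)"
    using solution_decomp[OF t, of x] by auto
  show "phi (cnj z) x = cnj (phi z x)" "phi' (cnj z) x = cnj (phi' z x)"
    using solution_decomp[OF p, of x] by auto
qed

section \<open>Analytic dependence on the spectral parameter\<close>

lemma V_bounded_on:
  "\<exists>M\<ge>0. \<forall>t\<in>{0..x}. \<bar>V t\<bar> \<le> M"
proof -
  have "compact (V ` {0..x})"
    by (intro compact_continuous_image continuous_on_subset[OF cont]) auto
  then obtain M where "\<And>t. t \<in> {0..x} \<Longrightarrow> \<bar>V t\<bar> \<le> M"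
    by (metis bounded_iff compact_imp_bounded imageI real_norm_def)
  then show ?thesis by (intro exI[of _ "max M 0"]) (auto simp: le_max_iff_disj)
qed

text \<open>The difference of solutions for two spectral parameters is controlled by integrating the
  derivative of their Wronskians; this replaces differentiation under the integral sign.\<close>

lemma solution_family_differentiable:
  assumes U: "\<And>z. ode_sol (Q z) (U z) (U' z)" "\<And>z. U z 0 = a" "\<And>z. U' z 0 = b" and x: "x \<ge> 0"
  shows "(\<lambda>z. U z x) field_differentiable (at z)" "(\<lambda>z. U' z x) field_differentiable (at z)"
proof -
  obtain M where M: "M \<ge> 0" "\<And>t. t \<in> {0..x} \<Longrightarrow> \<bar>V t\<bar> \<le> M"
    using V_bounded_on[of x] by blast
  \<comment> \<open>Bounds \<open>V - w + 1\<close> for all \<open>w\<close> within distance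
    \<open>1\<close> of \<open>z\<close>. The energy estimate with \<open>k = 1\<close> then gives
    the bound \<open>B\<close>, uniform in \<open>w\<close>.\<close>
  define N where "N = M + norm z + 2"
  define B where "B = sqrt ((norm b)\<^sup>2 + (norm a)\<^sup>2) * exp (N * x / 2)"
  have B: "norm (U w t) \<le> B" if w: "norm (w - z) \<le> 1" and t: "t \<in> {0..x}" for w t
  proof -
    have N: "norm (Q w s + of_real (1\<^sup>2)) \<le> N" if "s \<in> {0..t}" for s
    proof -
      have "norm (Q w s + of_real (1\<^sup>2)) = norm (of_real (V s) - z - (w - z) + 1)"
        by (simp add: Q_def)
      also have "\<dots> \<le> norm (complex_of_real (V s)) + norm z + norm (w - z) + norm (1::complex)"
        by (intro norm_triangle_le norm_triangle_le_diff add_mono order_refl)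
      also have "\<dots> \<le> N" using M(2)[of s] that t w by (simp add: N_def)
      finally show ?thesis .
    qed
    have "(norm (U w t))\<^sup>2 \<le> (norm (U' w t))\<^sup>2 + 1\<^sup>2 * (norm (U w t))\<^sup>2" by simp
    also have "\<dots> \<le> ((norm b)\<^sup>2 + (norm a)\<^sup>2) * exp (N * t / 1)"
      using energy_bound[OF U(1)[of w], of 1 t N] N t U(2,3) by auto
    also have "\<dots> \<le> ((norm b)\<^sup>2 + (norm a)\<^sup>2) * exp (N * x)"
      using t M(1) by (intro mult_left_mono) (auto simp: N_def intro!: mult_left_mono)
    also have "\<dots> = B\<^sup>2" by (simp add: B_def power_mult_distrib exp_double[symmetric])
    finally show ?thesis by (rule power2_le_imp_le) (simp add: B_def)
  qed
  have B0: "B \<ge> 0" by (simp add: B_def)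
  have "\<exists>S. \<forall>t\<in>{0..x}. norm (theta z t) \<le> S \<and> norm (phi z t) \<le> S"
  proof -
    have "bounded (theta z ` {0..x})" "bounded (phi z ` {0..x})"
      by (intro compact_imp_bounded compact_continuous_image ode_sol_continuous[OF theta]
          ode_sol_continuous[OF phi] compact_Icc)+
    then obtain S1 S2 where "\<forall>t\<in>{0..x}. norm (theta z t) \<le> S1" "\<forall>t\<in>{0..x}. norm (phi z t) \<le> S2"
      unfolding bounded_iff by auto
    then show ?thesis by (intro exI[of _ "max S1 S2"]) (auto simp: le_max_iff_disj)
  qed
  then obtain S where S: "\<And>t. t \<in> {0..x} \<Longrightarrow> norm (theta z t) \<le> S"
    "\<And>t. t \<in> {0..x} \<Longrightarrow> norm (phi z t) \<le> S" by blast
  have S0: "S \<ge> 0" using S(1)[of 0] x by (auto intro: order_trans[OF norm_ge_zero])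
  \<comment> \<open>The Wronskian of \<open>U w\<close> with a solution \<open>s\<close> for the
    fixed parameter \<open>z\<close>. Its initial value does not depend on \<open>w\<close>, and its
    derivative in \<open>t\<close> carries the small factor \<open>w - z\<close>.\<close>
  define g where "g s s' w t = U w t * s' t - U' w t * s t" for s s' w t
  have dg: "((g s s' w) has_vector_derivative (w - z) * (U w t * s t)) (at t)" if "ode_sol (Q z) s s'" for s s' w t
    using wronskian_derivative[OF U(1)[of w] that, of t] by (simp add: g_def[abs_def] Q_def)
  have g0: "g s s' w 0 = a * s' 0 - b * s 0" for s s' w by (simp add: g_def U)
  have gz: "g s s' z t = g s s' z 0" if "ode_sol (Q z) s s'" for s s' t
    using wronskian_constant[OF U(1)[of z] that, of t 0] by (simp add: g_def)
  have g1: "norm (g s s' w t - g s s' z t) \<le> norm (w - z) * B * S * x"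
    if s: "ode_sol (Q z) s s'" "\<And>t. t \<in> {0..x} \<Longrightarrow> norm (s t) \<le> S" and w: "norm (w - z) \<le> 1"
      and t: "t \<in> {0..x}" for s s' w t
  proof -
    have "norm (g s s' w t - g s s' w 0) \<le> norm (w - z) * B * S * t - norm (w - z) * B * S * 0"
    proof (rule norm_diff_le_of_vector_derivative[OF _ dg[OF s(1)]])
      fix r assume "r \<in> {0..t}"
      then have r: "r \<in> {0..x}" using t by auto
      show "norm ((w - z) * (U w r * s r)) \<le> norm (w - z) * B * S"
        unfolding norm_mult mult.assoc by (intro mult_left_mono mult_mono B w s r B0) auto
    qed (use t in \<open>auto intro!: derivative_eq_intros\<close>)
    also have "\<dots> \<le> norm (w - z) * B * S * x"
      using t B0 S0 by (auto intro!: mult_left_mono mult_nonneg_nonneg)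
    finally show ?thesis using gz[OF s(1), of t] g0 by simp
  qed
  \<comment> \<open>\<open>U w\<close> is recovered from its Wronskians with \<open>theta z\<close>
    and \<open>phi z\<close>, whose coefficients are independent of \<open>w\<close>, so it is
    enough to differentiate these Wronskians.\<close>
  have U_eq: "U w t = theta z t * g (phi z) (phi' z) w t - phi z t * g (theta z) (theta' z) w t"
    "U' w t = theta' z t * g (phi z) (phi' z) w t - phi' z t * g (theta z) (theta' z) w t" for w t
  proof -
    have "theta z t * g (phi z) (phi' z) w t - phi z t * g (theta z) (theta' z) w t
      = U w t * (theta z t * phi' z t - theta' z t * phi z t)"
      by (simp add: g_def algebra_simps)
    then show "U w t = theta z t * g (phi z) (phi' z) w t - phi z t * g (theta z) (theta' z) w t"
      by (simp add: wronskian_theta_phi)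
    have "theta' z t * g (phi z) (phi' z) w t - phi' z t * g (theta z) (theta' z) w t
      = U' w t * (theta z t * phi' z t - theta' z t * phi z t)"
      by (simp add: g_def algebra_simps)
    then show "U' w t = theta' z t * g (phi z) (phi' z) w t - phi' z t * g (theta z) (theta' z) w t"
      by (simp add: wronskian_theta_phi)
  qed
  define C where "C = 2 * S * (B * S * x)"
  have C0: "C \<ge> 0" using S0 B0 x by (simp add: C_def)
  have dU: "norm (U w t - U z t) \<le> C * norm (w - z)" if w: "norm (w - z) \<le> 1" and t: "t \<in> {0..x}" for w t
  proof -
    have "norm (U w t - U z t) = norm (theta z t * (g (phi z) (phi' z) w t - g (phi z) (phi' z) z t)
      - phi z t * (g (theta z) (theta' z) w t - g (theta z) (theta' z) z t))"
      unfolding U_eq(1)[of w] U_eq(1)[of z] by (simp add: algebra_simps)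
    also have "\<dots> \<le> norm (theta z t) * norm (g (phi z) (phi' z) w t - g (phi z) (phi' z) z t)
      + norm (phi z t) * norm (g (theta z) (theta' z) w t - g (theta z) (theta' z) z t)"
      by (rule order_trans[OF norm_triangle_ineq4]) (simp add: norm_mult)
    also have "\<dots> \<le> S * (norm (w - z) * B * S * x) + S * (norm (w - z) * B * S * x)"
      by (intro add_mono mult_mono S t g1 w theta phi S0) auto
    also have "\<dots> = C * norm (w - z)" by (simp add: C_def)
    finally show ?thesis .
  qed
  have g_diff: "(\<lambda>w. g s s' w x) field_differentiable (at z)"
    if s: "ode_sol (Q z) s s'" "\<And>t. t \<in> {0..x} \<Longrightarrow> norm (s t) \<le> S" for s s'
  proof -
    \<comment> \<open>\<open>F x\<close>, the integral of \<open>U z * s\<close> from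
      \<open>0\<close> to \<open>x\<close>, is the derivative of the Wronskian with respect to
      \<open>w\<close> at \<open>z\<close>. Replacing \<open>U w\<close> by \<open>U z\<close> costs
      at most \<open>C * norm (w - z)\<close>, which makes the remainder quadratic.\<close>
    obtain F where F: "\<And>t. (F has_vector_derivative U z t * s t) (at t)" "F 0 = 0"
      using antiderivative_exists[OF continuous_on_mult[OF ode_sol_continuous(1)[OF U(1)[of z]]
            ode_sol_continuous(1)[OF s(1)]]] by blast
    have "norm (g s s' w x - g s s' z x - (w - z) * F x) \<le> C * S * x * (norm (w - z))\<^sup>2"
      if w: "norm (w - z) \<le> 1" for w
    proof -
      have "norm ((g s s' w x - (w - z) * F x) - (g s s' w 0 - (w - z) * F 0))
        \<le> C * S * (norm (w - z))\<^sup>2 * x - C * S * (norm (w - z))\<^sup>2 * 0"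
      proof (rule norm_diff_le_of_vector_derivative)
        fix t assume t: "t \<in> {0..x}"
        show "((\<lambda>t. g s s' w t - (w - z) * F t) has_vector_derivative
          (w - z) * (U w t * s t) - (w - z) * (U z t * s t)) (at t)"
          by (auto intro!: derivative_eq_intros dg s F)
        have "norm ((w - z) * (U w t * s t) - (w - z) * (U z t * s t))
          = norm (w - z) * (norm (U w t - U z t) * norm (s t))"
          by (simp add: norm_mult[symmetric] algebra_simps)
        also have "\<dots> \<le> norm (w - z) * ((C * norm (w - z)) * S)"
          using C0 by (intro mult_left_mono mult_mono dU w t s) auto
        finally show "norm ((w - z) * (U w t * s t) - (w - z) * (U z t * s t)) \<le> C * S * (norm (w - z))\<^sup>2"
          by (simp add: power2_eq_square mult_ac)
      qed (use x in \<open>auto intro!: derivative_eq_intros\<close>)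
      moreover have "g s s' z x = g s s' w 0" by (simp only: gz[OF s(1)] g0)
      ultimately show ?thesis using F(2) by (simp add: algebra_simps)
    qed
    then have "((\<lambda>w. g s s' w x) has_field_derivative F x) (at z)"
      by (rule has_field_derivative_of_quadratic_remainder)
    then show ?thesis by (auto simp: field_differentiable_def)
  qed
  have gd: "(\<lambda>w. g (phi z) (phi' z) w x) field_differentiable (at z)"
    "(\<lambda>w. g (theta z) (theta' z) w x) field_differentiable (at z)"
    using g_diff[OF phi S(2)] g_diff[OF theta S(1)] by blast+
  show "(\<lambda>z. U z x) field_differentiable (at z)" "(\<lambda>z. U' z x) field_differentiable (at z)"
    unfolding U_eq[of _ x]
    by (intro field_differentiable_diff field_differentiable_mult gd field_differentiable_const)+
qed

lemma holomorphic_theta: "x \<ge> 0 \<Longrightarrow> (\<lambda>z. theta z x) holomorphic_on S"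
  and holomorphic_theta': "x \<ge> 0 \<Longrightarrow> (\<lambda>z. theta' z x) holomorphic_on S"
  unfolding holomorphic_on_def
  by (blast intro: field_differentiable_at_within solution_family_differentiable[OF theta theta_0])+

lemma holomorphic_phi: "x \<ge> 0 \<Longrightarrow> (\<lambda>z. phi z x) holomorphic_on S"
  and holomorphic_phi': "x \<ge> 0 \<Longrightarrow> (\<lambda>z. phi' z x) holomorphic_on S"
  unfolding holomorphic_on_def
  by (blast intro: field_differentiable_at_within solution_family_differentiable[OF phi phi_0])+

end

section \<open>Weyl solutions\<close>

text \<open>Let \<open>G\<close> be the derivative of \<open>|p|^2\<close> minus
  \<open>|p|^2\<close> itself. Since \<open>G' + G = 2 |p'|^2 + (2 Re Q - 1) |p|^2\<close> is
  nonnegative and the data at \<open>X\<close> give \<open>G X = 1\<close>, \<open>G\<close> stays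
  positive from \<open>X\<close> on, and hence \<open>|p|^2 exp (- t)\<close> increases.\<close>

lemma growing_solution:
  assumes p: "ode_sol Q p p'" "p X = 1" "p' X = 1" and Q: "\<And>t. t \<ge> X \<Longrightarrow> Re (Q t) \<ge> 1"
    and xy: "X \<le> x" "x \<le> y"
  shows "(norm (p x))\<^sup>2 * exp (y - x) \<le> (norm (p y))\<^sup>2"
proof -
  define G where "G t = 2 * Re (cnj (p t) * p' t) - (norm (p t))\<^sup>2" for t
  define G' where "G' t = 2 * Re (cnj (p' t) * p' t + cnj (p t) * (Q t * p t)) - 2 * Re (cnj (p t) * p' t)" for t
  have dG: "(G has_real_derivative G' t) (at t)" for t
    unfolding G_def G'_def
    by (rule DERIV_diff[OF DERIV_cmult[OF has_real_derivative_Re_cnj_mult[OF ode_solD[OF p(1)]]]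
          has_real_derivative_norm_square[OF ode_solD(1)[OF p(1)]]])
  have G: "G t \<ge> 0" if "t \<ge> X" for t
  proof -
    have "G X * exp X \<le> G t * exp t"
    proof (rule DERIV_nonneg_imp_nondecreasing[OF that])
      fix s assume s: "X \<le> s" "s \<le> t"
      have "G' s + G s = 2 * (norm (p' s))\<^sup>2 + (2 * Re (Q s) - 1) * (norm (p s))\<^sup>2"
        unfolding G_def G'_def by (simp add: cmod_power2) (simp add: algebra_simps power2_eq_square)
      then have "(G' s + G s) * exp s \<ge> 0" using Q[of s] s by simp
      moreover have "((\<lambda>t. G t * exp t) has_real_derivative (G' s + G s) * exp s) (at s)"
        by (auto intro!: derivative_eq_intros dG simp: algebra_simps)
      ultimately show "\<exists>y. ((\<lambda>t. G t * exp t) has_real_derivative y) (at s) \<and> 0 \<le> y" by blast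
    qed
    moreover have "G X = 1" using p by (simp add: G_def)
    ultimately have "0 < G t * exp t" using exp_gt_zero[of X] by (metis less_le_trans mult_1)
    then show ?thesis by (simp add: zero_less_mult_iff)
  qed
  have "(norm (p x))\<^sup>2 * exp (- x) \<le> (norm (p y))\<^sup>2 * exp (- y)"
  proof (rule DERIV_nonneg_imp_nondecreasing[OF xy(2)])
    fix s assume s: "x \<le> s" "s \<le> y"
    have "((\<lambda>t. (norm (p t))\<^sup>2 * exp (- t)) has_real_derivative
        (norm (p s))\<^sup>2 * (exp (- s) * - 1) + 2 * Re (cnj (p s) * p' s) * exp (- s)) (at s)"
      by (rule DERIV_mult'[OF has_real_derivative_norm_square[OF ode_solD(1)[OF p(1)]]])
        (auto intro!: derivative_eq_intros)
    moreover have "(norm (p s))\<^sup>2 * (exp (- s) * - 1) + 2 * Re (cnj (p s) * p' s) * exp (- s) = G s * exp (- s)"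
      by (simp add: G_def algebra_simps)
    ultimately show "\<exists>d. ((\<lambda>t. (norm (p t))\<^sup>2 * exp (- t)) has_real_derivative d) (at s) \<and> 0 \<le> d"
      using G[of s] s xy by (intro exI[of _ "G s * exp (- s)"]) auto
  qed
  then have "(norm (p x))\<^sup>2 * exp (- x) * exp y \<le> (norm (p y))\<^sup>2 * exp (- y) * exp y"
    by (intro mult_right_mono) auto
  then show ?thesis by (simp add: mult.assoc exp_add[symmetric])
qed

text \<open>The Wronskian of \<open>p\<close> and \<open>q\<close> is \<open>1\<close>, so
  \<open>q / p\<close> has the derivative \<open>1 / p^2\<close>, which is exponentially small.
  Hence \<open>q / p\<close> has a limit \<open>J\<close> at infinity, and \<open>J * p - q\<close>
  is the candidate for the decaying solution.\<close>

lemma solution_ratio_cauchy: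
  assumes p: "ode_sol Q p p'" "p X = 1" "p' X = 1" and Q: "\<And>t. t \<ge> X \<Longrightarrow> Re (Q t) \<ge> 1"
    and q: "ode_sol Q q q'" "q X = 0" "q' X = 1"
    and xy: "X \<le> x" "x \<le> y"
  shows "norm (q y / p y - q x / p x) \<le> 1 / (norm (p x))\<^sup>2"
proof -
  have px: "norm (p t) > 0" if "t \<ge> X" for t
  proof -
    have "exp (t - X) \<le> (norm (p t))\<^sup>2"
      using growing_solution[OF p Q order_refl that] p(2) by simp
    then have "0 < (norm (p t))\<^sup>2" using exp_gt_zero[of "t - X"] by linarith
    then show ?thesis by simp
  qed
  have W: "p t * q' t - p' t * q t = 1" for t
    using wronskian_constant[OF p(1) q(1), of t X] p q by simp
  have "norm (q y / p y - q x / p x)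
    \<le> - exp (x - y) / (norm (p x))\<^sup>2 - - exp (x - x) / (norm (p x))\<^sup>2"
  proof (rule norm_diff_le_of_vector_derivative[OF xy(2)])
    fix t assume "t \<in> {x..y}"
    then have t: "t \<ge> X" "t \<ge> x" using xy by auto
    have p0: "p t \<noteq> 0" using px[OF t(1)] by auto
    have "(inverse has_field_derivative - inverse (p t ^ 2)) (at (p t))"
      using DERIV_inverse[OF p0] by (simp add: numeral_2_eq_2 power_inverse)
    from field_vector_diff_chain_at[OF ode_solD(1)[OF p(1)] this]
    have "((\<lambda>t. inverse (p t)) has_vector_derivative p' t * - inverse (p t ^ 2)) (at t)"
      by (simp add: o_def)
    then have "((\<lambda>t. q t * inverse (p t)) has_vector_derivative
        q t * (p' t * - inverse (p t ^ 2)) + q' t * inverse (p t)) (at t)"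
      by (intro has_vector_derivative_mult ode_solD(1)[OF q(1)])
    moreover have "q t * (p' t * - inverse (p t ^ 2)) + q' t * inverse (p t) = inverse (p t ^ 2)"
      using W[of t] p0 by (simp add: field_simps power2_eq_square)
    ultimately show "((\<lambda>t. q t / p t) has_vector_derivative inverse (p t ^ 2)) (at t)"
      by (simp add: divide_inverse)
    show "((\<lambda>t. - exp (x - t) / (norm (p x))\<^sup>2) has_real_derivative exp (x - t) / (norm (p x))\<^sup>2) (at t)"
      by (rule DERIV_cong[OF DERIV_cdivide[of _ "exp (x - t)"]]) (auto intro!: derivative_eq_intros)
    have "exp (t - x) * (norm (p x))\<^sup>2 \<le> (norm (p t))\<^sup>2"
      using growing_solution[OF p Q xy(1) t(2)] by (simp add: mult.commute)
    then have "inverse ((norm (p t))\<^sup>2) \<le> inverse (exp (t - x) * (norm (p x))\<^sup>2)"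
      using px[OF xy(1)] by (intro le_imp_inverse_le) auto
    also have "\<dots> = exp (x - t) / (norm (p x))\<^sup>2"
      by (simp add: inverse_eq_divide exp_diff)
    finally show "norm (inverse (p t ^ 2)) \<le> exp (x - t) / (norm (p x))\<^sup>2"
      by (simp add: norm_inverse norm_power)
  qed
  also have "\<dots> = (1 - exp (x - y)) / (norm (p x))\<^sup>2" by (simp add: diff_divide_distrib)
  also have "\<dots> \<le> 1 / (norm (p x))\<^sup>2" by (intro divide_right_mono) auto
  finally show ?thesis .
qed

context potential
begin

lemma V_ge_eventually: "\<exists>X\<ge>0. \<forall>x\<ge>X. V x \<ge> B"
proof -
  have "\<forall>\<^sub>F x in at_top. V x \<ge> B" using at_top by (simp add: filterlim_at_top)
  then obtain X where "\<And>x. x \<ge> X \<Longrightarrow> V x \<ge> B" by (auto simp: eventually_at_top_linorder)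
  then show ?thesis by (intro exI[of _ "max X 0"]) auto
qed

text \<open>Boundedness on the half line singles out the decaying solution up to factors without any
  integral: each solution that is not a multiple of it turns out to be unbounded.\<close>

definition bounded_sol :: "complex \<Rightarrow> complex \<Rightarrow> complex \<Rightarrow> bool" where
  "bounded_sol z a b \<longleftrightarrow> (\<exists>M. \<forall>x\<ge>0. norm (a * theta z x + b * phi z x) \<le> M)"

text \<open>The Weyl function takes the value \<open>0\<close> at its poles, so that its zero set on the real line
  is the whole spectrum.\<close>

definition m :: "complex \<Rightarrow> complex" where
  "m z = (if bounded_sol z 0 1 then 0 else THE c. bounded_sol z 1 c)"

abbreviation psi :: "complex \<Rightarrow> real \<Rightarrow> complex" where
  "psi z x \<equiv> theta z x + m z * phi z x"

text \<open>The bounded solutions are exactly the multiples of the one with coefficients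
  \<open>\<alpha>\<close>, \<open>\<beta>\<close>: eventually having norm at least \<open>1\<close>
  becomes unboundedness after rescaling. For \<open>\<alpha> = 0\<close> the convention in the
  definition of \<open>m\<close> agrees with division by zero.\<close>

lemma m_eq_quotient:
  fixes \<alpha> \<beta> :: complex
  assumes nz: "\<alpha> \<noteq> 0 \<or> \<beta> \<noteq> 0"
    and bounded: "bounded_sol z \<alpha> \<beta>"
    and large: "\<And>a b. a * \<beta> \<noteq> b * \<alpha> \<Longrightarrow> \<exists>Y. \<forall>x\<ge>Y. norm (a * theta z x + b * phi z x) \<ge> 1"
  shows "m z = \<beta> / \<alpha>"
proof -
  have b: "bounded_sol z a b \<longleftrightarrow> a * \<beta> = b * \<alpha>" for a b
  proof
    assume "bounded_sol z a b"
    then obtain M where M: "\<And>x. x \<ge> 0 \<Longrightarrow> norm (a * theta z x + b * phi z x) \<le> M"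
      by (auto simp: bounded_sol_def)
    show "a * \<beta> = b * \<alpha>"
    proof (rule ccontr)
      \<comment> \<open>Chosen with \<open>norm c * M < 1\<close>, so that the rescaled solution
        violates \<open>large\<close>.\<close>
      define c where "c = complex_of_real (1 / (\<bar>M\<bar> + 1) / 2)"
      have "1 / (\<bar>M\<bar> + 1) / 2 > 0" by simp
      then have c: "c \<noteq> 0" unfolding c_def of_real_eq_0_iff by linarith
      have norm_c: "norm c = 1 / (\<bar>M\<bar> + 1) / 2" unfolding c_def norm_of_real by simp
      assume "a * \<beta> \<noteq> b * \<alpha>"
      then have "(c * a) * \<beta> \<noteq> (c * b) * \<alpha>" using c by (simp add: mult.assoc)
      then obtain Y where Y: "\<And>x. x \<ge> Y \<Longrightarrow> norm ((c * a) * theta z x + (c * b) * phi z x) \<ge> 1"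
        using large by blast
      define x where "x = max 0 Y"
      have "1 \<le> norm (c * (a * theta z x + b * phi z x))"
        using Y[of x] by (simp add: x_def algebra_simps)
      also have "\<dots> \<le> norm c * M"
        unfolding norm_mult by (intro mult_left_mono M) (auto simp: x_def)
      also have "\<dots> < 1" unfolding norm_c by (simp add: field_simps)
      finally show False by simp
    qed
  next
    assume ab: "a * \<beta> = b * \<alpha>"
    obtain t where t: "a = t * \<alpha>" "b = t * \<beta>"
    proof (cases "\<alpha> = 0")
      case True
      then show ?thesis using ab nz by (intro that[of "b / \<beta>"]) auto
    next
      case False
      then show ?thesis using ab by (intro that[of "a / \<alpha>"]) (auto simp: field_simps)
    qed
    obtain C where C: "\<And>x. x \<ge> 0 \<Longrightarrow> norm (\<alpha> * theta z x + \<beta> * phi z x) \<le> C"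
      using bounded by (auto simp: bounded_sol_def)
    have "a * theta z x + b * phi z x = t * (\<alpha> * theta z x + \<beta> * phi z x)" for x
      by (simp add: t algebra_simps)
    then have "norm (a * theta z x + b * phi z x) \<le> norm t * C" if "x \<ge> 0" for x
      using C[OF that] by (simp add: norm_mult mult_left_mono)
    then show "bounded_sol z a b" by (auto simp: bounded_sol_def)
  qed
  show ?thesis
  proof (cases "\<alpha> = 0")
    case True
    then show ?thesis using b[of 0 1] by (simp add: m_def)
  next
    case False
    have "(THE c. bounded_sol z 1 c) = \<beta> / \<alpha>"
      using False by (intro the_equality) (auto simp: b field_simps)
    then show ?thesis using b[of 0 1] False by (simp add: m_def)
  qed
qed

text \<open>\<open>\<alpha> z * theta z + \<beta> z * phi z\<close> is the solution decaying at \<open>\<infinity>\<close>.  No canonical normalization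
  is entire in \<open>z\<close>, so \<open>\<alpha>\<close> and \<open>\<beta>\<close> are obtained on left half planes only.\<close>

lemma weyl_coefficients:
  obtains \<alpha> \<beta> :: "complex \<Rightarrow> complex"
  where "\<alpha> holomorphic_on {z. Re z < R}" "\<beta> holomorphic_on {z. Re z < R}"
    and "\<And>z. Re z < R \<Longrightarrow> \<alpha> z \<noteq> 0 \<or> \<beta> z \<noteq> 0"
    and "\<And>z. Re z < R \<Longrightarrow> \<alpha> (cnj z) = cnj (\<alpha> z) \<and> \<beta> (cnj z) = cnj (\<beta> z)"
    and "\<And>z. Re z < R \<Longrightarrow> \<exists>C. \<forall>x\<ge>0. norm (\<alpha> z * theta z x + \<beta> z * phi z x) \<le> C * exp (- x / 2)"
    and "\<And>z a b. Re z < R \<Longrightarrow> a * \<beta> z \<noteq> b * \<alpha> z \<Longrightarrow> \<exists>Y. \<forall>x\<ge>Y. norm (a * theta z x + b * phi z x) \<ge> 1"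
    and "\<And>z. Re z < R \<Longrightarrow> Im z > 0 \<Longrightarrow> Im (\<beta> z * cnj (\<alpha> z)) > 0"
    and "\<And>z. Re z < R \<Longrightarrow> m z = \<beta> z / \<alpha> z"
proof -
  \<comment> \<open>Beyond \<open>X\<close> the coefficient \<open>V - z\<close> has real part at
    least \<open>1\<close>, uniformly for \<open>Re z < R\<close>; this is why the construction is
    tied to a left half plane.\<close>
  obtain X where X: "X \<ge> 0" "\<And>x. x \<ge> X \<Longrightarrow> V x \<ge> R + 1" using V_ge_eventually[of "R+1"] by blast
  \<comment> \<open>The coefficients are read off from the Wronskian \<open>1\<close> at
    \<open>X\<close>: they give \<open>p\<close> the data \<open>1\<close>, \<open>1\<close> and
    \<open>q\<close> the data \<open>0\<close>, \<open>1\<close> at that point.\<close>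
  define A where "A z = phi' z X - phi z X" for z
  define B where "B z = theta z X - theta' z X" for z
  define p where "p z x = A z * theta z x + B z * phi z x" for z x
  define p' where "p' z x = A z * theta' z x + B z * phi' z x" for z x
  define q where "q z x = - phi z X * theta z x + theta z X * phi z x" for z x
  define q' where "q' z x = - phi z X * theta' z x + theta z X * phi' z x" for z x
  have p: "ode_sol (Q z) (p z) (p' z)" and q: "ode_sol (Q z) (q z) (q' z)" for z
    unfolding p_def p'_def q_def q'_def by (intro ode_sol_linear theta phi)+
  have pX: "p z X = 1" "p' z X = 1" "q z X = 0" "q' z X = 1" for z
    using wronskian_theta_phi[of z X] unfolding p_def p'_def q_def q'_def A_def B_def
    by (simp_all add: algebra_simps)
  have Q1: "Re (Q z t) \<ge> 1" if "Re z < R" "t \<ge> X" for z t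
    using X(2)[OF that(2)] that(1) by (simp add: Q_def)
  have p_ge: "exp (x - X) \<le> (norm (p z x))\<^sup>2" if "Re z < R" "x \<ge> X" for z x
    using growing_solution[OF p pX(1,2) Q1[OF that(1)] order_refl that(2)] pX by simp
  have p0: "p z x \<noteq> 0" if "Re z < R" "x \<ge> X" for z x
    using p_ge[OF that] exp_gt_zero[of "x - X"] by (metis norm_zero not_less zero_power2)
  define r where "r z x = q z x / p z x" for z x
  have r: "norm (r z y - r z x) \<le> 1 / (norm (p z x))\<^sup>2" if "Re z < R" "X \<le> x" "x \<le> y" for z x y
    unfolding r_def by (rule solution_ratio_cauchy[OF p pX(1,2) Q1[OF that(1)] q pX(3,4) that(2,3)])
  have p_inv: "1 / (norm (p z x))\<^sup>2 \<le> exp (X - x)" if "Re z < R" "X \<le> x" for z x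
    using le_imp_inverse_le[OF p_ge[OF that]] by (simp add: divide_inverse exp_minus[symmetric])
  \<comment> \<open>The points \<open>X + n\<close> do not depend on \<open>z\<close>, so the terms
    are holomorphic in \<open>z\<close>; they converge uniformly on the half plane with error at
    most \<open>exp (- n)\<close>.\<close>
  define J where "J z = lim (\<lambda>n. r z (X + real n))" for z
  have exp_lim: "(\<lambda>n. exp (- real n)) \<longlonglongrightarrow> 0"
    by (rule filterlim_compose[OF exp_at_bot])
      (simp add: filterlim_uminus_at_bot_at_top filterlim_real_sequentially filterlim_uminus_at_bot)
  have J_lim: "(\<lambda>n. r z (X + real n)) \<longlonglongrightarrow> J z" if z: "Re z < R" for z
  proof -
    have "Cauchy (\<lambda>n. r z (X + real n))"
    proof (rule CauchyI')
      fix e :: real assume "e > 0"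
      then have "\<forall>\<^sub>F n in sequentially. exp (- real n) < e"
        using exp_lim by (simp add: order_tendsto_iff)
      then obtain M where M: "\<And>n. n \<ge> M \<Longrightarrow> exp (- real n) < e" by (auto simp: eventually_sequentially)
      have "dist (r z (X + real m)) (r z (X + real n)) < e" if mn: "m \<ge> M" "n > m" for m n
      proof -
        have "norm (r z (X + real n) - r z (X + real m)) \<le> exp (X - (X + real m))"
          using r[OF z, of "X + real m" "X + real n"] p_inv[OF z, of "X + real m"] mn by simp
        also have "\<dots> < e" using M[OF mn(1)] by simp
        finally show ?thesis by (simp add: dist_norm norm_minus_commute)
      qed
      then show "\<exists>M. \<forall>m\<ge>M. \<forall>n>m. dist (r z (X + real m)) (r z (X + real n)) < e" by blast
    qed
    then show ?thesis unfolding J_def by (simp add: Cauchy_convergent convergent_LIMSEQ_iff[symmetric])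
  qed
  have J_bound: "norm (J z - r z x) \<le> 1 / (norm (p z x))\<^sup>2" if "Re z < R" "X \<le> x" for z x
  proof (rule tendsto_upperbound)
    show "(\<lambda>n. norm (r z (X + real n) - r z x)) \<longlonglongrightarrow> norm (J z - r z x)"
      by (intro tendsto_intros J_lim that)
    have "\<forall>\<^sub>F n in sequentially. x - X \<le> real n"
      using filterlim_real_sequentially by (simp add: filterlim_at_top)
    then show "\<forall>\<^sub>F n in sequentially. norm (r z (X + real n) - r z x) \<le> 1 / (norm (p z x))\<^sup>2"
      by eventually_elim (rule r, use that in auto)
  qed simp
  have open_R: "open {z. Re z < R}" by (rule open_halfspace_Re_lt)
  have hol_r: "(\<lambda>z. r z (X + real n)) holomorphic_on {z. Re z < R}" for n
    unfolding r_def p_def q_def A_def B_def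
    by (intro holomorphic_intros holomorphic_theta holomorphic_theta' holomorphic_phi holomorphic_phi')
      (use X(1) p0[of _ "X + real n"] in \<open>auto simp: p_def A_def B_def\<close>)
  have hol_J: "J holomorphic_on {z. Re z < R}"
  proof (rule holomorphic_uniform_sequence[OF open_R hol_r])
    fix z assume "z \<in> {z. Re z < R}"
    then obtain d where d: "d > 0" "cball z d \<subseteq> {z. Re z < R}"
      using open_R open_contains_cball by blast
    have "uniform_limit (cball z d) (\<lambda>n z. r z (X + real n)) J sequentially"
      unfolding uniform_limit_iff
    proof (intro allI impI)
      fix e :: real assume "e > 0"
      then have "\<forall>\<^sub>F n in sequentially. exp (- real n) < e"
        using exp_lim by (simp add: order_tendsto_iff)
      then show "\<forall>\<^sub>F n in sequentially. \<forall>w\<in>cball z d. dist (r w (X + real n)) (J w) < e"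
      proof eventually_elim
        case (elim n)
        show ?case
        proof
          fix w assume "w \<in> cball z d"
          then have w: "Re w < R" using d by auto
          show "dist (r w (X + real n)) (J w) < e"
            using J_bound[OF w, of "X + real n"] p_inv[OF w, of "X + real n"] elim
            by (simp add: dist_norm norm_minus_commute)
        qed
      qed
    qed
    then show "\<exists>d>0. cball z d \<subseteq> {z. Re z < R} \<and>
        uniform_limit (cball z d) (\<lambda>n z. r z (X + real n)) J sequentially" using d by blast
  qed
  \<comment> \<open>\<open>\<alpha>\<close> and \<open>\<beta>\<close> are the coefficients of
    \<open>J * p - q\<close> with respect to \<open>theta\<close> and \<open>phi\<close>, that is,
    its data at \<open>0\<close>.\<close>
  define \<alpha> where "\<alpha> z = J z * A z + phi z X" for z
  define \<beta> where "\<beta> z = J z * B z - theta z X" for z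
  define u where "u z x = \<alpha> z * theta z x + \<beta> z * phi z x" for z x
  define u' where "u' z x = \<alpha> z * theta' z x + \<beta> z * phi' z x" for z x
  have u: "ode_sol (Q z) (u z) (u' z)" for z
    unfolding u_def u'_def by (intro ode_sol_linear theta phi)
  have u_eq: "u z x = J z * p z x - q z x" "u' z x = J z * p' z x - q' z x" for z x
    by (simp_all add: u_def u'_def p_def p'_def q_def q'_def \<alpha>_def \<beta>_def algebra_simps)
  have u0: "u z 0 = \<alpha> z" "u' z 0 = \<beta> z" for z by (simp_all add: u_def u'_def)
  have W_pu: "p z x * u' z x - p' z x * u z x = - 1" for z x
    using wronskian_constant[OF p q, of z x X] pX by (simp add: u_eq algebra_simps)
  have nonzero: "\<alpha> z \<noteq> 0 \<or> \<beta> z \<noteq> 0" for z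
    using W_pu[of z 0] u0[of z] by auto
  \<comment> \<open>Factoring out \<open>p\<close> leaves the tail \<open>J - q / p\<close>, which
    is at most \<open>1 / |p|^2\<close>, so \<open>u\<close> decays at least like
    \<open>1 / |p|\<close>.\<close>
  have u_bound: "norm (u z x) \<le> exp ((X - x) / 2)" if z: "Re z < R" and x: "x \<ge> X" for z x
  proof -
    have "u z x = p z x * (J z - r z x)" using p0[OF that] by (simp add: u_eq r_def field_simps)
    then have "norm (u z x) = norm (p z x) * norm (J z - r z x)" by (simp add: norm_mult)
    also have "\<dots> \<le> norm (p z x) * (1 / (norm (p z x))\<^sup>2)" by (intro mult_left_mono J_bound that) auto
    also have "\<dots> = 1 / norm (p z x)" using p0[OF that] by (simp add: power2_eq_square)
    finally have "(norm (u z x))\<^sup>2 \<le> (1 / norm (p z x))\<^sup>2" by (intro power_mono) auto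
    also have "\<dots> \<le> exp (X - x)" using p_inv[OF that] by (simp add: power_divide)
    also have "\<dots> = (exp ((X - x) / 2))\<^sup>2" by (simp add: exp_double[symmetric])
    finally show ?thesis by (rule power2_le_imp_le) simp
  qed
  show ?thesis
  proof (rule that)
    show "\<alpha> holomorphic_on {z. Re z < R}" "\<beta> holomorphic_on {z. Re z < R}"
      unfolding \<alpha>_def \<beta>_def A_def B_def
      by (intro holomorphic_intros hol_J holomorphic_theta holomorphic_theta' holomorphic_phi holomorphic_phi' X(1))+
    show "\<alpha> z \<noteq> 0 \<or> \<beta> z \<noteq> 0" for z by (rule nonzero)
    show "\<alpha> (cnj z) = cnj (\<alpha> z) \<and> \<beta> (cnj z) = cnj (\<beta> z)" if z: "Re z < R" for z
    proof -
      have "r (cnj z) x = cnj (r z x)" for x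
        by (simp add: r_def p_def q_def A_def B_def theta_cnj phi_cnj)
      then have "(\<lambda>n. r (cnj z) (X + real n)) \<longlonglongrightarrow> cnj (J z)"
        using tendsto_cnj[OF J_lim[OF z]] by simp
      moreover have "(\<lambda>n. r (cnj z) (X + real n)) \<longlonglongrightarrow> J (cnj z)"
        by (rule J_lim) (use z in simp)
      ultimately have "J (cnj z) = cnj (J z)" by (rule LIMSEQ_unique[symmetric])
      then show ?thesis by (simp add: \<alpha>_def \<beta>_def A_def B_def theta_cnj phi_cnj)
    qed
    show decay: "\<exists>C. \<forall>x\<ge>0. norm (\<alpha> z * theta z x + \<beta> z * phi z x) \<le> C * exp (- x / 2)" if z: "Re z < R" for z
    proof -
      have "bounded (u z ` {0..X})"
        by (intro compact_imp_bounded compact_continuous_image ode_sol_continuous[OF u] compact_Icc)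
      then obtain D where D: "\<And>x. x \<in> {0..X} \<Longrightarrow> norm (u z x) \<le> D"
        unfolding bounded_iff by blast
      have "norm (u z x) \<le> (max 1 D * exp (X / 2)) * exp (- x / 2)" if x: "x \<ge> 0" for x
      proof (cases "x \<le> X")
        case True
        have "norm (u z x) \<le> max 1 D * 1" using D[of x] x True by auto
        also have "\<dots> \<le> max 1 D * exp ((X - x) / 2)" using True by (intro mult_left_mono) auto
        finally show ?thesis by (simp add: mult.assoc exp_add[symmetric] diff_divide_distrib)
      next
        case False
        then have "norm (u z x) \<le> 1 * exp ((X - x) / 2)" using u_bound[OF z, of x] by simp
        also have "\<dots> \<le> max 1 D * exp ((X - x) / 2)" by (intro mult_right_mono) auto
        finally show ?thesis by (simp add: mult.assoc exp_add[symmetric] diff_divide_distrib)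
      qed
      then show ?thesis unfolding u_def by blast
    qed
    show large: "\<exists>Y. \<forall>x\<ge>Y. norm (a * theta z x + b * phi z x) \<ge> 1"
      if z: "Re z < R" and ab: "a * \<beta> z \<noteq> b * \<alpha> z" for z a b
    proof -
      define v where "v x = a * theta z x + b * phi z x" for x
      define v' where "v' x = a * theta' z x + b * phi' z x" for x
      have v: "ode_sol (Q z) v v'" unfolding v_def v'_def by (intro ode_sol_linear theta phi)
      define w where "w = a * \<beta> z - b * \<alpha> z"
      have w: "v x * u' z x - v' x * u z x = w" for x
        using wronskian_constant[OF v u, of x 0] u0[of z] by (simp add: v_def v'_def w_def)
      define c where "c = v 0 * p' z 0 - v' 0 * p z 0"
      have c: "v x * p' z x - v' x * p z x = c" for x
        using wronskian_constant[OF v p, of x 0] by (simp add: c_def)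
      have w0: "norm w > 0" using ab by (simp add: w_def)
      have "LIM x at_top. norm w * exp ((x - X) / 2) :> at_top"
        by (rule filterlim_tendsto_pos_mult_at_top[OF tendsto_const w0])
          (rule filterlim_compose[OF exp_at_top], real_asymp)
      then have "\<forall>\<^sub>F x in at_top. norm w * exp ((x - X) / 2) \<ge> 1 + norm c"
        by (simp add: filterlim_at_top)
      then obtain Y where Y: "\<And>x. x \<ge> Y \<Longrightarrow> norm w * exp ((x - X) / 2) \<ge> 1 + norm c"
        by (auto simp: eventually_at_top_linorder)
      have "norm (v x) \<ge> 1" if x: "x \<ge> max X Y" for x
      proof -
        \<comment> \<open>In the basis \<open>p\<close>, \<open>u\<close> the coefficient of the
          growing solution \<open>p\<close> is, up to sign, the Wronskian \<open>w\<close> of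
          \<open>v\<close> with the decaying one, and \<open>w\<close> is nonzero by
          assumption.\<close>
        have "v x = - (p z x * w) + u z x * c"
        proof -
          have "- (p z x * w) + u z x * c = v x * - (p z x * u' z x - p' z x * u z x)"
            unfolding w[of x, symmetric] c[of x, symmetric] by (simp add: algebra_simps)
          then show ?thesis by (simp add: W_pu)
        qed
        then have "norm (p z x * w) \<le> norm (v x) + norm (u z x * c)"
          using norm_triangle_ineq4[of "u z x * c" "v x"] by simp
        moreover have "norm (u z x * c) \<le> 1 * norm c"
        proof -
          have "norm (u z x) \<le> exp ((X - x) / 2)" using u_bound[OF z, of x] x by simp
          also have "\<dots> \<le> 1" using x by simp
          finally show ?thesis unfolding norm_mult by (intro mult_right_mono) auto
        qed
        moreover have "norm (p z x * w) \<ge> norm w * exp ((x - X) / 2)"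
        proof -
          have "(exp ((x - X) / 2))\<^sup>2 = exp (x - X)"
            by (simp add: power2_eq_square flip: exp_add)
          then have "(exp ((x - X) / 2))\<^sup>2 \<le> (norm (p z x))\<^sup>2"
            using p_ge[OF z, of x] x by simp
          then have "exp ((x - X) / 2) \<le> norm (p z x)" by (rule power2_le_imp_le) simp
          then show ?thesis by (simp add: norm_mult mult.commute mult_left_mono)
        qed
        ultimately show ?thesis using Y[of x] x by simp
      qed
      then show ?thesis unfolding v_def by blast
    qed
    show "m z = \<beta> z / \<alpha> z" if z: "Re z < R" for z
    proof (rule m_eq_quotient[OF nonzero _ large[OF z]])
      obtain C where C: "\<And>x. x \<ge> 0 \<Longrightarrow> norm (\<alpha> z * theta z x + \<beta> z * phi z x) \<le> C * exp (- x / 2)"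
        using decay[OF z] by blast
      have "norm (\<alpha> z * theta z x + \<beta> z * phi z x) \<le> \<bar>C\<bar>" if "x \<ge> 0" for x
      proof -
        have "C * exp (- x / 2) \<le> \<bar>C\<bar> * 1" using that by (intro mult_mono) auto
        then show ?thesis using C[OF that] by simp
      qed
      then show "bounded_sol z (\<alpha> z) (\<beta> z)" by (auto simp: bounded_sol_def)
    qed
    show "Im (\<beta> z * cnj (\<alpha> z)) > 0" if z: "Re z < R" "Im z > 0" for z
    proof -
      \<comment> \<open>This is \<open>Im (f' * cnj f)\<close>, written as a real part so that the
        product rule already proved applies. Its derivative is \<open>- Im z * |f|^2\<close>, hence
        it decreases for \<open>Im z > 0\<close>.\<close>
      define h where "h f f' x = Re (cnj (f x) * (- \<i> * f' x))" for f f' :: "real \<Rightarrow> complex" and x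
      have h_Im: "h f f' x = Im (f' x * cnj (f x))" for f f' x by (simp add: h_def)
      have dh: "(h f f' has_real_derivative - (Im z * (norm (f x))\<^sup>2)) (at x)"
        if f: "ode_sol (Q z) f f'" for f f' x
        unfolding h_def
        by (rule DERIV_cong[OF has_real_derivative_Re_cnj_mult[OF ode_solD(1)[OF f]
                has_vector_derivative_mult_right[OF ode_solD(2)[OF f]]]])
          (simp add: Q_def cmod_power2, simp add: algebra_simps power2_eq_square)
      have h_mono: "h f f' y \<le> h f f' x" if f: "ode_sol (Q z) f f'" and xy: "x \<le> y" for f f' x y
        by (rule DERIV_nonpos_imp_nonincreasing[OF xy])
          (use dh[OF f] z(2) in \<open>fastforce\<close>)
      have h0: "h (u z) (u' z) x \<ge> 0" for x
      proof (rule tendsto_lowerbound)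
        \<comment> \<open>The solution \<open>f n\<close> vanishes at \<open>X + n\<close>, where
          \<open>h\<close> is therefore \<open>0\<close>; by monotonicity \<open>h\<close> is
          nonnegative to the left of that point. The sign survives the limit, in which
          \<open>f n\<close> becomes \<open>u\<close>.\<close>
        define f where "f n x = r z (X + real n) * p z x - q z x" for n x
        define f' where "f' n x = r z (X + real n) * p' z x - q' z x" for n x
        have f: "ode_sol (Q z) (f n) (f' n)" for n
          using ode_sol_linear[OF p q, of z "r z (X + real n)" "-1"] by (simp add: f_def[abs_def] f'_def[abs_def])
        show "(\<lambda>n. h (f n) (f' n) x) \<longlonglongrightarrow> h (u z) (u' z) x"
          unfolding h_def f_def f'_def u_eq
          by (intro tendsto_intros J_lim z)
        have "\<forall>\<^sub>F n in sequentially. x - X \<le> real n"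
          using filterlim_real_sequentially by (simp add: filterlim_at_top)
        then show "\<forall>\<^sub>F n in sequentially. 0 \<le> h (f n) (f' n) x"
        proof eventually_elim
          case (elim n)
          have "f n (X + real n) = 0" using p0[OF z(1), of "X + real n"] by (simp add: f_def r_def)
          then have "h (f n) (f' n) (X + real n) = 0" by (simp add: h_def)
          then show ?case using h_mono[OF f, of x "X + real n" n] elim by simp
        qed
      qed simp
      \<comment> \<open>Otherwise \<open>h\<close> would be zero on the whole half line, its
        derivative would vanish and so would \<open>u\<close>, against the Wronskian
        \<open>- 1\<close> of \<open>p\<close> and \<open>u\<close>.\<close>
      have "h (u z) (u' z) 0 \<noteq> 0"
      proof
        assume "h (u z) (u' z) 0 = 0"
        then have hz: "h (u z) (u' z) x = 0" if "x \<ge> 0" for x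
          using h0[of x] h_mono[OF u that] by simp
        have uz: "u z x = 0" if "x > 0" for x
        proof -
          have "\<forall>\<^sub>F y in nhds x. y \<in> {0<..}" using that by (intro eventually_nhds_in_open) auto
          then have "\<forall>\<^sub>F y in nhds x. h (u z) (u' z) y = 0" by eventually_elim (simp add: hz)
          from DERIV_cong_ev[OF refl this refl, THEN iffD1, OF dh[OF u]]
          have "((\<lambda>_. 0) has_real_derivative - (Im z * (norm (u z x))\<^sup>2)) (at x)" .
          then have "- (Im z * (norm (u z x))\<^sup>2) = 0" by (metis DERIV_const DERIV_unique)
          then show ?thesis using z(2) by simp
        qed
        have "u' z 1 = 0"
        proof -
          have "((\<lambda>_. 0) has_vector_derivative u' z 1) (at (1::real))"
            by (rule has_vector_derivative_transform_within_open[where S = "{0<..}", OF ode_solD(1)[OF u]])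
              (use uz in auto)
          then show ?thesis using vector_derivative_unique_at has_vector_derivative_const by blast
        qed
        then show False using W_pu[of z 1] uz[of 1] by simp
      qed
      then show ?thesis using h0[of 0] by (simp add: h_Im u0 less_le)
    qed
  qed
qed

end

section \<open>Eigenvalues as zeros and poles of the Weyl function\<close>

lemma integrable_exp_minus_abs: "integrable lborel (\<lambda>x::real. exp (- \<bar>x\<bar>))"
proof -
  have "(\<lambda>x::real. exp (- 1 * x)) absolutely_integrable_on {0..}"
    by (intro nonnegative_absolutely_integrable_1 integrable_on_exp_minus_to_infinity) auto
  then have "integrable lebesgue (\<lambda>x::real. indicator {0..} x *\<^sub>R exp (- 1 * x))"
    by (simp add: set_integrable_def)
  then have 1: "integrable lborel (\<lambda>x::real. indicator {0..} x *\<^sub>R exp (- 1 * x))"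
    by (subst (asm) integrable_completion) auto
  from lborel_integrable_real_affine[OF this, of "-1" 0]
  have 2: "integrable lborel (\<lambda>x::real. indicator {0..} (- x) *\<^sub>R exp x)" by simp
  show ?thesis
    by (rule Bochner_Integration.integrable_bound[OF Bochner_Integration.integrable_add[OF 1 2]])
      (auto simp: indicator_def)
qed

lemma negligible_of_AE:
  fixes P :: "real \<Rightarrow> bool"
  assumes "AE x in lebesgue. P x"
  shows "negligible {x. \<not> P x}"
proof -
  obtain N where "{x. \<not> P x} \<subseteq> N" "N \<in> null_sets lebesgue"
    using assms by (auto elim!: AE_E simp: null_setsI)
  then show ?thesis using negligible_iff_null_sets negligible_subset by blast
qed

lemma continuous_AE_eq_0:
  fixes f :: "real \<Rightarrow> complex"
  assumes "continuous_on UNIV f" "AE x in lebesgue. f x = 0"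
  shows "f x = 0"
proof (rule ccontr)
  assume "f x \<noteq> 0"
  moreover have "open {x. f x \<noteq> 0}"
    using assms(1) by (simp add: open_Collect_neq)
  ultimately show False
    using open_not_negligible[of "{x. f x \<noteq> 0}"] negligible_of_AE[OF assms(2)] by auto
qed

text \<open>The left end point may depend on the length of the interval, so that one statement
  excludes solutions that are large at plus infinity as well as at minus infinity.\<close>

lemma not_integrable_of_ge_1:
  fixes f :: "real \<Rightarrow> real"
  assumes f: "integrable lebesgue f" "\<And>x. f x \<ge> 0"
    and large: "\<And>n::nat. \<exists>a. \<forall>x\<in>{a..a + real n}. f x \<ge> 1"
  shows False
proof -
  obtain n :: nat where n: "real n > integral\<^sup>L lebesgue f" using reals_Archimedean2 by blast
  obtain a where a: "\<And>x. x \<in> {a..a + real n} \<Longrightarrow> f x \<ge> 1" using large by blast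
  have "real n = integral\<^sup>L lebesgue (indicator {a..a + real n} :: real \<Rightarrow> real)" by simp
  also have "\<dots> \<le> integral\<^sup>L lebesgue f"
    by (intro integral_mono f(1)) (use f(2) a in \<open>auto simp: indicator_def\<close>)
  finally show False using n by simp
qed

section \<open>From absolutely continuous to classical solutions\<close>

lemma has_ac_derivative_eq:
  assumes "has_ac_derivative f h" "a \<le> b"
  shows "f a + integral {a..b} h = f b"
proof -
  have "f b - f a = integral {a..b} h" using assms by (simp add: has_ac_derivative_def)
  then show ?thesis by (metis add.commute diff_add_cancel)
qed

lemma ac_derivative_continuous:
  assumes "has_ac_derivative f h"
  shows "continuous_on UNIV f"
proof -
  have "isCont f x" for x
  proof -
    define a b where "a = x - 1" and "b = x + 1"
    have "h integrable_on {a..b}"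
      using assms by (auto simp: has_ac_derivative_def a_def b_def set_lebesgue_integral_eq_integral(1))
    then have "continuous_on {a..b} (\<lambda>x. f a + integral {a..x} h)"
      by (intro continuous_intros indefinite_integral_continuous_1)
    moreover have "f a + integral {a..y} h = f y" if "y \<in> {a..b}" for y
      using has_ac_derivative_eq[OF assms, of a y] that by simp
    ultimately have "continuous_on {a..b} f" by (rule continuous_on_eq)
    then show ?thesis by (rule continuous_on_interior) (auto simp: a_def b_def)
  qed
  then show ?thesis by (simp add: continuous_at_imp_continuous_on)
qed

text \<open>Regularity bootstrap: an almost everywhere derivative with a continuous version is a
  classical derivative. Used for both derivatives, it turns an element of the operator graph with
  eigenvalue \<open>l\<close> into a solution of the differential equation.\<close>

lemma ac_derivative_has_vector_derivative:
  assumes f: "has_ac_derivative f h" and k: "continuous_on UNIV k" "AE x in lebesgue. h x = k x"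
  shows "(f has_vector_derivative k x) (at x)"
proof -
  define a b where "a = x - 1" and "b = x + 1"
  have x: "x \<in> {a<..<b}" by (auto simp: a_def b_def)
  have eq: "f a + integral {a..y} k = f y" if "y \<in> {a..b}" for y
  proof -
    have "integral {a..y} k = integral {a..y} h"
      by (rule integral_spike[OF negligible_of_AE[OF k(2)]]) auto
    then show ?thesis
      using has_ac_derivative_eq[OF f, of a y] that by simp
  qed
  have "((\<lambda>y. integral {a..y} k) has_vector_derivative k x) (at x within {a..b})"
    by (rule integral_has_vector_derivative) (use x in \<open>auto intro: continuous_on_subset[OF k(1)]\<close>)
  then have "((\<lambda>y. f a + integral {a..y} k) has_vector_derivative k x) (at x within {a..b})"
    by (auto intro!: derivative_eq_intros)
  then have "((\<lambda>y. f a + integral {a..y} k) has_vector_derivative k x) (at x)"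
    using x by (simp add: at_within_interior[of x "{a..b}"])
  then show ?thesis
    by (rule has_vector_derivative_transform_within_open[OF _ _ x]) (use eq in auto)
qed

lemma has_ac_derivative_of_continuous:
  assumes "\<And>x. (f has_vector_derivative h x) (at x)" "continuous_on UNIV h"
  shows "has_ac_derivative f h"
  unfolding has_ac_derivative_def
proof (intro allI impI conjI)
  fix a b :: real assume "a \<le> b"
  show "h absolutely_integrable_on {a..b}"
    by (intro absolutely_integrable_continuous_real continuous_on_subset[OF assms(2)]) auto
  have "(h has_integral f b - f a) {a..b}"
    by (rule fundamental_theorem_of_calculus[OF \<open>a \<le> b\<close>])
      (rule has_vector_derivative_at_within[OF assms(1)])
  then show "f b - f a = integral {a..b} h" by (simp add: integral_unique)
qed

context potential
begin

lemma eigenvalue_of_decaying_solution: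
  assumes f: "ode_sol (Q (of_real l)) f f'" and C: "\<And>x. norm (f x) \<le> C * exp (- \<bar>x\<bar> / 2)" and nz: "f x \<noteq> 0"
  shows "l \<in> eigenvalues V"
proof -
  have cf: "continuous_on UNIV f" "continuous_on UNIV f'" by (rule ode_sol_continuous[OF f])+
  then have mf: "f \<in> borel_measurable borel" by (simp add: borel_measurable_continuous_onI)
  have "integrable lborel (\<lambda>x. (norm (f x))\<^sup>2)"
  proof (rule Bochner_Integration.integrable_bound)
    show "integrable lborel (\<lambda>x. C\<^sup>2 * exp (- \<bar>x\<bar>))"
      by (intro integrable_mult_right integrable_exp_minus_abs)
    have "(norm (f x))\<^sup>2 \<le> C\<^sup>2 * exp (- \<bar>x\<bar>)" for x
    proof -
      have "(norm (f x))\<^sup>2 \<le> (C * exp (- \<bar>x\<bar> / 2))\<^sup>2" by (intro power_mono C) auto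
      also have "\<dots> = C\<^sup>2 * exp (- \<bar>x\<bar>)" by (simp add: power_mult_distrib exp_double[symmetric])
      finally show ?thesis .
    qed
    then show "AE x in lborel. norm ((norm (f x))\<^sup>2) \<le> norm (C\<^sup>2 * exp (- \<bar>x\<bar>))" by (simp add: abs_mult)
  qed (use mf in measurable)
  then have "integrable lebesgue (\<lambda>x. (norm (f x))\<^sup>2)"
    by (subst integrable_completion) (use mf in measurable)
  moreover have "f \<in> borel_measurable lebesgue" using mf by (simp add: measurable_completion)
  ultimately have sq: "square_integrable f" "square_integrable (\<lambda>x. complex_of_real l * f x)"
    by (auto simp: square_integrable_def norm_mult power_mult_distrib)
  have "has_ac_derivative f f'"
    by (rule has_ac_derivative_of_continuous[OF ode_solD(1)[OF f] cf(2)])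
  moreover have "has_ac_derivative f' (\<lambda>x. Q (of_real l) x * f x)"
    by (intro has_ac_derivative_of_continuous[OF ode_solD(2)[OF f]] continuous_intros cf continuous_Q)
  moreover have "AE x in lebesgue. complex_of_real l * f x = - (Q (of_real l) x * f x) + complex_of_real (V x) * f x"
    by (simp add: Q_def algebra_simps)
  ultimately have "(f, \<lambda>x. complex_of_real l * f x) \<in> schroedinger_graph V"
    using sq unfolding schroedinger_graph_def by blast
  moreover have "\<not> (AE x in lebesgue. f x = 0)" using continuous_AE_eq_0[OF cf(1)] nz by blast
  ultimately show ?thesis unfolding eigenvalues_def by blast
qed

text \<open>If \<open>\<beta> = 0\<close> the decaying solution is a multiple of the even
  \<open>theta\<close>, if \<open>\<alpha> = 0\<close> of the odd \<open>phi\<close>; either then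
  decays at both ends. Conversely an eigenfunction \<open>a * theta + b * phi\<close> and its
  reflection \<open>a * theta - b * phi\<close> must both be multiples of the decaying solution at
  plus infinity, which forces \<open>a * \<beta> = 0\<close> and
  \<open>b * \<alpha> = 0\<close>.\<close>

lemma eigenvalues_iff: "l \<in> eigenvalues V \<longleftrightarrow> m (of_real l) = 0"
proof -
  define z where "z = complex_of_real l"
  obtain \<alpha> \<beta> where nz: "\<And>z. Re z < l + 1 \<Longrightarrow> \<alpha> z \<noteq> 0 \<or> \<beta> z \<noteq> 0"
    and decay: "\<And>z. Re z < l + 1 \<Longrightarrow> \<exists>C. \<forall>x\<ge>0. norm (\<alpha> z * theta z x + \<beta> z * phi z x) \<le> C * exp (- x / 2)"
    and big: "\<And>z a b. Re z < l + 1 \<Longrightarrow> a * \<beta> z \<noteq> b * \<alpha> z \<Longrightarrow> \<exists>Y. \<forall>x\<ge>Y. norm (a * theta z x + b * phi z x) \<ge> 1"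
    and m: "\<And>z. Re z < l + 1 \<Longrightarrow> m z = \<beta> z / \<alpha> z"
    by (rule weyl_coefficients[of "l + 1"]) blast
  have z: "Re z < l + 1" by (simp add: z_def)
  have m0: "m z = 0 \<longleftrightarrow> \<alpha> z = 0 \<or> \<beta> z = 0" using m[OF z] by auto
  obtain C where C: "\<And>x. x \<ge> 0 \<Longrightarrow> norm (\<alpha> z * theta z x + \<beta> z * phi z x) \<le> C * exp (- x / 2)"
    using decay[OF z] by blast
  show ?thesis unfolding z_def[symmetric]
  proof
    assume "m z = 0"
    then consider "\<alpha> z = 0" "\<beta> z \<noteq> 0" | "\<beta> z = 0" "\<alpha> z \<noteq> 0" using m0 nz[OF z] by blast
    then show "l \<in> eigenvalues V"
    proof cases
      case 1
      have "norm (phi z x) \<le> (C / norm (\<beta> z)) * exp (- \<bar>x\<bar> / 2)" for x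
        using C[of "\<bar>x\<bar>"] 1 phi_reflect[of z x] by (cases "x \<ge> 0") (auto simp: norm_mult field_simps)
      moreover have "\<exists>x. phi z x \<noteq> 0"
      proof (rule ccontr)
        assume "\<nexists>x. phi z x \<noteq> 0"
        then have "phi z = (\<lambda>_. 0)" by auto
        then have "((\<lambda>_. 0) has_vector_derivative phi' z 0) (at (0::real))"
          using ode_solD(1)[OF phi, of z 0] by simp
        then have "phi' z 0 = 0" using vector_derivative_unique_at has_vector_derivative_const by blast
        then show False by simp
      qed
      ultimately show ?thesis
        using eigenvalue_of_decaying_solution[OF phi[of "of_real l"]] unfolding z_def by blast
    next
      case 2
      have "norm (theta z x) \<le> (C / norm (\<alpha> z)) * exp (- \<bar>x\<bar> / 2)" for x
        using C[of "\<bar>x\<bar>"] 2 theta_reflect[of z x] by (cases "x \<ge> 0") (auto simp: norm_mult field_simps)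
      moreover have "theta z 0 \<noteq> 0" by simp
      ultimately show ?thesis
        using eigenvalue_of_decaying_solution[OF theta[of "of_real l"]] unfolding z_def by blast
    qed
  next
    assume "l \<in> eigenvalues V"
    then obtain f f' f'' where sq: "square_integrable f" and ac: "has_ac_derivative f f'" "has_ac_derivative f' f''"
      and eq: "AE x in lebesgue. complex_of_real l * f x = - f'' x + complex_of_real (V x) * f x"
      and f0: "\<not> (AE x in lebesgue. f x = 0)"
      unfolding eigenvalues_def schroedinger_graph_def by blast
    have cf: "continuous_on UNIV f" "continuous_on UNIV f'"
      using ac by (auto intro: ac_derivative_continuous)
    have "AE x in lebesgue. f'' x = Q z x * f x"
      using eq by eventually_elim (simp add: Q_def z_def algebra_simps)
    then have "(f' has_vector_derivative Q z x * f x) (at x)" for x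
      by (intro ac_derivative_has_vector_derivative[OF ac(2)] continuous_intros cf continuous_Q)
    moreover have "(f has_vector_derivative f' x) (at x)" for x
      by (intro ac_derivative_has_vector_derivative[OF ac(1)] cf) simp
    ultimately have f: "ode_sol (Q z) f f'" by (simp add: ode_sol_def)
    define a b where "a = f 0" and "b = f' 0"
    have f_eq: "f x = a * theta z x + b * phi z x" for x
      unfolding a_def b_def by (rule solution_decomp(1)[OF f])
    have ab: "a \<noteq> 0 \<or> b \<noteq> 0" using f0 f_eq by auto
    have int: "integrable lebesgue (\<lambda>x. (norm (f x))\<^sup>2)" using sq by (simp add: square_integrable_def)
    have "a * \<beta> z = b * \<alpha> z"
    proof (rule ccontr)
      assume "a * \<beta> z \<noteq> b * \<alpha> z"
      then obtain Y where "\<And>x. x \<ge> Y \<Longrightarrow> norm (f x) \<ge> 1" using big[OF z] f_eq by metis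
      then have "\<forall>x\<in>{Y..Y + real n}. (norm (f x))\<^sup>2 \<ge> 1" for n by (simp add: one_le_power)
      then show False by (intro not_integrable_of_ge_1[OF int]) auto
    qed
    moreover have "a * \<beta> z = (- b) * \<alpha> z"
    proof (rule ccontr)
      assume "a * \<beta> z \<noteq> (- b) * \<alpha> z"
      then obtain Y where "\<And>x. x \<ge> Y \<Longrightarrow> norm (a * theta z x + (- b) * phi z x) \<ge> 1" using big[OF z] by metis
      then have Y: "norm (f (- x)) \<ge> 1" if "x \<ge> Y" for x using that by (simp add: f_eq theta_reflect phi_reflect)
      have "\<forall>x\<in>{- Y - real n..- Y - real n + real n}. (norm (f x))\<^sup>2 \<ge> 1" for n
        using Y[of "- _"] by (auto intro!: one_le_power)
      then have "\<exists>a. \<forall>x\<in>{a..a + real n}. (norm (f x))\<^sup>2 \<ge> 1" for n by (rule exI)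
      then show False by (intro not_integrable_of_ge_1[OF int]) auto
    qed
    ultimately have "a * \<beta> z = 0" "b * \<alpha> z = 0" by auto
    then show "m z = 0" using ab m0 by auto
  qed
qed

end

section \<open>Analytic properties of the Weyl function\<close>

text \<open>Near \<open>z\<close> the function behaves like \<open>c * (w - z)^n\<close>. While
  \<open>w\<close> runs through a small upper half circle the argument of the power runs from
  \<open>0\<close> to \<open>n * pi\<close>, and the imaginary part has to stay nonnegative. For
  \<open>n >= 2\<close> this covers the four directions \<open>0\<close>, \<open>pi/2\<close>,
  \<open>pi\<close>, \<open>3 * pi / 2\<close> and forces \<open>c = 0\<close>; for
  \<open>n = 1\<close> it forces \<open>c\<close> to be positive.\<close>

lemma herglotz_zero_simple:
  fixes f :: "complex \<Rightarrow> complex"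
  assumes S: "open S" "z \<in> S" and f: "f holomorphic_on S" "f z = 0" and z: "Im z = 0"
    and pos: "\<And>w. w \<in> S \<Longrightarrow> Im w > 0 \<Longrightarrow> Im (f w) > 0"
  obtains h :: real where "h > 0" "((\<lambda>w. f w / (w - z)) \<longlongrightarrow> of_real h) (at z)"
proof -
  obtain d where d: "d > 0" "ball z d \<subseteq> S" using S openE by blast
  have fd: "f holomorphic_on ball z d" using f d holomorphic_on_subset by blast
  have "\<not> f constant_on ball z d"
  proof
    assume "f constant_on ball z d"
    moreover have w: "z + \<i> * of_real (d / 2) \<in> ball z d" "z \<in> ball z d"
      using d by (auto simp: dist_norm norm_mult)
    ultimately have "f (z + \<i> * of_real (d / 2)) = 0" using f(2) unfolding constant_on_def by metis
    then show False using pos[of "z + \<i> * of_real (d / 2)"] w d z by auto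
  qed
  then obtain g r n where g: "0 < n" "0 < r" "ball z r \<subseteq> ball z d" "g holomorphic_on ball z r"
    "\<And>w. w \<in> ball z r \<Longrightarrow> f w = (w - z) ^ n * g w" "\<And>w. w \<in> ball z r \<Longrightarrow> g w \<noteq> 0"
    using holomorphic_factor_zero_nonconstant[OF fd open_ball connected_ball _ f(2)] d(1)
    by (metis centre_in_ball)
  have contg: "isCont g z"
    using holomorphic_on_imp_continuous_on[OF g(4)] g(2) by (simp add: continuous_on_eq_continuous_at)
  define c where "c = g z"
  have c0: "c \<noteq> 0" using g(2,6) by (simp add: c_def)
  have pos1: "Im (cis (real n * t) * c) \<ge> 0" if t: "0 < t" "t < pi" for t
  proof (rule tendsto_lowerbound)
    show "((\<lambda>s. Im (cis (real n * t) * g (z + of_real s * cis t))) \<longlongrightarrow> Im (cis (real n * t) * c)) (at_right 0)"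
      unfolding c_def
      by (intro tendsto_intros isCont_tendsto_compose[OF contg] tendsto_eq_intros) auto
    have "\<forall>\<^sub>F s in at_right 0. s \<in> {0<..<r}"
      using g(2) by (intro eventually_at_right_real)
    then show "\<forall>\<^sub>F s in at_right 0. 0 \<le> Im (cis (real n * t) * g (z + of_real s * cis t))"
    proof eventually_elim
      case (elim s)
      define w where "w = z + of_real s * cis t"
      have w: "w \<in> ball z r" using elim by (auto simp: w_def dist_norm norm_mult)
      have "Im w > 0" using z elim sin_gt_zero[OF t] by (simp add: w_def)
      then have "0 < Im (f w)" using pos w g(3) d(2) by blast
      also have "f w = of_real (s ^ n) * (cis (real n * t) * g w)"
        unfolding g(5)[OF w] by (simp add: w_def power_mult_distrib Complex.DeMoivre)
      also have "Im \<dots> = s ^ n * Im (cis (real n * t) * g w)" by (simp add: algebra_simps)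
      finally show ?case using elim by (simp add: w_def zero_less_mult_iff)
    qed
  qed simp
  have pos2: "Im (cis (real n * t) * c) \<ge> 0" if t: "t \<in> {0..pi}" for t
  proof -
    have "closure {0<..<pi} = {0..pi}" by simp
    moreover have "continuous_on (closure {0<..<pi}) (\<lambda>t. Im (cis (real n * t) * c))"
      by (intro continuous_intros)
    ultimately show ?thesis
      using continuous_ge_on_closure[of "{0<..<pi}" "\<lambda>t. Im (cis (real n * t) * c)" t 0] pos1 t by auto
  qed
  have pos3: "Im (cis t * c) \<ge> 0" if "0 \<le> t" "t \<le> real n * pi" for t
    using pos2[of "t / real n"] that g(1) by (simp add: field_simps)
  have n1: "n = 1"
  proof (rule ccontr)
    assume "n \<noteq> 1"
    then have "n \<ge> 2" using g(1) by simp
    then have n2: "2 * pi \<le> real n * pi" by simp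
    have "Im c \<ge> 0" using pos3[of 0] by simp
    moreover have "Im c \<le> 0" using pos3[of pi] n2 pi_gt_zero by (simp add: cis_pi del: pi_gt_zero)
    moreover have "Re c \<ge> 0" using pos3[of "pi/2"] n2 pi_gt_zero by (simp add: cis_pi_half del: pi_gt_zero)
    moreover have "Re c \<le> 0"
    proof -
      have "cis (3 * pi / 2) = cis (pi + pi / 2)" by (rule arg_cong[of _ _ cis]) simp
      also have "\<dots> = - \<i>" by (simp only: cis_mult[symmetric] cis_pi cis_pi_half) simp
      finally show ?thesis using pos3[of "3 * pi / 2"] n2 pi_gt_zero by (simp del: pi_gt_zero)
    qed
    ultimately show False using c0 by (simp add: complex_eq_iff)
  qed
  have "Im c \<ge> 0" using pos3[of 0] by simp
  moreover have "Im c \<le> 0" using pos3[of pi] n1 by (simp add: cis_pi)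
  ultimately have Imc: "Im c = 0" by simp
  have "Re c \<ge> 0" using pos3[of "pi/2"] n1 by (simp add: cis_pi_half)
  then have Rec: "Re c > 0" using Imc c0 by (simp add: complex_eq_iff less_le)
  have "(g \<longlongrightarrow> c) (at z)" using contg by (simp add: c_def isCont_def)
  moreover have "\<forall>\<^sub>F w in at z. g w = f w / (w - z)"
    unfolding eventually_at using g(2,5) n1
    by (intro exI[of _ r]) (auto simp: dist_commute)
  ultimately have "((\<lambda>w. f w / (w - z)) \<longlongrightarrow> c) (at z)" by (rule Lim_transform_eventually)
  moreover have "c = of_real (Re c)" using Imc by (simp add: complex_eq_iff)
  ultimately show ?thesis using that Rec by metis
qed

lemma Im_divide_cnj: "Im (a / b) = Im (a * cnj b) / (norm b)\<^sup>2"
  by (simp add: Im_divide cmod_power2)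

context potential
begin

text \<open>Localizes the half plane coefficients at an arbitrary point. The half plane around
  \<open>z\<close> is symmetric under conjugation, so it contains the mirror images of its
  points.\<close>

lemma weyl_quotient:
  obtains \<alpha> \<beta> S where "open S" "z \<in> S" "\<alpha> holomorphic_on S" "\<beta> holomorphic_on S"
    and "\<And>w. w \<in> S \<Longrightarrow> m w = \<beta> w / \<alpha> w" "\<And>w. w \<in> S \<Longrightarrow> \<alpha> w \<noteq> 0 \<or> \<beta> w \<noteq> 0"
    and "\<And>w. w \<in> S \<Longrightarrow> \<alpha> (cnj w) = cnj (\<alpha> w) \<and> \<beta> (cnj w) = cnj (\<beta> w)" "\<And>w. w \<in> S \<Longrightarrow> cnj w \<in> S"
    and "\<And>w. w \<in> S \<Longrightarrow> Im w > 0 \<Longrightarrow> Im (\<beta> w * cnj (\<alpha> w)) > 0"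
proof -
  define S where "S = {w. Re w < Re z + 1}"
  have S: "open S" "z \<in> S" "\<And>w. w \<in> S \<Longrightarrow> cnj w \<in> S"
    unfolding S_def by (auto intro: open_halfspace_Re_lt)
  obtain \<alpha> \<beta> where "\<alpha> holomorphic_on S" "\<beta> holomorphic_on S"
    "\<And>w. w \<in> S \<Longrightarrow> m w = \<beta> w / \<alpha> w" "\<And>w. w \<in> S \<Longrightarrow> \<alpha> w \<noteq> 0 \<or> \<beta> w \<noteq> 0"
    "\<And>w. w \<in> S \<Longrightarrow> \<alpha> (cnj w) = cnj (\<alpha> w) \<and> \<beta> (cnj w) = cnj (\<beta> w)"
    "\<And>w. w \<in> S \<Longrightarrow> Im w > 0 \<Longrightarrow> Im (\<beta> w * cnj (\<alpha> w)) > 0"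
    unfolding S_def by (rule weyl_coefficients[of "Re z + 1"]) auto
  with S show ?thesis using that by blast
qed

lemma m_cnj: "m (cnj z) = cnj (m z)"
proof -
  obtain \<alpha> \<beta> S where "z \<in> S" "\<And>w. w \<in> S \<Longrightarrow> m w = \<beta> w / \<alpha> w"
    "\<And>w. w \<in> S \<Longrightarrow> \<alpha> (cnj w) = cnj (\<alpha> w) \<and> \<beta> (cnj w) = cnj (\<beta> w)" "\<And>w. w \<in> S \<Longrightarrow> cnj w \<in> S"
    by (rule weyl_quotient[of z]) blast
  then show ?thesis by simp
qed

lemma m_Im_pos: "Im z > 0 \<Longrightarrow> Im (m z) > 0"
proof -
  assume z: "Im z > 0"
  obtain \<alpha> \<beta> S where "z \<in> S" "\<And>w. w \<in> S \<Longrightarrow> m w = \<beta> w / \<alpha> w"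
    "\<And>w. w \<in> S \<Longrightarrow> Im w > 0 \<Longrightarrow> Im (\<beta> w * cnj (\<alpha> w)) > 0"
    by (rule weyl_quotient[of z]) blast
  then have *: "m z = \<beta> z / \<alpha> z" "Im (\<beta> z * cnj (\<alpha> z)) > 0" using z by auto
  then have "\<alpha> z \<noteq> 0" by auto
  then show ?thesis using * by (simp only: Im_divide_cnj zero_less_divide_iff) simp
qed

lemma m_Im_neg: "Im z < 0 \<Longrightarrow> Im (m z) < 0"
  using m_Im_pos[of "cnj z"] by (simp add: m_cnj)

lemma m_real: "Im z = 0 \<Longrightarrow> Im (m z) = 0"
proof -
  assume "Im z = 0"
  then have "cnj z = z" by (simp add: complex_eq_iff)
  then have "cnj (m z) = m z" using m_cnj[of z] by simp
  then show ?thesis by (simp add: complex_eq_iff)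
qed

lemma m_zero_real: "m z = 0 \<Longrightarrow> Im z = 0"
  using m_Im_pos[of z] m_Im_neg[of z] by (cases "Im z" "0::real" rule: linorder_cases) auto

text \<open>As \<open>m\<close> was given the value \<open>0\<close> at its poles, a nonzero value
  excludes zeros and poles alike: both \<open>\<alpha>\<close> and \<open>\<beta>\<close> are
  nonzero near \<open>z\<close>.\<close>

lemma m_holomorphic_near:
  assumes "m z \<noteq> 0"
  obtains e where "e > 0" "m holomorphic_on ball z e" "\<And>w. w \<in> ball z e \<Longrightarrow> m w \<noteq> 0"
proof -
  obtain \<alpha> \<beta> S where *: "open S" "z \<in> S" "\<alpha> holomorphic_on S" "\<beta> holomorphic_on S"
    "\<And>w. w \<in> S \<Longrightarrow> m w = \<beta> w / \<alpha> w"
    by (rule weyl_quotient[of z]) blast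
  have "open (S \<inter> (\<lambda>w. \<alpha> w * \<beta> w) -` (- {0}))"
    by (rule continuous_open_preimage)
      (auto intro!: holomorphic_on_mult holomorphic_on_imp_continuous_on *(1,3,4))
  moreover have "z \<in> S \<inter> (\<lambda>w. \<alpha> w * \<beta> w) -` (- {0})" using assms *(2) *(5)[of z] by auto
  ultimately obtain e where e: "e > 0" "ball z e \<subseteq> S \<inter> (\<lambda>w. \<alpha> w * \<beta> w) -` (- {0})"
    using openE by blast
  have "(\<lambda>w. \<beta> w / \<alpha> w) holomorphic_on ball z e"
    by (intro holomorphic_on_divide holomorphic_on_subset[OF *(3)] holomorphic_on_subset[OF *(4)]) (use e in auto)
  moreover have "\<beta> w / \<alpha> w = m w" "m w \<noteq> 0" if "w \<in> ball z e" for w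
  proof -
    have "w \<in> S" "\<alpha> w * \<beta> w \<noteq> 0" using subsetD[OF e(2) that] by auto
    then show "\<beta> w / \<alpha> w = m w" "m w \<noteq> 0" using *(5)[of w] by auto
  qed
  ultimately show ?thesis using that[OF e(1)] by (metis (no_types, lifting) holomorphic_cong)
qed

lemma m_continuous: "m z \<noteq> 0 \<Longrightarrow> isCont m z"
  using m_holomorphic_near[of z]
  by (metis centre_in_ball continuous_on_eq_continuous_at holomorphic_on_imp_continuous_on open_ball)

abbreviation zero_slope :: "real \<Rightarrow> complex \<Rightarrow> bool" where
  "zero_slope h z \<equiv> ((\<lambda>w. m w / (w - z)) \<longlongrightarrow> complex_of_real h) (at z)"

abbreviation pole_slope :: "real \<Rightarrow> complex \<Rightarrow> bool" where
  "pole_slope h z \<equiv> ((\<lambda>w. m w * (w - z)) \<longlongrightarrow> complex_of_real h) (at z)"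

text \<open>At a zero the preceding lemma on simple zeros applies to
  \<open>\<beta> / \<alpha>\<close>. At a pole it applies to \<open>- \<alpha> / \<beta>\<close>,
  that is \<open>- 1 / m\<close>, which also maps the upper half plane into itself; a slope
  \<open>h > 0\<close> of this function is a residue \<open>- 1 / h\<close> of
  \<open>m\<close>.\<close>

lemma m_zero_cases:
  assumes "m z = 0"
  shows "(\<exists>h>0. zero_slope h z) \<or> (\<exists>h<0. pole_slope h z)"
proof -
  have z: "Im z = 0" using assms by (rule m_zero_real)
  obtain \<alpha> \<beta> S where *: "open S" "z \<in> S" "\<alpha> holomorphic_on S" "\<beta> holomorphic_on S"
    "\<And>w. w \<in> S \<Longrightarrow> m w = \<beta> w / \<alpha> w" "\<And>w. w \<in> S \<Longrightarrow> \<alpha> w \<noteq> 0 \<or> \<beta> w \<noteq> 0"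
    "\<And>w. w \<in> S \<Longrightarrow> Im w > 0 \<Longrightarrow> Im (\<beta> w * cnj (\<alpha> w)) > 0"
    by (rule weyl_quotient[of z]) blast
  have ev: "\<forall>\<^sub>F w in at z. w \<in> S" using * by (simp add: eventually_at_in_open')
  have op: "open {w \<in> S. f w \<noteq> 0}" if "f holomorphic_on S" for f
  proof -
    have "open (S \<inter> f -` (- {0}))"
      by (rule continuous_open_preimage) (use that *(1) in \<open>auto intro: holomorphic_on_imp_continuous_on\<close>)
    moreover have "S \<inter> f -` (- {0}) = {w \<in> S. f w \<noteq> 0}" by auto
    ultimately show ?thesis by simp
  qed
  consider "\<beta> z = 0" "\<alpha> z \<noteq> 0" | "\<alpha> z = 0" "\<beta> z \<noteq> 0" using assms *(2,5,6) by fastforce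
  then show ?thesis
  proof cases
    case 1
    obtain h where h: "h > 0" "((\<lambda>w. (\<beta> w / \<alpha> w) / (w - z)) \<longlongrightarrow> of_real h) (at z)"
    proof (rule herglotz_zero_simple[OF op[OF *(3)], of z "\<lambda>w. \<beta> w / \<alpha> w"])
      show "(\<lambda>w. \<beta> w / \<alpha> w) holomorphic_on {w \<in> S. \<alpha> w \<noteq> 0}"
        by (intro holomorphic_on_divide holomorphic_on_subset[OF *(3)] holomorphic_on_subset[OF *(4)]) auto
      show "Im (\<beta> w / \<alpha> w) > 0" if "w \<in> {w \<in> S. \<alpha> w \<noteq> 0}" "Im w > 0" for w
        using that m_Im_pos[of w] *(5)[of w] by simp
    qed (use 1 * z in auto)
    have "\<forall>\<^sub>F w in at z. (\<beta> w / \<alpha> w) / (w - z) = m w / (w - z)"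
      using ev by eventually_elim (simp add: *(5))
    with h(2) have "zero_slope h z"
      by (rule Lim_transform_eventually)
    then show ?thesis using h(1) by blast
  next
    case 2
    obtain h where h: "h > 0" "((\<lambda>w. (- \<alpha> w / \<beta> w) / (w - z)) \<longlongrightarrow> of_real h) (at z)"
    proof (rule herglotz_zero_simple[OF op[OF *(4)], of z "\<lambda>w. - \<alpha> w / \<beta> w"])
      show "(\<lambda>w. - \<alpha> w / \<beta> w) holomorphic_on {w \<in> S. \<beta> w \<noteq> 0}"
        by (intro holomorphic_on_divide holomorphic_on_minus holomorphic_on_subset[OF *(3)] holomorphic_on_subset[OF *(4)]) auto
      show "Im (- \<alpha> w / \<beta> w) > 0" if w: "w \<in> {w \<in> S. \<beta> w \<noteq> 0}" "Im w > 0" for w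
      proof -
        have "Im (\<beta> w * cnj (\<alpha> w)) > 0" using *(7) w by auto
        then have "Im (- \<alpha> w * cnj (\<beta> w)) > 0" by (simp add: algebra_simps)
        then show ?thesis using w by (simp only: Im_divide_cnj zero_less_divide_iff) simp
      qed
    qed (use 2 * z in auto)
    have "((\<lambda>w. - inverse ((- \<alpha> w / \<beta> w) / (w - z))) \<longlongrightarrow> - inverse (complex_of_real h)) (at z)"
      by (intro tendsto_intros h) (use h in auto)
    moreover have "\<forall>\<^sub>F w in at z. - inverse ((- \<alpha> w / \<beta> w) / (w - z)) = m w * (w - z)"
      using ev by eventually_elim (simp add: *(5) field_simps)
    ultimately have "((\<lambda>w. m w * (w - z)) \<longlongrightarrow> - inverse (complex_of_real h)) (at z)"
      by (rule Lim_transform_eventually)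
    then have "((\<lambda>w. m w * (w - z)) \<longlongrightarrow> complex_of_real (- inverse h)) (at z)" by simp
    moreover have "- inverse h < 0" using h by simp
    ultimately show ?thesis by blast
  qed
qed

lemma m_zero_isolated:
  assumes "m z = 0"
  shows "\<forall>\<^sub>F w in at z. m w \<noteq> 0"
  using m_zero_cases[OF assms]
proof (elim disjE exE conjE)
  fix h :: real assume "h > 0" "zero_slope h z"
  then have "\<forall>\<^sub>F w in at z. m w / (w - z) \<noteq> 0" by (intro tendsto_imp_eventually_ne) auto
  then show ?thesis by eventually_elim auto
next
  fix h :: real assume "h < 0" "pole_slope h z"
  then have "\<forall>\<^sub>F w in at z. m w * (w - z) \<noteq> 0" by (intro tendsto_imp_eventually_ne) auto
  then show ?thesis by eventually_elim auto
qed

text \<open>On the real line the function below is continuous, has exactly the eigenvalues as zeros, and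
  changes sign at each of them, upwards at zeros and downwards at poles of the Weyl function.\<close>

definition D :: "real \<Rightarrow> real" where
  "D x = Re (m (of_real x)) / (1 + (Re (m (of_real x)))\<^sup>2)"

lemma D_eq_0_iff: "D x = 0 \<longleftrightarrow> m (of_real x) = 0"
proof -
  have "1 + (Re (m (of_real x)))\<^sup>2 \<noteq> 0" by (smt (verit) zero_le_power2)
  then show ?thesis using m_real[of "of_real x"] by (simp add: D_def complex_eq_iff)
qed

lemma D_continuous: "m (of_real x) \<noteq> 0 \<Longrightarrow> isCont D x"
proof -
  assume "m (of_real x) \<noteq> 0"
  then have c: "isCont (\<lambda>x. m (of_real x)) x"
    by (intro isCont_o2[OF _ m_continuous] continuous_intros)
  then have "isCont (\<lambda>x. Re (m (of_real x))) x" unfolding isCont_def by (rule tendsto_Re)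
  moreover have "1 + (Re (m (of_real x)))\<^sup>2 \<noteq> 0" for x by (smt (verit) zero_le_power2)
  ultimately show ?thesis unfolding D_def by (intro continuous_intros) auto
qed

lemma D_derivative_zero:
  assumes h: "h > 0" "zero_slope h (of_real x)"
  shows "((\<lambda>y. D y / (y - x)) \<longlongrightarrow> h) (at x)"
proof -
  have flt: "filterlim complex_of_real (at (of_real x)) (at x)"
    by (auto simp: filterlim_at eventually_at_filter intro!: tendsto_intros)
  define r where "r y = Re (m (of_real y))" for y
  have "((\<lambda>y. Re (m (of_real y) / (of_real y - of_real x))) \<longlongrightarrow> Re (of_real h)) (at x)"
    by (intro tendsto_Re filterlim_compose[OF h(2) flt])
  moreover have "Re (m (of_real y) / (of_real y - of_real x)) = r y / (y - x)" for y
    by (simp add: r_def flip: of_real_diff)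
  ultimately have l: "((\<lambda>y. r y / (y - x)) \<longlongrightarrow> h) (at x)" by (simp only: Re_complex_of_real)
  have "((\<lambda>y. r y / (y - x) * (y - x)) \<longlongrightarrow> h * 0) (at x)"
    by (rule tendsto_mult[OF l]) (auto intro!: tendsto_eq_intros)
  moreover have "\<forall>\<^sub>F y in at x. r y / (y - x) * (y - x) = r y" by (auto simp: eventually_at_filter)
  ultimately have "(r \<longlongrightarrow> h * 0) (at x)" by (rule Lim_transform_eventually)
  then have r0: "(r \<longlongrightarrow> 0) (at x)" by simp
  have "((\<lambda>y. (r y / (y - x)) / (1 + (r y)\<^sup>2)) \<longlongrightarrow> h / (1 + 0\<^sup>2)) (at x)"
    by (intro tendsto_intros l r0) auto
  then show ?thesis by (simp add: D_def r_def field_simps)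
qed

text \<open>Expanding the fraction by \<open>(y - x)^2\<close> leaves only
  \<open>r y * (y - x)\<close>, which tends to the residue \<open>h\<close>, so the limit is
  \<open>h / h^2\<close>. As \<open>D x = 0\<close> this is the derivative of \<open>D\<close>, and
  a negative residue makes \<open>D\<close> cross downwards.\<close>

lemma D_derivative_pole:
  assumes h: "h < 0" "pole_slope h (of_real x)"
  shows "((\<lambda>y. D y / (y - x)) \<longlongrightarrow> 1 / h) (at x)"
proof -
  have flt: "filterlim complex_of_real (at (of_real x)) (at x)"
    by (auto simp: filterlim_at eventually_at_filter intro!: tendsto_intros)
  define r where "r y = Re (m (of_real y))" for y
  have "((\<lambda>y. Re (m (of_real y) * (of_real y - of_real x))) \<longlongrightarrow> Re (of_real h)) (at x)"
    by (intro tendsto_Re filterlim_compose[OF h(2) flt])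
  moreover have "Re (m (of_real y) * (of_real y - of_real x)) = r y * (y - x)" for y
    by (simp add: r_def flip: of_real_diff)
  ultimately have l: "((\<lambda>y. r y * (y - x)) \<longlongrightarrow> h) (at x)" by (simp only: Re_complex_of_real)
  have "((\<lambda>y. (r y * (y - x)) / ((y - x)\<^sup>2 + (r y * (y - x))\<^sup>2)) \<longlongrightarrow> h / ((x - x)\<^sup>2 + h\<^sup>2)) (at x)"
    by (intro tendsto_intros l) (use h in auto)
  moreover have "\<forall>\<^sub>F y in at x. (r y * (y - x)) / ((y - x)\<^sup>2 + (r y * (y - x))\<^sup>2) = D y / (y - x)"
  proof -
    have "(r y * (y - x)) / ((y - x)\<^sup>2 + (r y * (y - x))\<^sup>2) = D y / (y - x)" if "y \<noteq> x" for y
    proof -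
      have "(y - x)\<^sup>2 + (r y * (y - x))\<^sup>2 = (1 + (r y)\<^sup>2) * (y - x) * (y - x)"
        by (simp add: algebra_simps power2_eq_square)
      then show ?thesis using that by (simp add: D_def r_def)
    qed
    then show ?thesis by (auto simp: eventually_at_filter)
  qed
  ultimately have "((\<lambda>y. D y / (y - x)) \<longlongrightarrow> h / ((x - x)\<^sup>2 + h\<^sup>2)) (at x)"
    by (rule Lim_transform_eventually)
  then show ?thesis using h by (simp add: power2_eq_square)
qed

end

section \<open>Asymptotics on the negative real axis\<close>

text \<open>The product \<open>g = v * v'\<close> is half the derivative of \<open>v^2\<close> and
  increases; boundedness of \<open>v\<close> forces \<open>g <= 0\<close>. Hence
  \<open>v'^2 - k^2 v^2\<close> is nonincreasing, and were it negative somewhere, \<open>g\<close>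
  would from there on grow at a fixed positive rate. So \<open>|v'| >= k |v|\<close> with
  \<open>v'\<close> pointing towards zero, which gives the decay. The upper bound for
  \<open>v' 0\<close> compares with \<open>K\<close> instead of \<open>k\<close> on the unit
  interval.\<close>

lemma decaying_real_solution:
  fixes v v' q :: "real \<Rightarrow> real"
  assumes v: "\<And>x. (v has_real_derivative v' x) (at x)"
    and v': "\<And>x. (v' has_real_derivative q x * v x) (at x)"
    and B: "\<And>x. x \<ge> 0 \<Longrightarrow> \<bar>v x\<bar> \<le> B"
    and q: "\<And>x. x \<ge> 0 \<Longrightarrow> q x \<ge> k\<^sup>2" and k: "k > 0"
    and nz: "v 0 \<noteq> 0 \<or> v' 0 \<noteq> 0"
    and K: "\<And>x. x \<in> {0..1} \<Longrightarrow> q x \<le> K\<^sup>2"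
  shows "v 0 * v' 0 < 0" "(v' 0)\<^sup>2 \<ge> k\<^sup>2 * (v 0)\<^sup>2" "(v' 0)\<^sup>2 \<le> (K\<^sup>2 + 4) * (v 0)\<^sup>2"
    and "\<And>x. x \<ge> 0 \<Longrightarrow> \<bar>v x\<bar> \<le> \<bar>v 0\<bar> * exp (- k * x)"
proof -
  define g where "g x = v x * v' x" for x
  have dg: "(g has_real_derivative (v' x)\<^sup>2 + q x * (v x)\<^sup>2) (at x)" for x
    unfolding g_def by (rule DERIV_cong[OF DERIV_mult[OF v v']]) (simp add: power2_eq_square)
  have dg_ge: "(v' x)\<^sup>2 + q x * (v x)\<^sup>2 \<ge> k\<^sup>2 * (v x)\<^sup>2" if "x \<ge> 0" for x
    using mult_right_mono[OF q[OF that], of "(v x)\<^sup>2"] by (simp add: add_increasing)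
  have g_mono: "g x \<le> g y" if "0 \<le> x" "x \<le> y" for x y
  proof (rule DERIV_nonneg_imp_nondecreasing[OF that(2)])
    fix t assume "x \<le> t" "t \<le> y"
    then have "0 \<le> (v' t)\<^sup>2 + q t * (v t)\<^sup>2"
      using dg_ge[of t] that order_trans[of 0 "k\<^sup>2 * (v t)\<^sup>2"] by simp
    then show "\<exists>y. (g has_real_derivative y) (at t) \<and> 0 \<le> y" using dg by blast
  qed
  have dv2: "((\<lambda>x. (v x)\<^sup>2) has_real_derivative 2 * g x) (at x)" for x
    by (rule DERIV_cong[OF DERIV_power[OF v]]) (simp add: g_def)
  have g_nonpos: "g x \<le> 0" if "x \<ge> 0" for x
  proof (rule ccontr)
    assume "\<not> g x \<le> 0"
    then have gx: "g x > 0" by simp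
    \<comment> \<open>On \<open>{x..y}\<close> the derivative of \<open>v^2\<close> is at least
      \<open>2 * g x\<close>, so \<open>v^2\<close> gains \<open>B^2 + 1\<close> and exceeds its
      bound at \<open>y\<close>.\<close>
    define y where "y = x + (B\<^sup>2 + 1) / (2 * g x)"
    have y: "y \<ge> x" using gx by (simp add: y_def)
    have "(v x)\<^sup>2 - 2 * g x * x \<le> (v y)\<^sup>2 - 2 * g x * y"
    proof (rule DERIV_nonneg_imp_nondecreasing[OF y])
      fix t assume t: "x \<le> t" "t \<le> y"
      have "((\<lambda>x'. (v x')\<^sup>2 - 2 * g x * x') has_real_derivative 2 * g t - 2 * g x) (at t)"
        by (rule DERIV_cong[OF DERIV_diff[OF dv2 DERIV_cmult_Id]]) simp
      then show "\<exists>d. ((\<lambda>x'. (v x')\<^sup>2 - 2 * g x * x') has_real_derivative d) (at t) \<and> 0 \<le> d"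
        using g_mono[OF that t(1)] by (intro exI[of _ "2 * g t - 2 * g x"]) auto
    qed
    then have "(v x)\<^sup>2 + 2 * g x * (y - x) \<le> (v y)\<^sup>2" by (simp add: algebra_simps)
    moreover have "2 * g x * (y - x) = B\<^sup>2 + 1" using gx by (simp add: y_def)
    moreover have "(v y)\<^sup>2 \<le> B\<^sup>2" using B[of y] y that by (simp add: abs_le_square_iff[symmetric])
    ultimately show False using zero_le_power2[of "v x"] by linarith
  qed
  show neg: "v 0 * v' 0 < 0"
  proof (rule ccontr)
    assume "\<not> v 0 * v' 0 < 0"
    then have "g 0 \<ge> 0" by (simp add: g_def)
    then have g0: "g x = 0" if "x \<ge> 0" for x
      using g_mono[OF order_refl that] g_nonpos[OF that] by linarith
    have vz: "v x = 0 \<and> v' x = 0" if "x > 0" for x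
    proof -
      have "\<forall>\<^sub>F y in nhds x. y \<in> {0<..}" using that by (intro eventually_nhds_in_open) auto
      then have "\<forall>\<^sub>F y in nhds x. g y = 0" by eventually_elim (simp add: g0)
      from DERIV_cong_ev[OF refl this refl, THEN iffD1, OF dg]
      have "(v' x)\<^sup>2 + q x * (v x)\<^sup>2 = 0" by (metis DERIV_const DERIV_unique)
      moreover have "k\<^sup>2 * (v x)\<^sup>2 \<ge> 0" by simp
      moreover have "k\<^sup>2 * (v x)\<^sup>2 \<le> q x * (v x)\<^sup>2" using q[of x] that by (intro mult_right_mono) auto
      ultimately have "(v' x)\<^sup>2 = 0 \<and> k\<^sup>2 * (v x)\<^sup>2 = 0" using zero_le_power2[of "v' x"] by linarith
      then show ?thesis using k by simp
    qed
    have "w 0 = 0" if w: "\<And>x. (w has_real_derivative w' x) (at x)" "\<And>x. x > 0 \<Longrightarrow> w x = 0"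
      for w w' :: "real \<Rightarrow> real"
    proof (rule tendsto_unique)
      show "(w \<longlongrightarrow> w 0) (at_right 0)"
        using DERIV_isCont[OF w(1)[of 0]] by (simp add: isCont_def filterlim_at_split)
      have "\<forall>\<^sub>F x in at_right 0. w x = 0" using w(2) by (simp add: eventually_at_filter)
      then show "(w \<longlongrightarrow> 0) (at_right 0)" by (rule tendsto_eventually)
    qed simp
    from this[OF v] this[OF v'] show False using vz nz by blast
  qed
  have G: "k\<^sup>2 * (v x)\<^sup>2 \<le> (v' x)\<^sup>2" if x: "x \<ge> 0" for x
  proof (rule ccontr)
    assume "\<not> k\<^sup>2 * (v x)\<^sup>2 \<le> (v' x)\<^sup>2"
    define d where "d = k\<^sup>2 * (v x)\<^sup>2 - (v' x)\<^sup>2"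
    have d: "d > 0" using \<open>\<not> _\<close> by (simp add: d_def)
    have v2: "k\<^sup>2 * (v y)\<^sup>2 \<ge> d" if y: "y \<ge> x" for y
    proof -
      have "(v' y)\<^sup>2 - k\<^sup>2 * (v y)\<^sup>2 \<le> (v' x)\<^sup>2 - k\<^sup>2 * (v x)\<^sup>2"
      proof (rule DERIV_nonpos_imp_nonincreasing[OF y])
        fix t assume t: "x \<le> t" "t \<le> y"
        have "((\<lambda>x. (v' x)\<^sup>2 - k\<^sup>2 * (v x)\<^sup>2) has_real_derivative 2 * g t * (q t - k\<^sup>2)) (at t)"
          by (rule DERIV_cong[OF DERIV_diff[OF DERIV_power[OF v'] DERIV_cmult[OF dv2]]])
            (simp add: g_def algebra_simps)
        moreover have "2 * g t * (q t - k\<^sup>2) \<le> 0"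
          using g_nonpos[of t] q[of t] t x mult_nonpos_nonneg[of "2 * g t" "q t - k\<^sup>2"] by simp
        ultimately show "\<exists>y. ((\<lambda>x. (v' x)\<^sup>2 - k\<^sup>2 * (v x)\<^sup>2) has_real_derivative y) (at t) \<and> y \<le> 0" by blast
      qed
      then show ?thesis unfolding d_def using zero_le_power2[of "v' y"] by linarith
    qed
    \<comment> \<open>Beyond \<open>x\<close> the derivative of \<open>g\<close> is at least
      \<open>d\<close>; at this point \<open>g\<close> would have climbed to at least
      \<open>1\<close>.\<close>
    define y where "y = x + (1 - g x) / d"
    have y: "y \<ge> x" using d g_nonpos[OF x] by (simp add: y_def)
    have "g x - d * x \<le> g y - d * y"
    proof (rule DERIV_nonneg_imp_nondecreasing[OF y])
      fix t assume t: "x \<le> t" "t \<le> y"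
      have "((\<lambda>x. g x - d * x) has_real_derivative ((v' t)\<^sup>2 + q t * (v t)\<^sup>2) - d) (at t)"
        by (auto intro!: derivative_eq_intros dg)
      moreover have "((v' t)\<^sup>2 + q t * (v t)\<^sup>2) - d \<ge> 0"
        using dg_ge[of t] v2[OF t(1)] t x by simp
      ultimately show "\<exists>y. ((\<lambda>x. g x - d * x) has_real_derivative y) (at t) \<and> 0 \<le> y" by blast
    qed
    moreover have "d * (y - x) = 1 - g x" using d by (simp add: y_def)
    ultimately have "g y \<ge> 1" by (simp add: algebra_simps)
    then show False using g_nonpos[of y] y x by simp
  qed
  then show "(v' 0)\<^sup>2 \<ge> k\<^sup>2 * (v 0)\<^sup>2" by simp
  show decay: "\<bar>v x\<bar> \<le> \<bar>v 0\<bar> * exp (- k * x)" if x: "x \<ge> 0" for x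
  proof -
    have "(v x)\<^sup>2 * exp (2 * k * x) \<le> (v 0)\<^sup>2 * exp (2 * k * 0)"
    proof (rule DERIV_nonpos_imp_nonincreasing[OF x])
      fix t assume t: "0 \<le> t" "t \<le> x"
      have "((\<lambda>x. (v x)\<^sup>2 * exp (2 * k * x)) has_real_derivative (2 * g t + 2 * k * (v t)\<^sup>2) * exp (2 * k * t)) (at t)"
        by (rule DERIV_cong[OF DERIV_mult[OF dv2, of "\<lambda>x. exp (2 * k * x)" "exp (2 * k * t) * (2 * k)"]])
          (auto intro!: derivative_eq_intros simp: algebra_simps)
      moreover have "g t + k * (v t)\<^sup>2 \<le> 0"
      proof -
        have "(k * \<bar>v t\<bar>)\<^sup>2 \<le> \<bar>v' t\<bar>\<^sup>2" using G[OF t(1)] by (simp add: power_mult_distrib)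
        then have "k * \<bar>v t\<bar> \<le> \<bar>v' t\<bar>" by (rule power2_le_imp_le) simp
        then have "\<bar>v t\<bar> * (k * \<bar>v t\<bar>) \<le> \<bar>v t\<bar> * \<bar>v' t\<bar>" by (intro mult_left_mono) auto
        also have "\<dots> = - g t" using g_nonpos[OF t(1)] by (simp add: g_def abs_mult[symmetric])
        finally show ?thesis by (simp add: power2_eq_square mult.left_commute)
      qed
      then have "(2 * g t + 2 * k * (v t)\<^sup>2) * exp (2 * k * t) \<le> 0" by (intro mult_nonpos_nonneg) auto
      ultimately show "\<exists>y. ((\<lambda>x. (v x)\<^sup>2 * exp (2 * k * x)) has_real_derivative y) (at t) \<and> y \<le> 0" by blast
    qed
    then have "(v x)\<^sup>2 * exp (2 * k * x) * exp (- (2 * k * x)) \<le> (v 0)\<^sup>2 * exp (- (2 * k * x))"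
      by (intro mult_right_mono) auto
    then have "(v x)\<^sup>2 \<le> (v 0)\<^sup>2 * exp (- (2 * k * x))"
      by (simp add: mult.assoc exp_add[symmetric])
    also have "\<dots> = (\<bar>v 0\<bar> * exp (- k * x))\<^sup>2"
      by (simp add: power_mult_distrib exp_double[symmetric] mult.assoc)
    finally have "\<bar>v x\<bar>\<^sup>2 \<le> (\<bar>v 0\<bar> * exp (- k * x))\<^sup>2" by simp
    then show ?thesis by (rule power2_le_imp_le) simp
  qed
  show "(v' 0)\<^sup>2 \<le> (K\<^sup>2 + 4) * (v 0)\<^sup>2"
  proof -
    define H where "H x = (v' x)\<^sup>2 - K\<^sup>2 * (v x)\<^sup>2" for x
    have H: "H 0 \<le> H x" if "x \<in> {0..1}" for x
    proof (rule DERIV_nonneg_imp_nondecreasing[of 0 x H])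
      fix t assume t: "0 \<le> t" "t \<le> x"
      have "(H has_real_derivative 2 * g t * (q t - K\<^sup>2)) (at t)"
        unfolding H_def
        by (rule DERIV_cong[OF DERIV_diff[OF DERIV_power[OF v'] DERIV_cmult[OF dv2]]])
          (simp add: g_def algebra_simps)
      moreover have "2 * g t * (q t - K\<^sup>2) \<ge> 0"
        using g_nonpos[of t] K[of t] t that mult_nonpos_nonpos[of "2 * g t" "q t - K\<^sup>2"] by simp
      ultimately show "\<exists>y. (H has_real_derivative y) (at t) \<and> 0 \<le> y" by blast
    qed (use that in auto)
    \<comment> \<open>At a mean value point \<open>v'\<close> is the increment
      \<open>v 1 - v 0\<close>, at most \<open>2 * |v 0|\<close> by the decay. This is the origin of
      the constant \<open>4\<close>.\<close>
    obtain \<xi> where xi: "0 < \<xi>" "\<xi> < 1" "v 1 - v 0 = (1 - 0) * v' \<xi>"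
      using MVT2[of 0 1 v v'] v by auto
    then have xi3: "v' \<xi> = v 1 - v 0" by simp
    have "\<bar>v 1\<bar> \<le> \<bar>v 0\<bar> * exp (- k * 1)" by (rule decay) simp
    also have "\<dots> \<le> \<bar>v 0\<bar> * 1" using k by (intro mult_left_mono) auto
    finally have "\<bar>v' \<xi>\<bar> \<le> 2 * \<bar>v 0\<bar>" using xi3 by linarith
    then have "\<bar>v' \<xi>\<bar>\<^sup>2 \<le> (2 * \<bar>v 0\<bar>)\<^sup>2" by (intro power_mono) auto
    then have "(v' \<xi>)\<^sup>2 \<le> 4 * (v 0)\<^sup>2" by (simp add: power_mult_distrib)
    moreover have "H 0 \<le> (v' \<xi>)\<^sup>2"
    proof -
      have "H 0 \<le> H \<xi>" using xi(1,2) by (intro H) simp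
      moreover have "K\<^sup>2 * (v \<xi>)\<^sup>2 \<ge> 0" by simp
      ultimately show ?thesis unfolding H_def[of \<xi>] by linarith
    qed
    ultimately show ?thesis by (simp add: H_def algebra_simps)
  qed
qed

context potential
begin

lemma V_bdd_below: "\<exists>c\<ge>0. \<forall>x\<ge>0. V x \<ge> - c"
proof -
  obtain X where X: "X \<ge> 0" "\<And>x. x \<ge> X \<Longrightarrow> V x \<ge> 0" using V_ge_eventually[of 0] by blast
  obtain M where M: "M \<ge> 0" "\<And>t. t \<in> {0..X} \<Longrightarrow> \<bar>V t\<bar> \<le> M" using V_bounded_on[of X] by blast
  have "V x \<ge> - M" if "x \<ge> 0" for x
    using X(2)[of x] M(1) M(2)[of x] that by (cases "x \<ge> X") auto
  then show ?thesis using M(1) by blast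
qed

text \<open>At \<open>z = - k^2\<close> conjugation symmetry makes the decaying solution real, and
  \<open>m\<close> is the ratio of its data at \<open>0\<close>. The equation has the coefficient
  \<open>V + k^2\<close>, which differs from \<open>k^2\<close> by a bounded amount in the
  directions required by the comparison lemma.\<close>

lemma m_asymptotics:
  obtains C where "C \<ge> 0"
    and "\<And>k. k\<^sup>2 \<ge> C + 1 \<Longrightarrow> \<exists>y<0. m (- of_real (k\<^sup>2)) = of_real y \<and> k\<^sup>2 - C \<le> y\<^sup>2 \<and> y\<^sup>2 \<le> k\<^sup>2 + C"
    and "\<And>k x. k\<^sup>2 \<ge> C + 1 \<Longrightarrow> x \<ge> 0 \<Longrightarrow>
      norm (psi (- of_real (k\<^sup>2)) x) \<le> exp (- sqrt (k\<^sup>2 - C) * x)"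
proof -
  obtain c where c: "c \<ge> 0" "\<And>x. x \<ge> 0 \<Longrightarrow> V x \<ge> - c" using V_bdd_below by blast
  obtain M where M: "M \<ge> 0" "\<And>t. t \<in> {0..1} \<Longrightarrow> \<bar>V t\<bar> \<le> M" using V_bounded_on[of 1] by blast
  \<comment> \<open>\<open>c\<close> bounds \<open>V\<close> from below on the half line,
    \<open>M\<close> bounds it on \<open>{0..1}\<close>, and \<open>4\<close> is the constant of the
    comparison lemma.\<close>
  define C where "C = c + M + 4"
  have C0: "C \<ge> 0" using c M by (simp add: C_def)
  obtain \<alpha> \<beta> where ab: "\<And>z. Re z < 1 \<Longrightarrow> \<alpha> z \<noteq> 0 \<or> \<beta> z \<noteq> 0"
    "\<And>z. Re z < 1 \<Longrightarrow> \<alpha> (cnj z) = cnj (\<alpha> z) \<and> \<beta> (cnj z) = cnj (\<beta> z)"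
    "\<And>z. Re z < 1 \<Longrightarrow> \<exists>C. \<forall>x\<ge>0. norm (\<alpha> z * theta z x + \<beta> z * phi z x) \<le> C * exp (- x / 2)"
    "\<And>z. Re z < 1 \<Longrightarrow> m z = \<beta> z / \<alpha> z"
    by (rule weyl_coefficients[of 1]) blast
  have main: "(\<exists>y<0. m (- of_real (k\<^sup>2)) = of_real y \<and> k\<^sup>2 - C \<le> y\<^sup>2 \<and> y\<^sup>2 \<le> k\<^sup>2 + C) \<and>
    (\<forall>x\<ge>0. norm (psi (- of_real (k\<^sup>2)) x) \<le> exp (- sqrt (k\<^sup>2 - C) * x))"
    if k: "k\<^sup>2 \<ge> C + 1" for k
  proof -
    define z where "z = - complex_of_real (k\<^sup>2)"
    have z: "Re z < 1" "cnj z = z" using k C0 by (auto simp: z_def)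
    obtain B where B: "\<And>x. x \<ge> 0 \<Longrightarrow> norm (\<alpha> z * theta z x + \<beta> z * phi z x) \<le> B * exp (- x / 2)"
      using ab(3)[OF z(1)] by blast
    have B0: "B \<ge> 0" using order_trans[OF norm_ge_zero B[of 0]] by simp
    define a b where "a = Re (\<alpha> z)" and "b = Re (\<beta> z)"
    have ab_eq: "\<alpha> z = of_real a" "\<beta> z = of_real b"
      using ab(2)[OF z(1)] z(2) by (auto simp: a_def b_def complex_eq_iff)
    define v v' where "v x = a * Re (theta z x) + b * Re (phi z x)"
      and "v' x = a * Re (theta' z x) + b * Re (phi' z x)" for x
    have dRe: "((\<lambda>x. Re (f x)) has_real_derivative Re f') (at x)" if "(f has_vector_derivative f') (at x)" for f f' x
      unfolding has_real_derivative_iff_has_vector_derivative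
      by (rule bounded_linear.has_vector_derivative[OF bounded_linear_Re that])
    have dv: "(v has_real_derivative v' x) (at x)" for x
      unfolding v_def v'_def
      by (intro DERIV_add DERIV_cmult dRe ode_solD(1)[OF theta] ode_solD(1)[OF phi])
    have dv': "(v' has_real_derivative (V x + k\<^sup>2) * v x) (at x)" for x
      unfolding v'_def
      by (rule DERIV_cong[OF DERIV_add[OF DERIV_cmult[OF dRe[OF ode_solD(2)[OF theta]]]
              DERIV_cmult[OF dRe[OF ode_solD(2)[OF phi]]]]])
        (simp add: Q_def z_def v_def algebra_simps flip: of_real_power)
    have Im0: "Im (theta z x) = 0" "Im (phi z x) = 0" for x
      using theta_cnj(1)[of z x] phi_cnj(1)[of z x] z(2) by (simp_all add: complex_eq_iff)
    have u_eq: "\<alpha> z * theta z x + \<beta> z * phi z x = of_real (v x)" for x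
      unfolding ab_eq v_def by (simp add: complex_eq_iff Im0)
    have vB: "\<bar>v x\<bar> \<le> B" if "x \<ge> 0" for x
    proof -
      have "\<bar>v x\<bar> \<le> B * exp (- x / 2)" using B[OF that] unfolding u_eq by simp
      also have "\<dots> \<le> B * 1" using that B0 by (intro mult_left_mono) auto
      finally show ?thesis by simp
    qed
    have v0: "v 0 = a" "v' 0 = b" by (simp_all add: v_def v'_def)
    have nz: "v 0 \<noteq> 0 \<or> v' 0 \<noteq> 0" using ab(1)[OF z(1)] by (simp add: v0 ab_eq)
    have s: "(sqrt (k\<^sup>2 - C))\<^sup>2 = k\<^sup>2 - C" "sqrt (k\<^sup>2 - C) > 0" "(sqrt (k\<^sup>2 + M))\<^sup>2 = k\<^sup>2 + M"
      using k M by auto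
    have q1: "V x + k\<^sup>2 \<ge> (sqrt (k\<^sup>2 - C))\<^sup>2" if "x \<ge> 0" for x
      unfolding s using c(2)[OF that] M(1) by (simp add: C_def)
    have q2: "V x + k\<^sup>2 \<le> (sqrt (k\<^sup>2 + M))\<^sup>2" if "x \<in> {0..1}" for x
      unfolding s using M(2)[OF that] by simp
    note * = decaying_real_solution[OF dv dv' vB q1 s(2) nz q2, unfolded v0 s]
    have a0: "a \<noteq> 0" using *(1) by auto
    have m: "m z = of_real (b / a)" using ab(4)[OF z(1)] by (simp add: ab_eq)
    have "b / a < 0" using *(1) by (simp add: divide_less_0_iff mult_less_0_iff) auto
    moreover have "k\<^sup>2 - C \<le> (b / a)\<^sup>2" using *(2) a0 by (simp add: power_divide le_divide_eq)
    moreover have "(b / a)\<^sup>2 \<le> k\<^sup>2 + C"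
    proof -
      have "(b / a)\<^sup>2 \<le> k\<^sup>2 + M + 4" using *(3) a0 by (simp add: power_divide divide_le_eq)
      then show ?thesis using c(1) by (simp add: C_def)
    qed
    moreover have "norm (theta z x + m z * phi z x) \<le> exp (- sqrt (k\<^sup>2 - C) * x)" if "x \<ge> 0" for x
    proof -
      have "theta z x + m z * phi z x = of_real (v x / a)"
        using u_eq[of x] a0 unfolding m ab_eq by (simp add: field_simps)
      then have "norm (theta z x + m z * phi z x) = \<bar>v x\<bar> / \<bar>a\<bar>"
        by (simp only: norm_of_real abs_divide)
      also have "\<dots> \<le> exp (- sqrt (k\<^sup>2 - C) * x)"
        using *(4)[OF _ _ _ that] a0 by (simp add: divide_le_eq mult.commute)
      finally show ?thesis .
    qed
    ultimately show ?thesis using m unfolding z_def by blast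
  qed
  show ?thesis by (rule that[OF C0]) (use main in blast)+
qed

end

section \<open>A Phragmen-Lindelof principle\<close>

text \<open>Damping by \<open>exp (- e * p w)\<close>, where \<open>p\<close> grows with an exponent
  strictly between the order \<open>1/2\<close> of \<open>F\<close> and \<open>1\<close>, makes the
  function small on large half circles. The maximum principle on a half disc gives the bound
  \<open>M\<close>, and then \<open>e\<close> tends to \<open>0\<close>.\<close>

lemma phragmen_lindelof_half_plane:
  fixes F :: "complex \<Rightarrow> complex"
  assumes hol: "F holomorphic_on UNIV"
    and growth: "\<And>z. norm (F z) \<le> A * exp (B * sqrt (norm z))"
    and real: "\<And>x::real. norm (F (of_real x)) \<le> M" and M: "M > 0"
    and z: "Im z \<ge> 0"
  shows "norm (F z) \<le> M"
proof -
  \<comment> \<open>The power \<open>(1 - \<i> * w)\<close> to \<open>3/4\<close>. The shift by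
    \<open>1\<close> moves the branch point to \<open>- \<i>\<close>, outside the closed upper half
    plane, and keeps the base in the right half plane. Its argument is then below
    \<open>pi / 2\<close>, so that of the power is below \<open>3 * pi / 8\<close>, whose cosine
    \<open>c\<close> is still positive.\<close>
  define p where "p w = exp (of_real (3/4) * Ln (1 - \<i> * w))" for w
  define c where "c = cos (3 * pi / 8)"
  have c0: "c > 0" unfolding c_def by (rule cos_gt_zero_pi) auto
  have Re_pos: "Re (1 - \<i> * w) \<ge> 1" if "Im w \<ge> 0" for w using that by simp
  have norm_ge: "norm (1 - \<i> * w) \<ge> norm w" if "Im w \<ge> 0" for w
  proof (rule power2_le_imp_le)
    have "(norm (1 - \<i> * w))\<^sup>2 = (norm w)\<^sup>2 + (1 + 2 * Im w)"
      by (simp only: cmod_power2) (simp add: power2_eq_square algebra_simps)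
    then show "(norm w)\<^sup>2 \<le> (norm (1 - \<i> * w))\<^sup>2" using that by simp
  qed simp
  have Re_p: "Re (p w) \<ge> c * norm w powr (3/4)" if "Im w \<ge> 0" for w
  proof -
    define u where "u = 1 - \<i> * w"
    have u2: "Re u > 0" using Re_pos[OF that] by (simp add: u_def)
    then have u: "u \<noteq> 0" "Re u > 0" by auto
    have "\<bar>Im (Ln u)\<bar> < pi / 2" using Re_Ln_pos_lt[OF u(1)] u(2) by simp
    then have "\<bar>3/4 * Im (Ln u)\<bar> \<le> 3 * pi / 8" by simp
    then have "c \<le> cos \<bar>3/4 * Im (Ln u)\<bar>"
      unfolding c_def by (intro cos_monotone_0_pi_le) auto
    then have c_le: "c \<le> cos (3/4 * Im (Ln u))" by (simp only: cos_abs_real)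
    have "norm w powr (3/4) \<le> norm u powr (3/4)"
      unfolding u_def by (intro powr_mono2 norm_ge that) auto
    then have "c * norm w powr (3/4) \<le> norm u powr (3/4) * cos (3/4 * Im (Ln u))"
      using c_le c0 by (subst mult.commute, intro mult_mono) auto
    also have "\<dots> = Re (p w)"
      using u(1) by (simp add: p_def u_def[symmetric] Re_exp powr_def)
    finally show ?thesis .
  qed
  have hol_p: "p holomorphic_on {w. Im w > -1}"
    unfolding p_def
    by (intro holomorphic_intros) (auto simp: complex_nonpos_Reals_iff)
  have "norm (F z) \<le> M * exp (e * norm (p z))" if e: "e > 0" for e :: real
  proof -
    define g where "g w = F w * exp (- of_real e * p w)" for w
    have norm_g: "norm (g w) = norm (F w) * exp (- e * Re (p w))" for w
      by (simp add: g_def norm_mult)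
    have "((\<lambda>r. A * exp (B * sqrt r - e * c * r powr (3/4))) \<longlongrightarrow> 0) at_top"
      using e c0 by real_asymp
    then have "\<forall>\<^sub>F r in at_top. A * exp (B * sqrt r - e * c * r powr (3/4)) < M"
      using M by (simp add: order_tendsto_iff)
    then have "\<forall>\<^sub>F r in at_top. A * exp (B * sqrt r - e * c * r powr (3/4)) < M \<and> r > norm z"
      using eventually_gt_at_top[of "norm z"] by eventually_elim auto
    then obtain r where r: "A * exp (B * sqrt r - e * c * r powr (3/4)) < M" "r > norm z"
      by (auto simp: eventually_at_top_linorder)
    define S where "S = {w. Im w \<ge> 0} \<inter> cball 0 r"
    have closed: "closed S" unfolding S_def by (intro closed_Int closed_halfspace_Im_ge closed_cball)
    have S_sub: "S \<subseteq> {w. Im w > -1}" by (auto simp: S_def)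
    have hol_g: "g holomorphic_on {w. Im w > -1}"
      unfolding g_def by (intro holomorphic_intros hol_p holomorphic_on_subset[OF hol]) auto
    have "norm (g z) \<le> M"
    proof (rule maximum_modulus_frontier[where S = S and f = g and \<xi> = z])
      show "g holomorphic_on interior S"
        using hol_g S_sub interior_subset holomorphic_on_subset by (metis order_trans)
      show "continuous_on (closure S) g"
        using hol_g S_sub closed by (simp add: holomorphic_on_imp_continuous_on holomorphic_on_subset)
      show "bounded S" unfolding S_def by (intro bounded_Int) auto
      show "z \<in> S" using z r(2) by (simp add: S_def)
      fix w assume w: "w \<in> frontier S"
      have wS: "w \<in> S" using w closed by (simp add: frontier_def)
      have Re0: "Re (p w) \<ge> c * norm w powr (3/4)" using Re_p wS by (simp add: S_def)
      have "Im w = 0 \<or> norm w = r"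
      proof (rule ccontr)
        assume "\<not> (Im w = 0 \<or> norm w = r)"
        then have "w \<in> {w. Im w > 0} \<inter> ball 0 r" using wS by (auto simp: S_def)
        moreover have "{w. Im w > 0} \<inter> ball 0 r \<subseteq> interior S"
          by (rule interior_maximal) (auto simp: S_def open_halfspace_Im_gt)
        ultimately show False using w by (auto simp: frontier_def)
      qed
      then show "norm (g w) \<le> M"
      proof
        assume "Im w = 0"
        then have "w = of_real (Re w)" by (simp add: complex_eq_iff)
        then have "norm (F w) \<le> M" using real[of "Re w"] by simp
        moreover have "Re (p w) \<ge> 0" using Re0 c0 order_trans[of 0 "c * norm w powr (3/4)"] by simp
        then have "exp (- e * Re (p w)) \<le> 1" using e by simp
        ultimately have "norm (F w) * exp (- e * Re (p w)) \<le> M * 1" using M by (intro mult_mono) auto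
        then show ?thesis by (simp add: norm_g)
      next
        assume nr: "norm w = r"
        have "norm (g w) \<le> (A * exp (B * sqrt r)) * exp (- e * Re (p w))"
          unfolding norm_g using growth[of w] nr by (intro mult_right_mono) auto
        also have "\<dots> \<le> (A * exp (B * sqrt r)) * exp (- e * (c * r powr (3/4)))"
        proof (rule mult_left_mono)
          have "e * (c * r powr (3/4)) \<le> e * Re (p w)" using Re0 nr e by (intro mult_left_mono) auto
          then show "exp (- e * Re (p w)) \<le> exp (- e * (c * r powr (3/4)))" by simp
          show "0 \<le> A * exp (B * sqrt r)" using growth[of w] nr order_trans[OF norm_ge_zero] by blast
        qed
        also have "\<dots> = A * exp (B * sqrt r - e * c * r powr (3/4))"
          by (simp add: mult.assoc exp_add[symmetric])
        finally show ?thesis using r(1) by simp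
      qed
    qed
    then have "norm (F z) * exp (- e * Re (p z)) * exp (e * Re (p z)) \<le> M * exp (e * Re (p z))"
      unfolding norm_g by (intro mult_right_mono) auto
    then have "norm (F z) \<le> M * exp (e * Re (p z))" by (simp add: mult.assoc exp_add[symmetric])
    also have "\<dots> \<le> M * exp (e * norm (p z))"
      using M e complex_Re_le_cmod[of "p z"] by simp
    finally show ?thesis .
  qed
  moreover have "((\<lambda>e. M * exp (e * norm (p z))) \<longlongrightarrow> M * exp (0 * norm (p z))) (at_right 0)"
    by (intro tendsto_intros)
  ultimately have "norm (F z) \<le> M * exp (0 * norm (p z))"
    by (intro tendsto_lowerbound[of "\<lambda>e. M * exp (e * norm (p z))" _ "at_right 0"])
      (auto simp: eventually_at_filter)
  then show ?thesis by simp
qed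

text \<open>The substitution \<open>- z\<close> carries the lower half plane to the upper one, and
  the real axis bounds both. Raising the bound to at least \<open>1\<close> makes it
  positive.\<close>

lemma entire_bounded_on_reals_constant:
  fixes F :: "complex \<Rightarrow> complex"
  assumes hol: "F holomorphic_on UNIV"
    and growth: "\<And>z. norm (F z) \<le> A * exp (B * sqrt (norm z))"
    and real: "\<And>x::real. norm (F (of_real x)) \<le> M"
  obtains c where "\<And>z. F z = c"
proof -
  define M' where "M' = max M 1"
  have M': "M' > 0" "\<And>x::real. norm (F (of_real x)) \<le> M'"
    using real by (auto simp: M'_def le_max_iff_disj)
  have "norm (F z) \<le> M'" for z
  proof (cases "Im z \<ge> 0")
    case True
    then show ?thesis using phragmen_lindelof_half_plane[OF hol growth M'(2,1)] by blast
  next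
    case False
    have "norm (F (- (- z))) \<le> M'"
    proof (rule phragmen_lindelof_half_plane[where F = "\<lambda>w. F (- w)"])
      show "(\<lambda>w. F (- w)) holomorphic_on UNIV"
        using holomorphic_on_compose[OF holomorphic_on_minus[OF holomorphic_on_ident]
            holomorphic_on_subset[OF hol subset_UNIV]]
        by (simp add: o_def)
      show "norm (F (- w)) \<le> A * exp (B * sqrt (norm w))" for w using growth[of "- w"] by simp
      show "norm (F (- of_real x)) \<le> M'" for x :: real using M'(2)[of "- x"] by simp
    qed (use M' False in auto)
    then show ?thesis by simp
  qed
  then have "F constant_on UNIV"
    using Liouville_theorem[OF hol] by (auto simp: bounded_iff)
  then show ?thesis using that by (auto simp: constant_on_def)
qed

section \<open>The Borg-Marchenko theorem\<close>

context potential
begin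

text \<open>Two choices of the energy parameter. With \<open>k^2 = norm z + 1\<close> the rate
  \<open>N / k\<close> is of size \<open>sqrt (norm z)\<close>, which is order \<open>1/2\<close>.
  At \<open>z = k^2\<close> the quantity \<open>Q + k^2\<close> is just \<open>V\<close>, so the
  bounds are uniform in \<open>k\<close>, and the weight \<open>k^2\<close> in the energy yields the
  factor \<open>1 / k\<close> for \<open>phi\<close>.\<close>

lemma solution_bounds:
  assumes x: "x \<ge> 0"
  obtains K where "K \<ge> 0"
    "\<And>z. norm (theta z x) \<le> K * exp (x * sqrt (norm z))"
    "\<And>z. norm (phi z x) \<le> K * exp (x * sqrt (norm z))"
    "\<And>k. k \<ge> 1 \<Longrightarrow> norm (theta (of_real (k\<^sup>2)) x) \<le> K"
    "\<And>k. k \<ge> 1 \<Longrightarrow> norm (phi (of_real (k\<^sup>2)) x) \<le> K / k"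
proof -
  obtain M where M: "M \<ge> 0" "\<And>t. t \<in> {0..x} \<Longrightarrow> \<bar>V t\<bar> \<le> M" using V_bounded_on[of x] by blast
  have root: "a \<le> exp (b / 2)" if "a\<^sup>2 \<le> exp b" for a b :: real
  proof (rule power2_le_imp_le)
    have "(exp (b / 2))\<^sup>2 = exp b" by (simp add: power2_eq_square flip: exp_add)
    then show "a\<^sup>2 \<le> (exp (b / 2))\<^sup>2" using that by simp
  qed simp
  have energy: "norm (theta z x) \<le> exp (N * x / k / 2)" "k * norm (phi z x) \<le> exp (N * x / k / 2)"
    if k: "k > 0" and N: "\<And>t. t \<in> {0..x} \<Longrightarrow> norm (Q z t + of_real (k\<^sup>2)) \<le> N" for z k N
  proof -
    have "k\<^sup>2 * (norm (theta z x))\<^sup>2 \<le> (norm (theta' z x))\<^sup>2 + k\<^sup>2 * (norm (theta z x))\<^sup>2" by simp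
    also have "\<dots> \<le> ((norm (theta' z 0))\<^sup>2 + k\<^sup>2 * (norm (theta z 0))\<^sup>2) * exp (N * x / k)"
      by (rule energy_bound[OF theta k x N])
    finally have "(norm (theta z x))\<^sup>2 \<le> exp (N * x / k)" using k by simp
    then show "norm (theta z x) \<le> exp (N * x / k / 2)" by (rule root)
    have "(k * norm (phi z x))\<^sup>2 \<le> (norm (phi' z x))\<^sup>2 + k\<^sup>2 * (norm (phi z x))\<^sup>2"
      by (simp add: power_mult_distrib)
    also have "\<dots> \<le> ((norm (phi' z 0))\<^sup>2 + k\<^sup>2 * (norm (phi z 0))\<^sup>2) * exp (N * x / k)"
      by (rule energy_bound[OF phi k x N])
    finally have "(k * norm (phi z x))\<^sup>2 \<le> exp (N * x / k)" by simp
    then show "k * norm (phi z x) \<le> exp (N * x / k / 2)" by (rule root)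
  qed
  define K where "K = exp ((M + 1) * x)"
  have gen: "norm (theta z x) \<le> K * exp (x * sqrt (norm z)) \<and> norm (phi z x) \<le> K * exp (x * sqrt (norm z))" for z
  proof -
    define k where "k = sqrt (norm z + 1)"
    have k: "k \<ge> 1" "k\<^sup>2 = norm z + 1" by (auto simp: k_def)
    have N: "norm (Q z t + of_real (k\<^sup>2)) \<le> M + 2 * k\<^sup>2" if "t \<in> {0..x}" for t
    proof -
      have "norm (Q z t + of_real (k\<^sup>2)) \<le> norm (complex_of_real (V t)) + norm z + norm (complex_of_real (k\<^sup>2))"
        unfolding Q_def by (intro norm_triangle_le norm_triangle_le_diff add_mono order_refl)
      also have "\<dots> \<le> M + 2 * k\<^sup>2" using M(2)[OF that] k(2) by (simp del: of_real_power)
      finally show ?thesis .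
    qed
    have "k \<le> sqrt (norm z) + 1"
      unfolding k_def by (rule order_trans[OF sqrt_add_le_add_sqrt]) auto
    have "(M + 2 * k\<^sup>2) * x / k / 2 = (M / k / 2 + k) * x"
      using k(1) by (simp add: field_simps power2_eq_square)
    also have "\<dots> \<le> (M + (sqrt (norm z) + 1)) * x"
    proof (intro mult_right_mono add_mono x)
      have "M / k / 2 \<le> M / 1 / 1" using M(1) k(1) by (intro frac_le) auto
      then show "M / k / 2 \<le> M" by simp
    qed fact
    finally have e: "exp ((M + 2 * k\<^sup>2) * x / k / 2) \<le> K * exp (x * sqrt (norm z))"
      unfolding K_def exp_add[symmetric] by (simp add: algebra_simps)
    have "norm (phi z x) \<le> k * norm (phi z x)" using k(1) by (simp add: mult_le_cancel_right1)
    then show ?thesis using energy[OF _ N] k(1) e by (meson order_trans less_le_trans zero_less_one)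
  qed
  have pos: "norm (theta (of_real (k\<^sup>2)) x) \<le> K \<and> norm (phi (of_real (k\<^sup>2)) x) \<le> K / k" if k: "k \<ge> 1" for k
  proof -
    have N: "norm (Q (of_real (k\<^sup>2)) t + of_real (k\<^sup>2)) \<le> M" if "t \<in> {0..x}" for t
      using M(2)[OF that] by (simp add: Q_def)
    have "M * x / k / 2 \<le> M * x / 1 / 1" using M(1) x k by (intro frac_le) auto
    also have "\<dots> \<le> (M + 1) * x" using x by (simp add: algebra_simps)
    finally have e: "exp (M * x / k / 2) \<le> K" by (simp add: K_def)
    have k0: "k > 0" using k by simp
    have "k * norm (phi (of_real (k\<^sup>2)) x) \<le> K" using energy(2)[OF k0 N] e by (rule order_trans)
    then have "norm (phi (of_real (k\<^sup>2)) x) \<le> K / k" using k0 by (simp add: le_divide_eq mult.commute)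
    moreover have "norm (theta (of_real (k\<^sup>2)) x) \<le> K" using energy(1)[OF k0 N] e by (rule order_trans)
    ultimately show ?thesis by blast
  qed
  have "K \<ge> 0" by (simp add: K_def)
  then show ?thesis by (rule that) (use gen pos in blast)+
qed

text \<open>The root \<open>sqrt (k^2 - C)\<close> is replaced by the smaller \<open>k - C\<close>,
  so that the exponent is linear in \<open>k\<close> and cancels the growth
  \<open>exp (x * k)\<close> of the other factor.\<close>

lemma weyl_decay:
  obtains C where "C \<ge> 0"
    "\<And>k x. k \<ge> C + 1 \<Longrightarrow> x \<ge> 0 \<Longrightarrow>
      norm (psi (- of_real (k\<^sup>2)) x) \<le> exp ((C - k) * x)"
proof -
  obtain C where C: "C \<ge> 0"
    "\<And>k x. k\<^sup>2 \<ge> C + 1 \<Longrightarrow> x \<ge> 0 \<Longrightarrow>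
      norm (psi (- of_real (k\<^sup>2)) x) \<le> exp (- sqrt (k\<^sup>2 - C) * x)"
    by (rule m_asymptotics) blast
  have "norm (psi (- of_real (k\<^sup>2)) x) \<le> exp ((C - k) * x)"
    if k: "k \<ge> C + 1" and x: "x \<ge> 0" for k x
  proof -
    have k1: "k \<ge> 1" using k C(1) by simp
    have "k * 1 \<le> k * k" using k1 by (intro mult_left_mono) auto
    then have k2: "k\<^sup>2 \<ge> C + 1" using k by (simp add: power2_eq_square)
    have "(k - C)\<^sup>2 \<le> k\<^sup>2 - C"
    proof -
      have "C * (C + 1) \<le> C * (2 * k)" using k C(1) by (intro mult_left_mono) auto
      then show ?thesis by (simp add: power2_eq_square algebra_simps)
    qed
    then have "k - C \<le> sqrt (k\<^sup>2 - C)" using k real_le_rsqrt by blast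
    then have "- sqrt (k\<^sup>2 - C) * x \<le> (C - k) * x" using x by (intro mult_right_mono) auto
    then show ?thesis using C(2)[OF k2 x] by (meson exp_le_cancel_iff order_trans)
  qed
  with C(1) show ?thesis by (rule that)
qed

end

locale two_potentials = V: potential V + W: potential W for V W :: "real \<Rightarrow> real"
begin

lemma borg_marchenko_identity:
  assumes m_eq: "\<And>k. k \<ge> r \<Longrightarrow> V.m (- of_real (k\<^sup>2)) = W.m (- of_real (k\<^sup>2))" and x: "x \<ge> 0"
  shows "V.phi z x * W.theta z x = V.theta z x * W.phi z x"
proof -
  define F where "F z = V.phi z x * W.theta z x - V.theta z x * W.phi z x" for z
  have hol: "F holomorphic_on UNIV"
    unfolding F_def
    by (intro holomorphic_intros V.holomorphic_phi V.holomorphic_theta W.holomorphic_phi W.holomorphic_theta x)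
  obtain K1 where K1: "K1 \<ge> 0"
    "\<And>z. norm (V.theta z x) \<le> K1 * exp (x * sqrt (norm z))"
    "\<And>z. norm (V.phi z x) \<le> K1 * exp (x * sqrt (norm z))"
    "\<And>k. k \<ge> 1 \<Longrightarrow> norm (V.theta (of_real (k\<^sup>2)) x) \<le> K1"
    "\<And>k. k \<ge> 1 \<Longrightarrow> norm (V.phi (of_real (k\<^sup>2)) x) \<le> K1 / k"
    by (rule V.solution_bounds[OF x]) blast
  obtain K2 where K2: "K2 \<ge> 0"
    "\<And>z. norm (W.theta z x) \<le> K2 * exp (x * sqrt (norm z))"
    "\<And>z. norm (W.phi z x) \<le> K2 * exp (x * sqrt (norm z))"
    "\<And>k. k \<ge> 1 \<Longrightarrow> norm (W.theta (of_real (k\<^sup>2)) x) \<le> K2"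
    "\<And>k. k \<ge> 1 \<Longrightarrow> norm (W.phi (of_real (k\<^sup>2)) x) \<le> K2 / k"
    by (rule W.solution_bounds[OF x]) blast
  obtain C1 where C1: "C1 \<ge> 0" "\<And>k x. k \<ge> C1 + 1 \<Longrightarrow> x \<ge> 0 \<Longrightarrow>
      norm (V.psi (- of_real (k\<^sup>2)) x) \<le> exp ((C1 - k) * x)"
    by (rule V.weyl_decay) blast
  obtain C2 where C2: "C2 \<ge> 0" "\<And>k x. k \<ge> C2 + 1 \<Longrightarrow> x \<ge> 0 \<Longrightarrow>
      norm (W.psi (- of_real (k\<^sup>2)) x) \<le> exp ((C2 - k) * x)"
    by (rule W.weyl_decay) blast
  have growth: "norm (F z) \<le> (2 * K1 * K2) * exp ((2 * x) * sqrt (norm z))" for z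
  proof -
    define E where "E = exp (x * sqrt (norm z))"
    have E2: "exp ((2 * x) * sqrt (norm z)) = E * E" by (simp add: E_def flip: exp_add)
    have "norm (F z) \<le> norm (V.phi z x) * norm (W.theta z x) + norm (V.theta z x) * norm (W.phi z x)"
      unfolding F_def by (rule order_trans[OF norm_triangle_ineq4]) (simp add: norm_mult)
    also have "\<dots> \<le> (K1 * E) * (K2 * E) + (K1 * E) * (K2 * E)"
      unfolding E_def using K1(1) by (intro add_mono mult_mono K1 K2) auto
    finally show ?thesis unfolding E2 by (simp add: algebra_simps)
  qed
  have pos: "norm (F (of_real (k\<^sup>2))) \<le> 2 * K1 * K2 / k" if k: "k \<ge> 1" for k
  proof -
    have "norm (F (of_real (k\<^sup>2))) \<le> norm (V.phi (of_real (k\<^sup>2)) x) * norm (W.theta (of_real (k\<^sup>2)) x)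
        + norm (V.theta (of_real (k\<^sup>2)) x) * norm (W.phi (of_real (k\<^sup>2)) x)"
      unfolding F_def by (rule order_trans[OF norm_triangle_ineq4]) (simp add: norm_mult)
    also have "\<dots> \<le> (K1 / k) * K2 + K1 * (K2 / k)"
      using K1(1) k by (intro add_mono mult_mono K1 K2) auto
    finally show ?thesis by (simp add: algebra_simps)
  qed
  define r0 where "r0 = max (max r 1) (max (C1 + 1) (C2 + 1))"
  have neg: "norm (F (- of_real (k\<^sup>2))) \<le> K1 * exp (C2 * x) + exp (C1 * x) * K2" if k: "k \<ge> r0" for k
  proof -
    have k': "k \<ge> r" "k \<ge> 1" "k \<ge> C1 + 1" "k \<ge> C2 + 1" using k by (auto simp: r0_def)
    define w where "w = - complex_of_real (k\<^sup>2)"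
    have sw: "sqrt (norm w) = k" using k' by (simp add: w_def norm_power)
    have m: "V.m w = W.m w" using m_eq[OF k'(1)] by (simp add: w_def)
    \<comment> \<open>With equal Weyl functions the two terms containing \<open>m\<close> times the
      product of both \<open>phi\<close> cancel, so each growing factor can be paired with a
      decaying one.\<close>
    have "F w = V.phi w x * (W.theta w x + W.m w * W.phi w x) - (V.theta w x + V.m w * V.phi w x) * W.phi w x"
      unfolding F_def m by (simp add: algebra_simps)
    then have "norm (F w) \<le> norm (V.phi w x) * norm (W.theta w x + W.m w * W.phi w x)
        + norm (V.theta w x + V.m w * V.phi w x) * norm (W.phi w x)"
      by (simp only: norm_mult[symmetric] norm_triangle_ineq4)
    also have "\<dots> \<le> (K1 * exp (x * k)) * exp ((C2 - k) * x) + exp ((C1 - k) * x) * (K2 * exp (x * k))"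
      using K1(3)[of w] K2(3)[of w] C1(2)[OF k'(3) x] C2(2)[OF k'(4) x] K1(1) unfolding sw w_def[symmetric]
      by (intro add_mono mult_mono) auto
    also have "\<dots> = K1 * exp (x * k + (C2 - k) * x) + exp ((C1 - k) * x + x * k) * K2"
      unfolding exp_add by (simp only: mult_ac)
    also have "\<dots> = K1 * exp (C2 * x) + exp (C1 * x) * K2" by (simp add: algebra_simps)
    finally show ?thesis by (simp add: w_def)
  qed
  have "\<exists>M. \<forall>t::real. norm (F (of_real t)) \<le> M"
  proof -
    have "compact ((\<lambda>t. F (of_real t)) ` {- r0\<^sup>2..1})"
      by (intro compact_continuous_image continuous_on_compose2[OF holomorphic_on_imp_continuous_on[OF hol]] continuous_intros) auto
    then obtain M where M: "\<And>t. t \<in> {- r0\<^sup>2..1} \<Longrightarrow> norm (F (of_real t)) \<le> M"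
      by (metis (mono_tags, lifting) bounded_iff compact_imp_bounded imageI)
    define M' where "M' = max M (max (2 * K1 * K2) (K1 * exp (C2 * x) + exp (C1 * x) * K2))"
    have "norm (F (of_real t)) \<le> M'" for t :: real
    proof -
      consider "t \<in> {- r0\<^sup>2..1}" | "t > 1" | "t < - r0\<^sup>2" by fastforce
      then show ?thesis
      proof cases
        case 1
        then show ?thesis using M by (auto simp: M'_def le_max_iff_disj)
      next
        case 2
        have k: "sqrt t \<ge> 1" "(sqrt t)\<^sup>2 = t" using 2 by auto
        have "norm (F (of_real t)) \<le> 2 * K1 * K2 / sqrt t" using pos[OF k(1)] k(2) by simp
        also have "\<dots> \<le> 2 * K1 * K2 / 1" using k K1(1) K2(1) by (intro divide_left_mono) auto
        finally show ?thesis by (auto simp: M'_def le_max_iff_disj)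
      next
        case 3
        have r0: "r0 \<ge> 0" by (auto simp: r0_def le_max_iff_disj)
        have "sqrt (- t) \<ge> sqrt (r0\<^sup>2)" using 3 by (intro real_sqrt_le_mono) auto
        then have k: "sqrt (- t) \<ge> r0" using r0 by simp
        have "r0\<^sup>2 \<ge> 0" by simp
        then have "t < 0" using 3 by linarith
        then have t: "- complex_of_real ((sqrt (- t))\<^sup>2) = of_real t" by simp
        show ?thesis using neg[OF k] unfolding t by (auto simp: M'_def le_max_iff_disj)
      qed
    qed
    then show ?thesis by blast
  qed
  then obtain M where "\<And>t::real. norm (F (of_real t)) \<le> M" by blast
  from entire_bounded_on_reals_constant[OF hol growth this]
  obtain c where c: "\<And>z. F z = c" by blast
  have "norm c \<le> 0"
  proof (rule tendsto_lowerbound)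
    show "((\<lambda>k. 2 * K1 * K2 / k) \<longlongrightarrow> 0) at_top"
      by (rule real_tendsto_divide_at_top[OF tendsto_const filterlim_ident])
    show "\<forall>\<^sub>F k in at_top. norm c \<le> 2 * K1 * K2 / k"
      using eventually_ge_at_top[of 1] by eventually_elim (use pos c in auto)
  qed simp
  then have "F z = 0" using c by simp
  then show ?thesis by (simp add: F_def)
qed

text \<open>The identity says that \<open>phi / theta\<close> is the same for both potentials. By
  the Wronskian its derivative is \<open>1 / theta^2\<close>, so the squares of \<open>theta\<close>
  agree; differentiating twice more brings in the potentials. A spectral parameter for which
  \<open>theta\<close> has no zeros finishes the comparison.\<close>

theorem borg_marchenko:
  assumes m_eq: "\<And>k. k \<ge> r \<Longrightarrow> V.m (- of_real (k\<^sup>2)) = W.m (- of_real (k\<^sup>2))"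
  shows "V = W"
proof
  have id: "V.phi z x * W.theta z x = V.theta z x * W.phi z x" for z x
  proof (cases "x \<ge> 0")
    case True
    then show ?thesis using borg_marchenko_identity[of r] m_eq by blast
  next
    case False
    then have "V.phi z (- x) * W.theta z (- x) = V.theta z (- x) * W.phi z (- x)"
      using borg_marchenko_identity[of r "- x"] m_eq by simp
    then show ?thesis
      by (simp add: V.theta_reflect V.phi_reflect W.theta_reflect W.phi_reflect)
  qed
  have zero_derivative: "f' = 0"
    if "\<And>y. f y = g y" "(f has_vector_derivative f1) (at x)" "(g has_vector_derivative g1) (at x)" "f1 - g1 = f'"
    for f g :: "real \<Rightarrow> complex" and f' f1 g1 and x :: real
  proof -
    have "f = g" using that(1) by auto
    then show ?thesis using that vector_derivative_unique_at by fastforce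
  qed
  have sq: "(V.theta z x)\<^sup>2 = (W.theta z x)\<^sup>2" for z x
  proof -
    note d = V.theta[of z, THEN ode_solD(1), of x] V.phi[of z, THEN ode_solD(1), of x]
      W.theta[of z, THEN ode_solD(1), of x] W.phi[of z, THEN ode_solD(1), of x]
    have d0: "(V.phi z x * W.theta' z x + V.phi' z x * W.theta z x)
        - (V.theta z x * W.phi' z x + V.theta' z x * W.phi z x) = 0"
      by (rule zero_derivative[OF id has_vector_derivative_mult[OF d(2,3)] has_vector_derivative_mult[OF d(1,4)] refl])
    \<comment> \<open>\<open>theta\<close> may vanish for general \<open>z\<close>, so instead of
      dividing, the differentiated identity is multiplied by both \<open>theta\<close> and reduced
      with the identity itself and the two Wronskians.\<close>
    have "0 = V.theta z x * W.theta z x * ((V.phi z x * W.theta' z x + V.phi' z x * W.theta z x)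
        - (V.theta z x * W.phi' z x + V.theta' z x * W.phi z x))" by (simp only: d0) simp
    also have "\<dots> = (V.phi z x * W.theta z x) * (V.theta z x * W.theta' z x)
        + V.theta z x * W.theta z x * (V.phi' z x * W.theta z x)
        - V.theta z x * W.theta z x * (V.theta z x * W.phi' z x)
        - (V.theta z x * W.phi z x) * (V.theta' z x * W.theta z x)"
      by (simp add: algebra_simps)
    also have "\<dots> = (V.theta z x * W.phi z x) * (V.theta z x * W.theta' z x)
        + V.theta z x * W.theta z x * (V.phi' z x * W.theta z x)
        - V.theta z x * W.theta z x * (V.theta z x * W.phi' z x)
        - (V.phi z x * W.theta z x) * (V.theta' z x * W.theta z x)"
      by (simp only: id)
    also have "\<dots> = (W.theta z x)\<^sup>2 * (V.theta z x * V.phi' z x - V.theta' z x * V.phi z x)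
        - (V.theta z x)\<^sup>2 * (W.theta z x * W.phi' z x - W.theta' z x * W.phi z x)"
      by (simp add: algebra_simps power2_eq_square)
    also have "\<dots> = (W.theta z x)\<^sup>2 - (V.theta z x)\<^sup>2"
      by (simp add: V.wronskian_theta_phi W.wronskian_theta_phi)
    finally show ?thesis by simp
  qed
  have sq': "V.theta z x * V.theta' z x = W.theta z x * W.theta' z x" for z x
  proof -
    note d = V.theta[of z, THEN ode_solD(1), of x] W.theta[of z, THEN ode_solD(1), of x]
    have "(V.theta z x * V.theta' z x + V.theta' z x * V.theta z x)
        - (W.theta z x * W.theta' z x + W.theta' z x * W.theta z x) = 0"
      by (rule zero_derivative[OF sq[unfolded power2_eq_square] has_vector_derivative_mult[OF d(1,1)]
            has_vector_derivative_mult[OF d(2,2)] refl])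
    then show ?thesis by (simp add: algebra_simps)
  qed
  fix x
  obtain c1 where c1: "\<And>x. x \<ge> 0 \<Longrightarrow> V x \<ge> - c1" using V.V_bdd_below by blast
  \<comment> \<open>For this real parameter the coefficient \<open>V + c1\<close> is nonnegative on
    the half line. Then \<open>|theta|^2\<close> increases from its value \<open>1\<close> at
    \<open>0\<close>, and \<open>theta\<close> has no zeros.\<close>
  define z where "z = complex_of_real (- c1)"
  have nz: "V.theta z x \<noteq> 0"
  proof -
    define h where "h x = Re (cnj (V.theta z x) * V.theta' z x)" for x
    note d = V.theta[of z, THEN ode_solD(1)] V.theta[of z, THEN ode_solD(2)]
    have dh: "(h has_real_derivative (norm (V.theta' z t))\<^sup>2 + (V t + c1) * (norm (V.theta z t))\<^sup>2) (at t)" for t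
      unfolding h_def
      by (rule DERIV_cong[OF has_real_derivative_Re_cnj_mult[OF d]])
        (simp add: V.Q_def z_def cmod_power2, simp add: algebra_simps power2_eq_square)
    have h0: "h t \<ge> 0" if "t \<ge> 0" for t
    proof -
      have "h 0 \<le> h t"
      proof (rule DERIV_nonneg_imp_nondecreasing[OF that])
        fix s assume "0 \<le> s" "s \<le> t"
        then have "0 \<le> V s + c1" using c1[of s] by simp
        from add_nonneg_nonneg[OF zero_le_power2 mult_nonneg_nonneg[OF this zero_le_power2]]
        have "0 \<le> (norm (V.theta' z s))\<^sup>2 + (V s + c1) * (norm (V.theta z s))\<^sup>2" .
        then show "\<exists>y. (h has_real_derivative y) (at s) \<and> 0 \<le> y" using dh by blast
      qed
      then show ?thesis by (simp add: h_def)
    qed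
    have "(norm (V.theta z 0))\<^sup>2 \<le> (norm (V.theta z \<bar>x\<bar>))\<^sup>2"
    proof (rule DERIV_nonneg_imp_nondecreasing[of 0 "\<bar>x\<bar>" "\<lambda>x. (norm (V.theta z x))\<^sup>2"])
      fix t assume "0 \<le> t" "t \<le> \<bar>x\<bar>"
      then show "\<exists>y. ((\<lambda>x. (norm (V.theta z x))\<^sup>2) has_real_derivative y) (at t) \<and> 0 \<le> y"
        using has_real_derivative_norm_square[OF d(1), of t] h0[of t] by (auto simp: h_def)
    qed simp
    moreover have "V.theta z \<bar>x\<bar> = V.theta z x" by (cases "x \<ge> 0") (auto simp: V.theta_reflect)
    ultimately show ?thesis by auto
  qed
  have d0: "(V.theta z x * (V.Q z x * V.theta z x) + V.theta' z x * V.theta' z x)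
      - (W.theta z x * (W.Q z x * W.theta z x) + W.theta' z x * W.theta' z x) = 0"
    by (rule zero_derivative[OF sq' has_vector_derivative_mult has_vector_derivative_mult refl])
      (rule V.theta[THEN ode_solD(1)] V.theta[THEN ode_solD(2)] W.theta[THEN ode_solD(1)] W.theta[THEN ode_solD(2)])+
  \<comment> \<open>After multiplication by \<open>theta^2\<close> the squares of
    \<open>theta'\<close> cancel, because both \<open>theta^2\<close> and
    \<open>theta * theta'\<close> agree for the two potentials.\<close>
  have "0 = (V.theta z x)\<^sup>2 * ((V.theta z x * (V.Q z x * V.theta z x) + V.theta' z x * V.theta' z x)
      - (W.theta z x * (W.Q z x * W.theta z x) + W.theta' z x * W.theta' z x))"
    by (simp only: d0) simp
  also have "\<dots> = (V.theta z x)\<^sup>2 * (V.Q z x * (V.theta z x)\<^sup>2 - W.Q z x * (W.theta z x)\<^sup>2)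
      + (V.theta z x * V.theta' z x)\<^sup>2 - (V.theta z x)\<^sup>2 * (W.theta' z x)\<^sup>2"
    by (simp add: algebra_simps power2_eq_square)
  also have "\<dots> = (V.theta z x)\<^sup>2 * (V.Q z x * (V.theta z x)\<^sup>2 - W.Q z x * (V.theta z x)\<^sup>2)"
    by (simp only: sq' sq) (simp add: power_mult_distrib)
  finally have "V.Q z x = W.Q z x" using nz by (simp add: right_diff_distrib[symmetric] left_diff_distrib[symmetric])
  then show "V x = W x" by (simp add: V.Q_def W.Q_def)
qed

end

section \<open>The enumeration of the eigenvalues\<close>

lemma strict_mono_enumeration_unique:
  fixes E F :: "nat \<Rightarrow> real"
  assumes "strict_mono E" "strict_mono F" "range E = range F"
  shows "E = F"
proof
  have le: "F n \<le> E n" if IH: "\<And>k. k < n \<Longrightarrow> E k = F k" and EF: "strict_mono E" "range E = range F" "strict_mono F"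
    for E F :: "nat \<Rightarrow> real" and n
  proof -
    have "E n \<in> range F" using EF(2) by blast
    then obtain j where j: "E n = F j" by blast
    have "\<not> j < n"
    proof
      assume "j < n"
      then have "E j = E n" using IH j by simp
      then show False using \<open>j < n\<close> EF(1) by (metis strict_mono_less less_irrefl)
    qed
    then show ?thesis using j EF(3) by (simp add: strict_mono_less_eq)
  qed
  fix n
  show "E n = F n"
  proof (induction n rule: less_induct)
    case (less n)
    then show ?case
      using le[of n E F] le[of n F E] assms by (metis order_antisym)
  qed
qed

text \<open>Each term is the least element above its predecessor. An element never reached would
  bound all terms, leaving infinitely many elements of \<open>S\<close> below it.\<close>

lemma strict_mono_enumeration_exists:
  fixes S :: "real set"
  assumes inf: "infinite S" and fin: "\<And>c. finite {x \<in> S. x \<le> c}"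
  shows "\<exists>E :: nat \<Rightarrow> real. strict_mono E \<and> range E = S"
proof -
  have min_ex: "\<exists>x. x \<in> T \<and> (\<forall>y\<in>T. x \<le> y)" if T: "T \<subseteq> S" "T \<noteq> {}" for T
  proof -
    obtain t where t: "t \<in> T" using T by blast
    have "finite {x \<in> T. x \<le> t}" by (rule finite_subset[OF _ fin[of t]]) (use T in auto)
    then obtain m where m: "m \<in> T" "m \<le> t" "\<And>y. y \<in> T \<Longrightarrow> y \<le> t \<Longrightarrow> y \<le> m \<Longrightarrow> m = y"
      using finite_has_minimal2[of "{x \<in> T. x \<le> t}" t] t by auto
    have "m \<le> y" if "y \<in> T" for y using m(2) m(3)[OF that] by fastforce
    then show ?thesis using m(1) by blast
  qed
  define least where "least T = (SOME x. x \<in> T \<and> (\<forall>y\<in>T. x \<le> y))" for T :: "real set"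
  have least: "least T \<in> T" "\<And>y. y \<in> T \<Longrightarrow> least T \<le> y" if "T \<subseteq> S" "T \<noteq> {}" for T
    using someI_ex[OF min_ex[OF that]] unfolding least_def by auto
  have above: "{x \<in> S. x > c} \<noteq> {}" for c
  proof
    assume "{x \<in> S. x > c} = {}"
    then have "S = {x \<in> S. x \<le> c}" by force
    then show False using inf fin[of c] by simp
  qed
  define E where "E = rec_nat (least S) (\<lambda>_ c. least {x \<in> S. x > c})"
  have E: "E 0 = least S" "E (Suc n) = least {x \<in> S. x > E n}" for n by (simp_all add: E_def)
  have S0: "S \<noteq> {}" using inf by auto
  have E_Suc: "E (Suc n) \<in> {x \<in> S. x > E n}" for n
    unfolding E(2) by (rule least(1)[OF _ above]) auto
  have E_in: "E n \<in> S" for n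
    using E_Suc least(1)[OF order_refl S0] by (cases n) (auto simp: E(1))
  have mono: "strict_mono E" using E_Suc by (intro strict_monoI_Suc) simp
  have "S \<subseteq> range E"
  proof
    fix s assume s: "s \<in> S"
    show "s \<in> range E"
    proof (rule ccontr)
      assume ns: "s \<notin> range E"
      have "E n < s" for n
      proof (induction n)
        case 0
        then show ?case using least(2)[OF order_refl S0 s] ns by (metis E(1) order_le_less rangeI)
      next
        case (Suc n)
        have "E (Suc n) \<le> s" unfolding E(2) by (rule least(2)[OF _ above]) (use s Suc in auto)
        then show ?case using ns by (metis order_le_less rangeI)
      qed
      then have "range E \<subseteq> {x \<in> S. x \<le> s}" using E_in by (auto simp: less_imp_le)
      then have "finite (range E)" using fin[of s] finite_subset by blast
      then show False using mono by (simp add: finite_image_iff strict_mono_imp_inj_on)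
    qed
  qed
  then show ?thesis using mono E_in by blast
qed

section \<open>Discreteness of the spectrum\<close>

context potential
begin

text \<open>A value \<open>0\<close> of \<open>m\<close> does not tell a zero from a pole; the sign
  of the real slope \<open>a\<close> does.\<close>

lemma D_slope:
  assumes "D x = 0"
  obtains a where "((\<lambda>y. D y / (y - x)) \<longlongrightarrow> a) (at x)"
    and "a > 0 \<and> (\<exists>h>0. zero_slope h (of_real x)) \<or>
      a < 0 \<and> (\<exists>h<0. pole_slope h (of_real x))"
proof -
  have "m (of_real x) = 0" using assms by (simp add: D_eq_0_iff)
  from m_zero_cases[OF this] show ?thesis
  proof (elim disjE exE conjE)
    fix h :: real
    assume h: "h > 0" "zero_slope h (of_real x)"
    show ?thesis using that[OF D_derivative_zero[OF h]] h by blast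
  next
    fix h :: real
    assume h: "h < 0" "pole_slope h (of_real x)"
    have "1 / h < 0" using h by simp
    then show ?thesis using that[OF D_derivative_pole[OF h]] h by blast
  qed
qed

lemma D_zero_isolated: "\<forall>\<^sub>F y in at x. D y \<noteq> 0"
proof (cases "D x = 0")
  case True
  obtain a where a: "((\<lambda>y. D y / (y - x)) \<longlongrightarrow> a) (at x)" "a \<noteq> 0"
    by (rule D_slope[OF True]) auto
  have "\<forall>\<^sub>F y in at x. D y / (y - x) \<noteq> 0" using a by (rule tendsto_imp_eventually_ne)
  then show ?thesis by eventually_elim auto
next
  case False
  then have "isCont D x" by (intro D_continuous) (simp add: D_eq_0_iff)
  then show ?thesis using False by (intro tendsto_imp_eventually_ne) (auto simp: isCont_def)
qed

lemma eigenvalues_eq: "eigenvalues V = {x. D x = 0}"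
  by (auto simp: eigenvalues_iff D_eq_0_iff)

lemma D_neg_eventually: "\<exists>b. \<forall>x<b. D x < 0"
proof -
  obtain C where C: "C \<ge> 0"
    "\<And>k. k\<^sup>2 \<ge> C + 1 \<Longrightarrow> \<exists>y<0. m (- of_real (k\<^sup>2)) = of_real y \<and> k\<^sup>2 - C \<le> y\<^sup>2 \<and> y\<^sup>2 \<le> k\<^sup>2 + C"
    by (rule m_asymptotics) blast
  have "D x < 0" if x: "x < - (C + 1)" for x
  proof -
    have k: "(sqrt (- x))\<^sup>2 = - x" using x C(1) by simp
    obtain y where y: "y < 0" "m (- of_real (- x)) = of_real y" using C(2)[of "sqrt (- x)"] x unfolding k by auto
    have "Re (m (of_real x)) = y" using y(2) by simp
    moreover have "1 + y\<^sup>2 > 0" by (smt (verit) zero_le_power2)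
    ultimately show ?thesis using y(1) by (simp add: D_def divide_neg_pos)
  qed
  then show ?thesis by blast
qed

text \<open>Near minus infinity \<open>D\<close> is negative, so these eigenvalues lie in a compact
  interval. Infinitely many would accumulate at some point, but zeros of \<open>D\<close> are
  isolated, and no point of the line is a limit of them.\<close>

lemma finite_eigenvalues_le: "finite {x \<in> eigenvalues V. x \<le> c}"
proof (rule ccontr)
  assume inf: "infinite {x \<in> eigenvalues V. x \<le> c}"
  obtain b where b: "\<And>x. x < b \<Longrightarrow> D x < 0" using D_neg_eventually by blast
  have sub: "{x \<in> eigenvalues V. x \<le> c} \<subseteq> {b..c}"
  proof
    fix x assume x: "x \<in> {x \<in> eigenvalues V. x \<le> c}"
    then have "D x = 0" by (simp add: eigenvalues_eq)
    then have "\<not> x < b" using b[of x] by auto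
    then show "x \<in> {b..c}" using x by simp
  qed
  obtain x where "x islimpt {x \<in> eigenvalues V. x \<le> c}"
    using Heine_Borel_imp_Bolzano_Weierstrass[OF compact_Icc inf sub] by blast
  then have "\<exists>\<^sub>F y in at x. y \<in> {x \<in> eigenvalues V. x \<le> c}" by (simp add: islimpt_conv_frequently_at)
  then have "\<exists>\<^sub>F y in at x. D y = 0" by (rule frequently_elim1) (simp add: eigenvalues_eq)
  then show False using D_zero_isolated[of x] by (simp add: frequently_def)
qed

lemma D_sign_constant:
  assumes "x \<le> y" "\<And>t. t \<in> {x..y} \<Longrightarrow> D t \<noteq> 0"
  shows "D x > 0 \<longleftrightarrow> D y > 0"
proof -
  have cont: "continuous_on {x..y} D"
    using assms(2) by (intro continuous_at_imp_continuous_on ballI D_continuous) (simp add: D_eq_0_iff)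
  have "\<not> (D x > 0 \<and> D y < 0)" using IVT2'[of D y 0 x] cont assms by force
  moreover have "\<not> (D x < 0 \<and> D y > 0)" using IVT'[of D x 0 y] cont assms by force
  ultimately show ?thesis using assms(2)[of x] assms(2)[of y] assms(1) by force
qed

end

section \<open>Infinitely many eigenvalues\<close>

text \<open>With a limit at \<open>0\<close> the singularity is removable, and a limit
  \<open>0\<close> makes the extension vanish at least linearly. Tending to \<open>0\<close> along
  \<open>w\<close> more slowly than \<open>w\<close> itself, as a square root does, is therefore
  impossible.\<close>

lemma removable_zero_not_slow:
  fixes g :: "complex \<Rightarrow> complex" and w :: "real \<Rightarrow> complex"
  assumes M: "open M" "0 \<in> M" and g: "g holomorphic_on M - {0}" and l: "(g \<longlongrightarrow> l) (at 0)"
    and w: "filterlim w (at 0) at_top" and gw: "((\<lambda>k. g (w k)) \<longlongrightarrow> 0) at_top"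
    and slow: "filterlim (\<lambda>k. norm (g (w k) / w k)) at_top at_top"
  shows False
proof -
  have "((\<lambda>k. g (w k)) \<longlongrightarrow> l) at_top" by (rule filterlim_compose[OF l w])
  then have l0: "l = 0" using gw tendsto_unique by (metis trivial_limit_at_top_linorder)
  define F where "F z = (if z = 0 then 0 else g z)" for z
  have "(F \<longlongrightarrow> 0) (at 0)"
    using l unfolding l0 by (rule Lim_transform_eventually) (auto simp: F_def eventually_at_filter)
  then have "(F \<longlongrightarrow> 0) (at 0 within M)" by (rule tendsto_within_subset) simp
  then have F0: "(F \<longlongrightarrow> F z) (at z within M)" if "z \<in> {0}" for z using that by (simp add: F_def)
  have hol: "F holomorphic_on M - {0}" using g by (rule holomorphic_transform) (auto simp: F_def)
  have "F holomorphic_on M"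
    by (rule no_isolated_singularity'[OF F0 hol M(1)]) simp_all
  then obtain d where "(F has_field_derivative d) (at 0)"
    using M by (metis field_differentiable_def holomorphic_on_imp_differentiable_at)
  then have "((\<lambda>z. F z / z) \<longlongrightarrow> d) (at 0)" by (simp add: has_field_derivative_iff F_def)
  then have "((\<lambda>z. norm (g z / z)) \<longlongrightarrow> norm d) (at 0)"
    by (intro tendsto_norm, rule Lim_transform_eventually) (auto simp: F_def eventually_at_filter)
  then have "((\<lambda>k. norm (g (w k) / w k)) \<longlongrightarrow> norm d) at_top" by (rule filterlim_compose[OF _ w])
  then show False using slow not_tendsto_and_filterlim_at_infinity
    by (metis filterlim_at_top_imp_at_infinity trivial_limit_at_top_linorder)
qed

context potential
begin

text \<open>If there were finitely many eigenvalues, then \<open>m (1 / w)\<close> or \<open>w * m (1 / w)\<close>, depending on the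
  sign of \<open>m\<close> near \<open>+\<infinity>\<close>, would omit half a line near \<open>0\<close>, so it could not have an essential
  singularity there, while a square root growth of \<open>m\<close> rules out all other possibilities.\<close>

lemma infinite_eigenvalues: "infinite (eigenvalues V)"
proof
  assume fin: "finite (eigenvalues V)"
  then have "bounded (eigenvalues V)" by (rule finite_imp_bounded)
  then obtain b0 where "\<And>x. x \<in> eigenvalues V \<Longrightarrow> \<bar>x\<bar> \<le> b0" by (auto simp: bounded_iff)
  then obtain b where b: "b > 0" "\<And>x. x \<in> eigenvalues V \<Longrightarrow> \<bar>x\<bar> < b"
    by (metis abs_ge_self abs_ge_zero add.commute add_increasing2 le_less_trans less_add_one order_le_less_trans order_trans)
  have nz: "m z \<noteq> 0" if "norm z \<ge> b" for z
  proof
    assume "m z = 0"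
    then have "z = of_real (Re z)" using m_zero_real by (simp add: complex_eq_iff)
    then have "Re z \<in> eigenvalues V" "norm z = \<bar>Re z\<bar>"
      using \<open>m z = 0\<close> eigenvalues_iff[of "Re z"] norm_of_real[of "Re z"] by metis+
    then show False using b(2)[of "Re z"] that by simp
  qed
  have Dnz: "D x \<noteq> 0" if "\<bar>x\<bar> \<ge> b" for x using nz[of "of_real x"] that by (simp add: D_eq_0_iff)
  have sgn_D: "D x > 0 \<longleftrightarrow> Re (m (of_real x)) > 0" for x
  proof -
    have "1 + (Re (m (of_real x)))\<^sup>2 > 0" by (smt (verit) zero_le_power2)
    then show ?thesis by (simp add: D_def zero_less_divide_iff)
  qed
  have left: "Re (m (of_real x)) < 0" if "x \<le> - b" for x
  proof -
    obtain c where c: "\<And>x. x < c \<Longrightarrow> D x < 0" using D_neg_eventually by blast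
    define y where "y = min (c - 1) x"
    have "D y > 0 \<longleftrightarrow> D x > 0" by (rule D_sign_constant) (use Dnz that in \<open>auto simp: y_def\<close>)
    moreover have "D y < 0" by (rule c) (simp add: y_def)
    ultimately have "\<not> D x > 0" by simp
    then have "\<not> Re (m (of_real x)) > 0" unfolding sgn_D .
    moreover have "Re (m (of_real x)) \<noteq> 0" using Dnz[of x] that by (simp add: D_def)
    ultimately show ?thesis by simp
  qed
  have right: "Re (m (of_real x)) > 0 \<longleftrightarrow> Re (m (of_real b)) > 0" if "x \<ge> b" for x
    using D_sign_constant[of b x] Dnz that sgn_D b(1) by force
  define M where "M = ball (0::complex) (1 / b)"
  have M: "open M" "0 \<in> M" using b by (auto simp: M_def)
  have inv: "norm (inverse w) > b" if "w \<in> M - {0}" for w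
  proof -
    have "w \<noteq> 0" "norm w * b < 1" using that b(1) by (auto simp: M_def field_simps)
    then show ?thesis by (simp add: norm_inverse less_divide_eq mult.commute inverse_eq_divide norm_divide)
  qed
  have hol_m: "m holomorphic_on {z. norm z > b}"
    unfolding holomorphic_on_def
  proof
    fix z :: complex assume "z \<in> {z. norm z > b}"
    then have "m z \<noteq> 0" by (intro nz) auto
    then obtain e where "e > 0" "m holomorphic_on ball z e" by (rule m_holomorphic_near) blast
    then show "m field_differentiable at z within {z. norm z > b}"
      by (meson centre_in_ball field_differentiable_at_within holomorphic_on_imp_differentiable_at open_ball)
  qed
  define f where "f w = m (inverse w)" for w
  have hol_f: "f holomorphic_on M - {0}"
  proof -
    have "(m \<circ> inverse) holomorphic_on M - {0}"
      by (rule holomorphic_on_compose_gen[OF _ hol_m]) (use inv in \<open>auto intro!: holomorphic_intros\<close>)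
    then show ?thesis by (simp add: f_def[abs_def] o_def)
  qed
  have f_nz: "f w \<noteq> 0" if "w \<in> M - {0}" for w
    unfolding f_def by (intro nz less_imp_le inv that)
  obtain C where C: "C \<ge> 0"
    "\<And>k. k\<^sup>2 \<ge> C + 1 \<Longrightarrow> \<exists>y<0. m (- of_real (k\<^sup>2)) = of_real y \<and> k\<^sup>2 - C \<le> y\<^sup>2 \<and> y\<^sup>2 \<le> k\<^sup>2 + C"
    by (rule m_asymptotics) blast
  \<comment> \<open>The inverse of \<open>w k\<close> is \<open>- k^2\<close>, so along this path
    \<open>norm (f (w k))\<close> is asymptotic to \<open>k\<close>, the power \<open>- 1/2\<close>
    of \<open>norm (w k)\<close>.\<close>
  define w where "w k = complex_of_real (- (1 / k\<^sup>2))" for k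
  have w_lim: "filterlim w (at 0) at_top"
  proof -
    have "((\<lambda>k::real. - (1 / k\<^sup>2)) \<longlongrightarrow> 0) at_top" by real_asymp
    then have "(w \<longlongrightarrow> of_real 0) at_top" unfolding w_def by (rule tendsto_of_real)
    moreover have "\<forall>\<^sub>F k in at_top. w k \<noteq> 0"
      using eventually_gt_at_top[of 0] by eventually_elim (simp add: w_def)
    ultimately show ?thesis by (simp add: filterlim_at)
  qed
  have fw: "sqrt (k\<^sup>2 - C) \<le> norm (f (w k)) \<and> norm (f (w k)) \<le> sqrt (k\<^sup>2 + C)" if k: "k \<ge> C + 1" for k
  proof -
    have "k * 1 \<le> k * k" using k C(1) by (intro mult_left_mono) auto
    then have "k\<^sup>2 \<ge> C + 1" using k by (simp add: power2_eq_square)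
    then obtain y where y: "m (- of_real (k\<^sup>2)) = of_real y" "k\<^sup>2 - C \<le> y\<^sup>2" "y\<^sup>2 \<le> k\<^sup>2 + C" using C(2) by blast
    have "inverse (w k) = - of_real (k\<^sup>2)" by (simp add: w_def inverse_eq_divide)
    then have "norm (f (w k)) = sqrt (y\<^sup>2)" using y(1) by (simp add: f_def)
    then show ?thesis using y(2,3) by (simp del: real_sqrt_abs)
  qed
  have ev_k: "\<forall>\<^sub>F k in at_top. k \<ge> C + 1" by (rule eventually_ge_at_top)
  have lim1: "filterlim (\<lambda>k. norm (f (w k))) at_top at_top"
  proof (rule filterlim_at_top_mono)
    show "filterlim (\<lambda>k. sqrt (k\<^sup>2 - C)) at_top at_top" by real_asymp
    show "\<forall>\<^sub>F k in at_top. sqrt (k\<^sup>2 - C) \<le> norm (f (w k))" using ev_k by eventually_elim (use fw in blast)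
  qed
  have lim2: "((\<lambda>k. norm (f (w k)) / k\<^sup>2) \<longlongrightarrow> 0) at_top"
  proof (rule tendsto_sandwich[of "\<lambda>_. 0"])
    show "\<forall>\<^sub>F k in at_top. norm (f (w k)) / k\<^sup>2 \<le> sqrt (k\<^sup>2 + C) / k\<^sup>2"
      using ev_k by eventually_elim (use fw in \<open>auto intro!: divide_right_mono\<close>)
    show "((\<lambda>k. sqrt (k\<^sup>2 + C) / k\<^sup>2) \<longlongrightarrow> 0) at_top" by real_asymp
  qed auto
  have lim3: "filterlim (\<lambda>k. k\<^sup>2 / norm (f (w k))) at_top at_top"
  proof (rule filterlim_at_top_mono)
    show "filterlim (\<lambda>k. k\<^sup>2 / sqrt (k\<^sup>2 + C)) at_top at_top" by real_asymp
    have "\<forall>\<^sub>F k in at_top. norm (f (w k)) > 0" using lim1[unfolded filterlim_at_top_dense] by blast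
    then show "\<forall>\<^sub>F k in at_top. k\<^sup>2 / sqrt (k\<^sup>2 + C) \<le> k\<^sup>2 / norm (f (w k))"
      using ev_k
    proof eventually_elim
      case (elim k)
      have le: "norm (f (w k)) \<le> sqrt (k\<^sup>2 + C)" using fw[OF elim(2)] by blast
      then have "sqrt (k\<^sup>2 + C) > 0" using elim(1) by linarith
      then show ?case using le elim(1) by (intro divide_left_mono mult_pos_pos) auto
    qed
  qed
  have no_limit: False
    if "(g \<longlongrightarrow> l) (at 0)" "filterlim (\<lambda>k. norm (g (w k))) at_top at_top" for g :: "complex \<Rightarrow> complex" and l
  proof -
    have "((\<lambda>k. norm (g (w k))) \<longlongrightarrow> norm l) at_top"
      by (intro tendsto_norm filterlim_compose[OF that(1) w_lim])
    then show False using that(2) not_tendsto_and_filterlim_at_infinity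
      by (metis filterlim_at_top_imp_at_infinity trivial_limit_at_top_linorder)
  qed
  show False
  proof (cases "Re (m (of_real b)) > 0")
    \<comment> \<open>Here \<open>m\<close> is negative on the real line outside the spectrum's
      bound \<open>b\<close> on both sides, and off the real line it takes no real value, so
      \<open>f\<close> omits all positive numbers; \<open>1\<close> and \<open>2\<close> are enough
      for Picard's theorem.\<close>
    case False
    have real_neg: "Re (f u) < 0" if u: "u \<in> M - {0}" "Im u = 0" for u
    proof -
      define x where "x = 1 / Re u"
      have ux: "inverse u = of_real x" using u(2) by (simp add: x_def complex_eq_iff Re_inverse Im_inverse power2_eq_square)
      have "\<bar>x\<bar> > b" using inv[OF u(1)] unfolding ux by simp
      then consider "x \<ge> b" | "x \<le> - b" by linarith
      then have "\<not> Re (m (of_real x)) > 0" by cases (use left[of x] right[of x] False in auto)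
      moreover have "Re (m (of_real x)) \<noteq> 0" using Dnz[of x] \<open>\<bar>x\<bar> > b\<close> by (simp add: D_def)
      ultimately show ?thesis by (simp add: f_def ux)
    qed
    have avoid: "f u \<noteq> of_real c" if u: "u \<in> M - {0}" and c: "c > 0" for u and c :: real
    proof
      assume eq: "f u = of_real c"
      then have "Im (inverse u) = 0"
        using m_Im_pos[of "inverse u"] m_Im_neg[of "inverse u"] by (cases "Im (inverse u)" "0::real" rule: linorder_cases) (auto simp: f_def)
      then have "Im u = 0" using u by (auto simp: Im_inverse)
      then show False using real_neg[OF u] eq c by simp
    qed
    have avoid12: "f u \<noteq> 1 \<and> f u \<noteq> 2" if "u \<in> M - {0}" for u
      using avoid[OF that, of 1] avoid[OF that, of 2] by simp
    have "(1::complex) \<noteq> 2" by simp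
    then obtain l where "(f \<longlongrightarrow> l) (at 0) \<or> ((inverse \<circ> f) \<longlongrightarrow> l) (at 0)"
      using great_Picard[OF M _ hol_f avoid12] by blast
    then have l: "((inverse \<circ> f) \<longlongrightarrow> l) (at 0)" using no_limit[OF _ lim1] by blast
    show False
    proof (rule removable_zero_not_slow[OF M _ l w_lim])
      show "(inverse \<circ> f) holomorphic_on M - {0}"
        unfolding o_def by (intro holomorphic_on_inverse hol_f f_nz)
      show "((\<lambda>k. (inverse \<circ> f) (w k)) \<longlongrightarrow> 0) at_top"
        unfolding o_def by (intro tendsto_inverse_0[THEN filterlim_compose] filterlim_norm_at_top_imp_at_infinity lim1)
      show "filterlim (\<lambda>k. norm ((inverse \<circ> f) (w k) / w k)) at_top at_top"
        using lim3 by (simp add: norm_divide norm_inverse norm_mult w_def norm_power divide_inverse mult.commute)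
    qed
  next
    case True
    \<comment> \<open>Now \<open>m\<close> has opposite signs at the two ends, and the factor
      \<open>u\<close> makes \<open>h\<close> positive on the real axis. A value \<open>- c\<close>
      of \<open>h\<close> at a nonreal \<open>u\<close> would give \<open>m (inverse u)\<close> an
      imaginary part of the wrong sign. Along \<open>w\<close> the size of \<open>h\<close> is about
      \<open>1 / k\<close>, again a square root.\<close>
    define h where "h u = u * f u" for u
    have hol_h: "h holomorphic_on M - {0}" unfolding h_def by (intro holomorphic_intros hol_f)
    have real_pos: "Re (h u) > 0" if u: "u \<in> M - {0}" "Im u = 0" for u
    proof -
      define x where "x = 1 / Re u"
      have ux: "inverse u = of_real x" using u(2) by (simp add: x_def complex_eq_iff Re_inverse Im_inverse power2_eq_square)
      have hu: "Re (h u) = Re u * Re (m (of_real x))"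
        using u(2) by (simp add: h_def f_def ux)
      have "\<bar>x\<bar> > b" using inv[OF u(1)] unfolding ux by simp
      then consider "x \<ge> b" | "x \<le> - b" by linarith
      then show ?thesis
      proof cases
        case 1
        then have "x > 0" using b(1) by linarith
        then have "Re u > 0" by (simp add: x_def)
        then show ?thesis unfolding hu using right[OF 1] True by simp
      next
        case 2
        then have "x < 0" using b(1) by linarith
        then have "Re u < 0" by (simp add: x_def)
        then show ?thesis unfolding hu using left[OF 2] by (simp add: mult_neg_neg)
      qed
    qed
    have avoid: "h u \<noteq> of_real (- c)" if u: "u \<in> M - {0}" and c: "c > 0" for u and c :: real
    proof
      assume eq: "h u = of_real (- c)"
      have "m (inverse u) = of_real (- c) * inverse u"
        using eq u by (simp add: h_def f_def field_simps)
      then have *: "Im (m (inverse u)) = - (c * Im (inverse u))" by simp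
      have "Im (inverse u) = 0"
      proof (cases "Im (inverse u)" "0::real" rule: linorder_cases)
        case less
        show ?thesis using mult_pos_neg[OF c less] m_Im_neg[OF less] * by linarith
      next
        case greater
        show ?thesis using mult_pos_pos[OF c greater] m_Im_pos[OF greater] * by linarith
      qed
      then have "Im u = 0" using u by (auto simp: Im_inverse)
      then show False using real_pos[OF u] eq c by simp
    qed
    have norm_h: "norm (h (w k)) = norm (f (w k)) / k\<^sup>2" for k
    proof -
      have "norm (w k) = 1 / k\<^sup>2" unfolding w_def norm_of_real by simp
      then show ?thesis by (simp add: h_def norm_mult)
    qed
    have avoid12: "h u \<noteq> - 1 \<and> h u \<noteq> - 2" if "u \<in> M - {0}" for u
      using avoid[OF that, of 1] avoid[OF that, of 2] by simp
    have "(- 1::complex) \<noteq> - 2" by simp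
    then obtain l where "(h \<longlongrightarrow> l) (at 0) \<or> ((inverse \<circ> h) \<longlongrightarrow> l) (at 0)"
      using great_Picard[OF M _ hol_h avoid12] by blast
    moreover have "filterlim (\<lambda>k. norm ((inverse \<circ> h) (w k))) at_top at_top"
      using lim3 by (simp add: norm_inverse norm_h)
    ultimately have l: "(h \<longlongrightarrow> l) (at 0)" using no_limit by blast
    show False
    proof (rule removable_zero_not_slow[OF M hol_h l w_lim])
      show "((\<lambda>k. h (w k)) \<longlongrightarrow> 0) at_top"
        using lim2 unfolding norm_h[symmetric] by (rule tendsto_norm_zero_cancel)
      have "\<forall>\<^sub>F k in at_top. norm (f (w k)) = norm (h (w k) / w k)"
        using eventually_gt_at_top[of 0] by eventually_elim (simp add: h_def w_def)
      then show "filterlim (\<lambda>k. norm (h (w k) / w k)) at_top at_top"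
        using lim1 by (simp add: filterlim_cong)
    qed
  qed
qed

text \<open>Gives the definite description its meaning: an infinite set that is finite below every
  bound has exactly one increasing enumeration. Equal sequences thereby become equal
  spectra.\<close>

lemma eigenvalue_seq: "strict_mono (eigenvalue_seq V)" "range (eigenvalue_seq V) = eigenvalues V"
proof -
  obtain E :: "nat \<Rightarrow> real" where E: "strict_mono E" "range E = eigenvalues V"
    using strict_mono_enumeration_exists[OF infinite_eigenvalues finite_eigenvalues_le] by blast
  have "\<exists>!E :: nat \<Rightarrow> real. strict_mono E \<and> range E = eigenvalues V"
    by (rule ex1I[of _ E]) (use E strict_mono_enumeration_unique in auto)
  from theI'[OF this] show "strict_mono (eigenvalue_seq V)" "range (eigenvalue_seq V) = eigenvalues V"
    unfolding eigenvalue_seq_def by auto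
qed

end

section \<open>Isospectral potentials have the same Weyl function\<close>

context two_potentials
begin

context
  assumes spec: "eigenvalues V = eigenvalues W"
begin

lemma m_zero_iff: "V.m z = 0 \<longleftrightarrow> W.m z = 0"
proof -
  have *: "V.m (of_real x) = 0 \<longleftrightarrow> W.m (of_real x) = 0" for x
    using V.eigenvalues_iff[of x] W.eigenvalues_iff[of x] spec by simp
  have "z = of_real (Re z)" if "Im z = 0" using that by (simp add: complex_eq_iff)
  then show ?thesis using *[of "Re z"] V.m_zero_real[of z] W.m_zero_real[of z] by metis
qed

lemma D_zero_iff: "V.D x = 0 \<longleftrightarrow> W.D x = 0"
  using m_zero_iff by (simp add: V.D_eq_0_iff W.D_eq_0_iff)

lemma D_ratio_limit:
  assumes "V.D x = 0"
    and a: "((\<lambda>y. V.D y / (y - x)) \<longlongrightarrow> a) (at x)" and b: "((\<lambda>y. W.D y / (y - x)) \<longlongrightarrow> b) (at x)" "b \<noteq> 0"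
  shows "((\<lambda>y. V.D y / W.D y) \<longlongrightarrow> a / b) (at x)"
  using tendsto_divide[OF a b]
  by (rule Lim_transform_eventually) (auto simp: eventually_at_filter)

text \<open>Extended by the ratio of slopes at the common zeros, the quotient of the two functions
  \<open>D\<close> is continuous without zeros, and near minus infinity both are negative; so it is
  positive everywhere. At a common zero this means that both slopes have the same sign.\<close>

lemma D_same_sign: "V.D x \<noteq> 0 \<Longrightarrow> V.D x / W.D x > 0"
  and D_same_slope: "V.D x = 0 \<Longrightarrow> ((\<lambda>y. V.D y / (y - x)) \<longlongrightarrow> a) (at x) \<Longrightarrow>
    ((\<lambda>y. W.D y / (y - x)) \<longlongrightarrow> b) (at x) \<Longrightarrow> b \<noteq> 0 \<Longrightarrow> a \<noteq> 0 \<Longrightarrow> a / b > 0"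
proof -
  define r where "r x = (if V.D x = 0 then Lim (at x) (\<lambda>y. V.D y / W.D y) else V.D x / W.D x)" for x
  have r_lim: "r x = a / b" if "V.D x = 0" "((\<lambda>y. V.D y / (y - x)) \<longlongrightarrow> a) (at x)"
    "((\<lambda>y. W.D y / (y - x)) \<longlongrightarrow> b) (at x)" "b \<noteq> 0" for x a b
    using tendsto_Lim[OF _ D_ratio_limit[OF that]] that(1) by (simp add: r_def)
  have r_ev: "\<forall>\<^sub>F y in at x. V.D y / W.D y = r y" for x
    using V.D_zero_isolated[of x] by eventually_elim (simp add: r_def)
  have r_ne_cont: "r x \<noteq> 0 \<and> isCont r x" for x
  proof (cases "V.D x = 0")
    case True
    obtain a where a: "((\<lambda>y. V.D y / (y - x)) \<longlongrightarrow> a) (at x)" "a \<noteq> 0"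
      by (rule V.D_slope[OF True]) auto
    obtain b where b: "((\<lambda>y. W.D y / (y - x)) \<longlongrightarrow> b) (at x)" "b \<noteq> 0"
      by (rule W.D_slope[of x]) (use True D_zero_iff in auto)
    have rx: "r x = a / b" using r_lim True a b by blast
    have "(r \<longlongrightarrow> a / b) (at x)"
      using D_ratio_limit[OF True a(1) b] r_ev by (rule Lim_transform_eventually)
    then show ?thesis using rx a(2) b(2) by (simp add: isCont_def)
  next
    case False
    have W0: "W.D x \<noteq> 0" using False D_zero_iff by simp
    have "isCont (\<lambda>y. V.D y / W.D y) x"
      by (intro continuous_intros V.D_continuous W.D_continuous)
        (use False W0 in \<open>auto simp: V.D_eq_0_iff W.D_eq_0_iff\<close>)
    then have "((\<lambda>y. V.D y / W.D y) \<longlongrightarrow> r x) (at x)" using False by (simp add: isCont_def r_def)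
    then have "(r \<longlongrightarrow> r x) (at x)" using r_ev by (rule Lim_transform_eventually)
    then show ?thesis using False W0 by (simp add: isCont_def r_def)
  qed
  obtain b1 where b1: "\<And>x. x < b1 \<Longrightarrow> V.D x < 0" using V.D_neg_eventually by blast
  obtain b2 where b2: "\<And>x. x < b2 \<Longrightarrow> W.D x < 0" using W.D_neg_eventually by blast
  have r_pos: "r x > 0" for x
  proof (rule ccontr)
    assume "\<not> r x > 0"
    define y where "y = min (min (b1 - 1) (b2 - 1)) x"
    have "V.D y < 0" "W.D y < 0" using b1[of y] b2[of y] by (auto simp: y_def)
    then have "r y > 0" by (simp add: r_def divide_neg_neg)
    have "\<exists>t\<ge>y. t \<le> x \<and> r t = 0"
      by (rule IVT2[of r]) (use \<open>r y > 0\<close> \<open>\<not> r x > 0\<close> r_ne_cont in \<open>auto simp: y_def\<close>)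
    then show False using r_ne_cont by blast
  qed
  show "V.D x / W.D x > 0" if "V.D x \<noteq> 0" using r_pos[of x] that by (simp add: r_def)
  show "a / b > 0" if "V.D x = 0" "((\<lambda>y. V.D y / (y - x)) \<longlongrightarrow> a) (at x)"
    "((\<lambda>y. W.D y / (y - x)) \<longlongrightarrow> b) (at x)" "b \<noteq> 0" "a \<noteq> 0"
    using r_pos[of x] r_lim[OF that(1-4)] by simp
qed

text \<open>Equal signs of the slopes make \<open>z\<close> a simple zero of both Weyl functions or
  a simple pole of both. The factor \<open>w - z\<close> cancels, and the limit is a quotient of two
  slopes, or two residues, of the same sign.\<close>

lemma m_ratio_limit:
  assumes "V.m z = 0"
  obtains h where "h > 0" "((\<lambda>w. V.m w / W.m w) \<longlongrightarrow> complex_of_real h) (at z)"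
proof -
  define x where "x = Re z"
  have z: "z = of_real x" using V.m_zero_real[OF assms] by (simp add: x_def complex_eq_iff)
  have Dx: "V.D x = 0" "W.D x = 0" using assms m_zero_iff[of z] by (auto simp: V.D_eq_0_iff W.D_eq_0_iff z)
  obtain a where a: "((\<lambda>y. V.D y / (y - x)) \<longlongrightarrow> a) (at x)"
    "a > 0 \<and> (\<exists>h>0. V.zero_slope h z) \<or>
     a < 0 \<and> (\<exists>h<0. V.pole_slope h z)"
    unfolding z by (rule V.D_slope[OF Dx(1)])
  obtain b where b: "((\<lambda>y. W.D y / (y - x)) \<longlongrightarrow> b) (at x)"
    "b > 0 \<and> (\<exists>h>0. W.zero_slope h z) \<or>
     b < 0 \<and> (\<exists>h<0. W.pole_slope h z)"
    unfolding z by (rule W.D_slope[OF Dx(2)])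
  have "a / b > 0" by (rule D_same_slope[OF Dx(1) a(1) b(1)]) (use a(2) b(2) in auto)
  then consider "a > 0" "b > 0" | "a < 0" "b < 0" by (auto simp: zero_less_divide_iff)
  then show ?thesis
  proof cases
    case 1
    obtain h1 where h1: "h1 > 0" "V.zero_slope h1 z" using a(2) 1 by auto
    obtain h2 where h2: "h2 > 0" "W.zero_slope h2 z" using b(2) 1 by auto
    have "((\<lambda>w. (V.m w / (w - z)) / (W.m w / (w - z))) \<longlongrightarrow> of_real h1 / of_real h2) (at z)"
      using h1 h2 by (intro tendsto_divide) auto
    then have "((\<lambda>w. V.m w / W.m w) \<longlongrightarrow> of_real h1 / of_real h2) (at z)"
      by (rule Lim_transform_eventually) (auto simp: eventually_at_filter)
    then show ?thesis using that[of "h1 / h2"] h1 h2 by simp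
  next
    case 2
    obtain h1 where h1: "h1 < 0" "V.pole_slope h1 z" using a(2) 2 by auto
    obtain h2 where h2: "h2 < 0" "W.pole_slope h2 z" using b(2) 2 by auto
    have "((\<lambda>w. (V.m w * (w - z)) / (W.m w * (w - z))) \<longlongrightarrow> of_real h1 / of_real h2) (at z)"
      using h1 h2 by (intro tendsto_divide) auto
    then have "((\<lambda>w. V.m w / W.m w) \<longlongrightarrow> of_real h1 / of_real h2) (at z)"
      by (rule Lim_transform_eventually) (auto simp: eventually_at_filter)
    then show ?thesis using that[of "h1 / h2"] h1 h2 by (simp add: divide_neg_neg)
  qed
qed

text \<open>The quotient of the Weyl functions extends to an entire function without zeros.  It avoids the
  negative reals, because both Weyl functions map each half plane into itself.\<close>

lemma m_ratio_constant:
  obtains c where "\<And>z. V.m z \<noteq> 0 \<Longrightarrow> V.m z = c * W.m z"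
proof -
  define q where "q z = (if V.m z = 0 then Lim (at z) (\<lambda>w. V.m w / W.m w) else V.m z / W.m z)" for z
  have q_pos: "\<exists>h>0. q z = of_real h \<and> ((\<lambda>w. V.m w / W.m w) \<longlongrightarrow> q z) (at z)" if z: "V.m z = 0" for z
  proof -
    obtain h where "h > 0" "((\<lambda>w. V.m w / W.m w) \<longlongrightarrow> complex_of_real h) (at z)" by (rule m_ratio_limit[OF z])
    then show ?thesis using tendsto_Lim[of "at z" "\<lambda>w. V.m w / W.m w"] z by (auto simp: q_def)
  qed
  have q_diff: "q field_differentiable at z" if z: "V.m z \<noteq> 0" for z
  proof -
    obtain e1 where e1: "e1 > 0" "V.m holomorphic_on ball z e1" "\<And>w. w \<in> ball z e1 \<Longrightarrow> V.m w \<noteq> 0"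
      by (rule V.m_holomorphic_near[OF z]) blast
    obtain e2 where e2: "e2 > 0" "W.m holomorphic_on ball z e2" "\<And>w. w \<in> ball z e2 \<Longrightarrow> W.m w \<noteq> 0"
      by (rule W.m_holomorphic_near[of z]) (use z m_zero_iff in blast)+
    define e where "e = min e1 e2"
    have "(\<lambda>w. V.m w / W.m w) holomorphic_on ball z e"
      by (intro holomorphic_on_divide holomorphic_on_subset[OF e1(2)] holomorphic_on_subset[OF e2(2)] e2(3))
        (auto simp: e_def)
    then have "q holomorphic_on ball z e"
      by (rule holomorphic_transform) (use e1(3) in \<open>auto simp: q_def e_def\<close>)
    then show ?thesis using e1(1) e2(1) by (intro holomorphic_on_imp_differentiable_at[of _ "ball z e"]) (auto simp: e_def)
  qed
  have "q field_differentiable at z" for z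
  proof (cases "V.m z = 0")
    case True
    obtain e where e: "e > 0" "\<And>w. w \<in> ball z e \<Longrightarrow> w \<noteq> z \<Longrightarrow> V.m w \<noteq> 0"
      using V.m_zero_isolated[OF True] by (auto simp: eventually_at dist_commute)
    have "\<forall>\<^sub>F w in at z. V.m w / W.m w = q w"
      using V.m_zero_isolated[OF True] by eventually_elim (simp add: q_def)
    then have "(q \<longlongrightarrow> q z) (at z)"
      using q_pos[OF True] Lim_transform_eventually by blast
    then have "(q \<longlongrightarrow> q z) (at z within ball z e)" by (rule tendsto_within_subset) simp
    then have lim: "(q \<longlongrightarrow> q w) (at w within ball z e)" if "w \<in> {z}" for w using that by simp
    have hol: "q holomorphic_on ball z e - {z}"
      unfolding holomorphic_on_def
    proof
      fix w assume "w \<in> ball z e - {z}"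
      then have "V.m w \<noteq> 0" using e(2) by blast
      then show "q field_differentiable at w within ball z e - {z}"
        by (rule field_differentiable_at_within[OF q_diff])
    qed
    have "q holomorphic_on ball z e"
      by (rule no_isolated_singularity'[OF lim hol open_ball]) simp_all
    then show ?thesis using e(1) by (intro holomorphic_on_imp_differentiable_at[of _ "ball z e"]) auto
  qed (rule q_diff)
  then have hol: "q holomorphic_on UNIV" by (simp add: holomorphic_on_def)
  have avoid: "q z \<noteq> 0 \<and> q z \<noteq> - 1" for z
  proof (cases "V.m z = 0")
    case True
    then obtain h where "h > 0" "q z = of_real h" using q_pos by blast
    moreover have "of_real h \<noteq> (- 1 :: complex)" if "h > 0"
      using that of_real_eq_iff[of h "- 1", where 'a = complex] by auto
    ultimately show ?thesis by auto
  next
    case False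
    then have W0: "W.m z \<noteq> 0" using m_zero_iff by simp
    have q_eq: "q z = V.m z / W.m z" using False by (simp add: q_def)
    have "V.m z \<noteq> - W.m z"
    proof
      assume eq: "V.m z = - W.m z"
      show False
      proof (cases "Im z" "0::real" rule: linorder_cases)
        case less
        then show False using V.m_Im_neg[OF less] W.m_Im_neg[OF less] eq by simp
      next
        case greater
        then show False using V.m_Im_pos[OF greater] W.m_Im_pos[OF greater] eq by simp
      next
        \<comment> \<open>On the real axis the imaginary parts carry no information. As
          \<open>D\<close> is an odd function of the value of \<open>m\<close>, opposite values of
          the Weyl functions would give \<open>D\<close> opposite signs.\<close>
        case equal
        define x where "x = Re z"
        have z: "z = of_real x" using equal by (simp add: x_def complex_eq_iff)
        have "V.D x = - W.D x" using eq by (simp add: V.D_def W.D_def z)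
        moreover have "V.D x \<noteq> 0" using False by (simp add: V.D_eq_0_iff z)
        ultimately show False using D_same_sign[of x] by (auto simp: zero_less_divide_iff)
      qed
    qed
    then show ?thesis using False W0 by (simp add: q_eq divide_eq_eq)
  qed
  have "0 \<notin> range q" "- 1 \<notin> range q" using avoid by (metis imageE)+
  then have "range q \<inter> {0, - 1} = {}" by simp
  then obtain c where c: "q = (\<lambda>z. c)"
    using little_Picard[OF hol, of 0 "- 1"] by auto
  have "V.m z = c * W.m z" if "V.m z \<noteq> 0" for z
  proof -
    have "V.m z / W.m z = c" using fun_cong[OF c, of z] that by (simp add: q_def)
    then show ?thesis using that m_zero_iff[of z] by (simp add: divide_eq_eq split: if_splits)
  qed
  then show ?thesis by (rule that)
qed

text \<open>On the negative axis both Weyl functions are negative reals \<open>y1\<close>,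
  \<open>y2\<close> with squares \<open>k^2 + O(1)\<close>. So the constant is the positive number
  \<open>y1 / y2\<close>, and its square, being independent of \<open>k\<close>, equals its limit
  \<open>1\<close>.\<close>

lemma m_eq_near_minus_infinity:
  obtains r where "\<And>k. k \<ge> r \<Longrightarrow> V.m (- of_real (k\<^sup>2)) = W.m (- of_real (k\<^sup>2))"
proof -
  obtain c where c: "\<And>z. V.m z \<noteq> 0 \<Longrightarrow> V.m z = c * W.m z" by (rule m_ratio_constant) blast
  obtain C1 where C1: "C1 \<ge> 0" "\<And>k. k\<^sup>2 \<ge> C1 + 1 \<Longrightarrow>
      \<exists>y<0. V.m (- of_real (k\<^sup>2)) = of_real y \<and> k\<^sup>2 - C1 \<le> y\<^sup>2 \<and> y\<^sup>2 \<le> k\<^sup>2 + C1"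
    by (rule V.m_asymptotics) blast
  obtain C2 where C2: "C2 \<ge> 0" "\<And>k. k\<^sup>2 \<ge> C2 + 1 \<Longrightarrow>
      \<exists>y<0. W.m (- of_real (k\<^sup>2)) = of_real y \<and> k\<^sup>2 - C2 \<le> y\<^sup>2 \<and> y\<^sup>2 \<le> k\<^sup>2 + C2"
    by (rule W.m_asymptotics) blast
  define r where "r = C1 + C2 + 1"
  have ratio: "\<exists>y1 y2. y1 < 0 \<and> y2 < 0 \<and> V.m (- of_real (k\<^sup>2)) = of_real y1 \<and> W.m (- of_real (k\<^sup>2)) = of_real y2
      \<and> c = of_real (y1 / y2) \<and> \<bar>(y1 / y2)\<^sup>2 - 1\<bar> \<le> (C1 + C2) / (k\<^sup>2 - C2)" if k: "k \<ge> r" for k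
  proof -
    have "k * 1 \<le> k * k" using k C1(1) C2(1) by (intro mult_left_mono) (auto simp: r_def)
    then have "k \<le> k\<^sup>2" by (simp add: power2_eq_square)
    then have k2: "k\<^sup>2 \<ge> C1 + 1" "k\<^sup>2 \<ge> C2 + 1" using k C1(1) C2(1) unfolding r_def by linarith+
    obtain y1 where y1: "y1 < 0" "V.m (- of_real (k\<^sup>2)) = of_real y1" "k\<^sup>2 - C1 \<le> y1\<^sup>2" "y1\<^sup>2 \<le> k\<^sup>2 + C1"
      using C1(2)[OF k2(1)] by blast
    obtain y2 where y2: "y2 < 0" "W.m (- of_real (k\<^sup>2)) = of_real y2" "k\<^sup>2 - C2 \<le> y2\<^sup>2" "y2\<^sup>2 \<le> k\<^sup>2 + C2"
      using C2(2)[OF k2(2)] by blast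
    have "V.m (- of_real (k\<^sup>2)) = c * W.m (- of_real (k\<^sup>2))" by (rule c) (use y1 in simp)
    then have "c = of_real (y1 / y2)" using y1 y2 by (simp add: field_simps)
    moreover have "\<bar>(y1 / y2)\<^sup>2 - 1\<bar> \<le> (C1 + C2) / (k\<^sup>2 - C2)"
    proof -
      have p: "y2\<^sup>2 > 0" using y2(1) by simp
      have "\<bar>(y1 / y2)\<^sup>2 - 1\<bar> = \<bar>(y1\<^sup>2 - y2\<^sup>2) / y2\<^sup>2\<bar>" using p by (simp add: power_divide diff_divide_distrib)
      also have "\<dots> = \<bar>y1\<^sup>2 - y2\<^sup>2\<bar> / y2\<^sup>2" by simp
      also have "\<dots> \<le> (C1 + C2) / (k\<^sup>2 - C2)"
        by (intro frac_le) (use y1 y2 k2 C1(1) C2(1) in auto)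
      finally show ?thesis .
    qed
    ultimately show ?thesis using y1 y2 by blast
  qed
  obtain y1 y2 where y: "y1 < 0" "y2 < 0" "c = of_real (y1 / y2)" using ratio[of r] by blast
  have "\<bar>(y1 / y2)\<^sup>2 - 1\<bar> \<le> 0"
  proof (rule tendsto_lowerbound)
    show "((\<lambda>k. (C1 + C2) / (k\<^sup>2 - C2)) \<longlongrightarrow> 0) at_top" by real_asymp
    show "\<forall>\<^sub>F k in at_top. \<bar>(y1 / y2)\<^sup>2 - 1\<bar> \<le> (C1 + C2) / (k\<^sup>2 - C2)"
      using eventually_ge_at_top[of r]
    proof eventually_elim
      case (elim k)
      obtain z1 z2 where z: "c = of_real (z1 / z2)" "\<bar>(z1 / z2)\<^sup>2 - 1\<bar> \<le> (C1 + C2) / (k\<^sup>2 - C2)"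
        using ratio[OF elim] by blast
      have "y1 / y2 = z1 / z2" using y(3) z(1) of_real_eq_iff by metis
      then show ?case using z(2) by simp
    qed
  qed simp
  then have "(y1 / y2)\<^sup>2 = 1" by simp
  moreover have "y1 / y2 > 0" using y by (simp add: divide_neg_neg)
  ultimately have "y1 / y2 = 1" by (auto simp: power2_eq_1_iff)
  then have c1: "c = 1" using y(3) by simp
  show ?thesis
  proof (rule that)
    fix k assume "k \<ge> r"
    from ratio[OF this] have "V.m (- of_real (k\<^sup>2)) \<noteq> 0" by auto
    then show "V.m (- of_real (k\<^sup>2)) = W.m (- of_real (k\<^sup>2))" using c c1 by simp
  qed
qed

lemma isospectral_eq: "V = W"
  by (rule m_eq_near_minus_infinity) (rule borg_marchenko)

end

end

theorem theorem4:
  fixes V W :: "real \<Rightarrow> real"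
  assumes "continuous_on UNIV V" and "continuous_on UNIV W"
    and "bdd_below (range V)" and "bdd_below (range W)"
    and "filterlim V at_top at_top" and "filterlim V at_top at_bot"
    and "filterlim W at_top at_top" and "filterlim W at_top at_bot"
    and "\<forall>x. V x = V (- x)" and "\<forall>x. W x = W (- x)"
    and "\<forall>n. eigenvalue_seq V n = eigenvalue_seq W n"
  shows "V = W"
proof -
  interpret two_potentials V W
    by unfold_locales (use assms in auto)
  have "eigenvalue_seq V = eigenvalue_seq W" using assms by auto
  then have "eigenvalues V = eigenvalues W"
    using V.eigenvalue_seq(2) W.eigenvalue_seq(2) by simp
  then show ?thesis by (rule isospectral_eq)
qed

end
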